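(* Let $V$ be a Hilbert space, let $A:\mathrm{Dom}\,A\subseteq V\to V$ and $B:\mathrm{Dom}\,B\subseteq V\to V$ be (possibly unbounded) linear operators, let $T>0$, let $p$ be an even positive integer, let $\pi=\{\pi_n\}_{n\in\mathbb{N}}$ be a sequence of finite partitions of $[0,T]$ whose mesh size tends to zero, and let $\omega:[0,T]\to\mathbb{R}$ be a continuous function with $\omega\in V_p(\pi)$. Assume: (h1) The $p$-th variation $[\omega]^\pi_p$ of $\omega$ is continuously differentiable on $[0,T]$ with derivative denoted by $\dot{[\omega]}^\pi_p$. (h2) $B$ is an infinitesimal generator of a strongly continuous group $G_B$ of bounded linear operators acting on $V$. (h3) For every $x\in\mathbb{R}$, $\|G_B(x)\|_{\mathscr{L}(V)}\le1$. Assume further that there exists a Hilbert space $Y$ that is continuously and densely embedded in $V$ such that: (h4) $Y$ is closed under the action of the group $G_B$, i.e. $G_B(x)Y\subseteq Y$ for every $x\in\mathbb{R}$. (h5) For every $x\in\mathbb{R}$, $\|G_B(x)\|_{\mathscr{L}(Y)}\le1$. Set $\mathrm{Dom}\,C:=\mathrm{Dom}\,A\cap\mathrm{Dom}\,B^p$ and $C(t):=A-\frac{1}{p!}\dot{[\omega]}^\pi_p(t)B^p$ on $\mathrm{Dom}\,C$ for $t\in[0,T]$, and assume moreover: (h6) $Y\subseteq\mathrm{Dom}\,C$ and the operator $C(t)$ is closed for every $t\in[0,T]$. (h7) There exists a constant $\lambda_1\in\mathbb{R}$ such that the resolvent set $\rho(C(t))$ contains the ray $(\lambda_1,\infty)$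 for every $t\in[0,T]$ and such that $\|R(\lambda:C(t))\|_{\mathscr{L}(V)}\le\frac{1}{\lambda-\lambda_1}$ for every $\lambda>\lambda_1$ and every $t\in[0,T]$. (h8) There exists an isomorphism $Q\in\mathscr{L}(Y;V)$ such that (a) for every $t\in[0,T]$, $C(t)Q^{-1}(\mathrm{Dom}\,C)\subseteq Y$; (b) for every $x\in\mathbb{R}$ and every $y\in Y$, $QG_B(x)y=G_B(x)Qy$; and there exists a strongly continuous function $L:[0,T]\to\mathscr{L}(V)$ such that $$QC(t)Q^{-1}v=C(t)v+L(t)v$$ for every $t\in[0,T]$ and every $v\in\mathrm{Dom}\,C$. Then for every $s\in[0,T)$ and $x_0\in Y$, there exists a strong solution to the bilinear problem $$\mathrm{d}X_t=AX_t\,\mathrm{d}t+BX_t\,\mathrm{d}^\pi\omega_t,\quad s<t\le T,\qquad X_s=x_0,$$ that takes values in the space $Y$.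
   Context: **$p$-th variation along partitions.** For a finite partition $P=\{a=t_0<t_1<\dots<t_N=b\}$ of $[a,b]$, $[t_j,t_{j+1}]\in P$ means that $t_j,t_{j+1}$ are consecutive points of $P$; the mesh size is $\max_{[t_j,t_{j+1}]\in P}|t_{j+1}-t_j|$; and for $S\in\mathscr{C}([a,b])$ set $\mathrm{osc}(S,P):=\max_{[t_j,t_{j+1}]\in P}\max_{x,y\in[t_j,t_{j+1}]}|S(x)-S(y)|$. Given a sequence $\pi=\{\pi_n\}$ of finite partitions of $[a,b]$, one writes $S\in V_p(\pi)$ ($S$ has finite $p$-th variation along $\pi$) if $\lim_n\mathrm{osc}(S,\pi_n)=0$ and the measures $\mu_n:=\sum_{[t_j,t_{j+1}]\in\pi_n}\delta_{t_j}|S(t_{j+1})-S(t_j)|^p$ on $([a,b],\mathcal{B}([a,b]))$ converge weakly to a non-atomic measure $\mu$ ($\delta_u$ is the Dirac measure at $u$). The $p$-th variation is then the function $[S]^\pi_p(t):=\mu([a,t])$, $t\in[a,b]$. **Integral.** $\mathscr{C}^{1,p}([a,b]\times\mathbb{R};V)$ is the set of continuous functions $f:[a,b]\times\mathbb{R}\to V$ such that the partial derivative $\partial_1 f$ in the first variable exists on $(a,b)\times\mathbb{R}$ and has a continuous extension to $[a,b]\times\mathbb{R}$, and the $p$-th partial derivative $\partial_2^p f$ in the second variable exists and is continuous on $[a,b]\times\mathbb{R}$. A function $h:[a,b]\to V$ is integrable with respect to $\omega$ on $[a,b]$ if there is $f\in\mathscr{C}^{1,p}([a,b]\times\mathbb{R};V)$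 with $h_t=(\partial_2 f)(t,\omega_t)$ for every $t\in[a,b]$; the integral (associated with such an $f$) is $$\int_a^t h_u\,\mathrm{d}^\pi\omega_u:=\lim_{n\to\infty}\sum_{[t_j,t_{j+1}]\in\pi_n}\sum_{k=1}^{p-1}\frac{1}{k!}(\partial_2^kf)(t_j,\omega_{t_j})(\omega_{t_{j+1}\wedge t}-\omega_{t_j\wedge t})^k$$ (limit in $V$). On a subinterval $[s,T]$ of $[0,T]$, the path $\omega|_{[s,T]}$ and the partitions $\{s\}\cup(\pi_n\cap[s,T])$ of $[s,T]$ are used. **Strong solution.** A function $X:[s,T]\to V$ is a strong solution to the bilinear problem if $X$ takes values in $\mathrm{Dom}\,A\cap\mathrm{Dom}\,B$, $r\mapsto AX_r$ is Lebesgue integrable on $[s,T]$, $r\mapsto BX_r$ is integrable with respect to $\omega$ on $[s,T]$ (i.e. there is $f\in\mathscr{C}^{1,p}([s,T]\times\mathbb{R};V)$ with $BX_r=(\partial_2 f)(r,\omega_r)$ for every $r\in[s,T]$), and $X_t=x_0+\int_s^tAX_r\,\mathrm{d}r+\int_s^tBX_r\,\mathrm{d}^\pi\omega_r$ for every $t\in(s,T]$. **Resolvents and strong continuity.** For a linear operator $K:\mathrm{Dom}\,K\subseteq V\to V$, $\rho(K)$ is the set of $\lambda\in\mathbb{C}$ such that $\lambda\mathrm{Id}_V-K$ has a bounded inverse, and $R(\lambda:K):=(\lambda\mathrm{Id}_V-K)^{-1}$ for $\lambda\in\rho(K)$. A function $L:[0,T]\to\mathscr{L}(V)$ is strongly continuous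 if $t\mapsto L(t)v$ is continuous for every $v\in V$. *)

theory Defs
  imports "HOL-Analysis.Analysis"
begin

section \<open>Partitions and p-th variation\<close>

text \<open>
  A finite partition of an interval is represented by its set of points.
\<close>

definition partition_of :: "real \<Rightarrow> real \<Rightarrow> real set \<Rightarrow> bool" where
  "partition_of a b P \<longleftrightarrow> finite P \<and> P \<subseteq> {a..b} \<and> a \<in> P \<and> b \<in> P"

definition consec :: "real set \<Rightarrow> (real \<times> real) set" where
  "consec P = {(u, v). u \<in> P \<and> v \<in> P \<and> u < v \<and> P \<inter> {u<..<v} = {}}"

definition mesh :: "real set \<Rightarrow> real" where
  "mesh P = Max ((\<lambda>(u, v). \<bar>v - u\<bar>) ` consec P)"

definition osc :: "(real \<Rightarrow> real) \<Rightarrow> real set \<Rightarrow> real" where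
  "osc S P = Max ((\<lambda>(u, v). diameter (S ` {u..v})) ` consec P)"

text \<open>
  The image under \<^term>\<open>fst\<close> of the weighted counting measure on consecutive pairs is the
  sum of the Dirac measures at the left endpoints with weights \<open>\<bar>S v - S u\<bar> ^ p\<close>.
\<close>

definition variation_measure ::
    "nat \<Rightarrow> real \<Rightarrow> real \<Rightarrow> (real \<Rightarrow> real) \<Rightarrow> real set \<Rightarrow> real measure" where
  "variation_measure p a b S P =
     distr (point_measure (consec P) (\<lambda>(u, v). ennreal (\<bar>S v - S u\<bar> ^ p)))
       (restrict_space borel {a..b}) fst"

definition non_atomic :: "'a measure \<Rightarrow> bool" where
  "non_atomic M \<longleftrightarrow>
     \<not> (\<exists>E\<in>sets M. emeasure M E > 0 \<and>
          (\<forall>F\<in>sets M. F \<subseteq> E \<and> emeasure M F < emeasure M E \<longrightarrow> emeasure M F = 0))"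

text \<open>
  Weak convergence of finite measures on a compact interval.  The library's
  \<open>weak_conv_m\<close> is formulated through distribution functions of probability
  measures on the whole line and does not apply here.
\<close>

definition weakly_converges :: "real \<Rightarrow> real \<Rightarrow> (nat \<Rightarrow> real measure) \<Rightarrow> real measure \<Rightarrow> bool" where
  "weakly_converges a b M N \<longleftrightarrow>
     (\<forall>g::real \<Rightarrow> real. continuous_on {a..b} g \<longrightarrow>
        (\<lambda>n. integral\<^sup>L (M n) g) \<longlonglongrightarrow> integral\<^sup>L N g)"

definition is_variation_limit ::
    "nat \<Rightarrow> real \<Rightarrow> real \<Rightarrow> (nat \<Rightarrow> real set) \<Rightarrow> (real \<Rightarrow> real) \<Rightarrow> real measure \<Rightarrow> bool" where
  "is_variation_limit p a b \<pi> S \<mu> \<longleftrightarrow>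
     sets \<mu> = sets (restrict_space borel {a..b}) \<and> finite_measure \<mu> \<and> non_atomic \<mu> \<and>
     weakly_converges a b (\<lambda>n. variation_measure p a b S (\<pi> n)) \<mu>"

definition finite_pth_variation ::
    "nat \<Rightarrow> real \<Rightarrow> real \<Rightarrow> (nat \<Rightarrow> real set) \<Rightarrow> (real \<Rightarrow> real) \<Rightarrow> bool" where
  "finite_pth_variation p a b \<pi> S \<longleftrightarrow>
     (\<lambda>n. osc S (\<pi> n)) \<longlonglongrightarrow> 0 \<and> (\<exists>\<mu>. is_variation_limit p a b \<pi> S \<mu>)"

text \<open>The limit measure is unique, so the choice below is immaterial.\<close>

definition pth_variation ::
    "nat \<Rightarrow> real \<Rightarrow> real \<Rightarrow> (nat \<Rightarrow> real set) \<Rightarrow> (real \<Rightarrow> real) \<Rightarrow> real \<Rightarrow> real" where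
  "pth_variation p a b \<pi> S t = measure (SOME \<mu>. is_variation_limit p a b \<pi> S \<mu>) {a..t}"

section \<open>The pathwise integral\<close>

definition partial2 ::
    "(real \<Rightarrow> real \<Rightarrow> 'v::real_normed_vector) \<Rightarrow> real \<Rightarrow> real \<Rightarrow> 'v" where
  "partial2 f = (\<lambda>t x. vector_derivative (f t) (at x))"

definition C1p ::
    "nat \<Rightarrow> real \<Rightarrow> real \<Rightarrow> (real \<Rightarrow> real \<Rightarrow> 'v::real_normed_vector) set" where
  "C1p p a b = {f.
     continuous_on ({a..b} \<times> UNIV) (\<lambda>(t, x). f t x) \<and>
     (\<exists>g. continuous_on ({a..b} \<times> UNIV) (\<lambda>(t, x). g t x) \<and>
          (\<forall>t\<in>{a<..<b}. \<forall>x. ((\<lambda>r. f r x) has_vector_derivative g t x) (at t))) \<and>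
     (\<forall>k<p. \<forall>t\<in>{a..b}. \<forall>x. ((partial2 ^^ k) f t) differentiable (at x)) \<and>
     continuous_on ({a..b} \<times> UNIV) (\<lambda>(t, x). (partial2 ^^ p) f t x)}"

definition pathwise_sum ::
    "nat \<Rightarrow> (real \<Rightarrow> real \<Rightarrow> 'v::real_normed_vector) \<Rightarrow> (real \<Rightarrow> real) \<Rightarrow> real set \<Rightarrow> real \<Rightarrow> 'v" where
  "pathwise_sum p f \<omega> P t =
     (\<Sum>(u, v)\<in>consec P. \<Sum>k = 1..p - 1.
        (1 / fact k) *\<^sub>R ((\<omega> (min v t) - \<omega> (min u t)) ^ k *\<^sub>R (partial2 ^^ k) f u (\<omega> u)))"

definition has_pathwise_integral ::
    "nat \<Rightarrow> (nat \<Rightarrow> real set) \<Rightarrow> (real \<Rightarrow> real \<Rightarrow> 'v::real_normed_vector) \<Rightarrow>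
     (real \<Rightarrow> real) \<Rightarrow> real \<Rightarrow> 'v \<Rightarrow> bool" where
  "has_pathwise_integral p \<pi> f \<omega> t I \<longleftrightarrow> (\<lambda>n. pathwise_sum p f \<omega> (\<pi> n) t) \<longlonglongrightarrow> I"

definition partitions_from :: "real \<Rightarrow> real \<Rightarrow> (nat \<Rightarrow> real set) \<Rightarrow> nat \<Rightarrow> real set" where
  "partitions_from s T \<pi> n = {s} \<union> (\<pi> n \<inter> {s..T})"

section \<open>The Bochner integral in not necessarily separable spaces\<close>

text \<open>
  The library's \<^const>\<open>has_bochner_integral\<close> is restricted to second countable spaces by
  its sort constraint.  The definition below repeats its defining clauses without it.
\<close>

definition bochner_integral_is ::
    "'a measure \<Rightarrow> ('a \<Rightarrow> 'v::real_normed_vector) \<Rightarrow> 'v \<Rightarrow> bool" where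
  "bochner_integral_is M f I \<longleftrightarrow>
     f \<in> borel_measurable M \<and>
     (\<exists>\<phi>. (\<forall>i. Bochner_Integration.simple_bochner_integrable M (\<phi> i)) \<and>
          (\<lambda>i. \<integral>\<^sup>+x. ennreal (norm (f x - \<phi> i x)) \<partial>M) \<longlonglongrightarrow> 0 \<and>
          (\<lambda>i. Bochner_Integration.simple_bochner_integral M (\<phi> i)) \<longlonglongrightarrow> I)"

lemma bochner_integral_is_iff_has_bochner_integral:
  fixes f :: "'a \<Rightarrow> 'v::{real_normed_vector, second_countable_topology}"
  shows "bochner_integral_is M f I \<longleftrightarrow> has_bochner_integral M f I"
  unfolding bochner_integral_is_def has_bochner_integral.simps by blast

section \<open>Unbounded operators, resolvents and groups\<close>

text \<open>
  An operator \<open>K : Dom K \<subseteq> V \<rightarrow> V\<close> is a pair of a set \<open>D\<close> (its domain) and a function \<open>K\<close>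
  whose values outside \<open>D\<close> play no role.  Scalars are real: a complex Hilbert space is also
  a real one with the same norm (for the real part of its inner product), and
  complex-linear operators are in particular real-linear.
\<close>

definition linear_operator :: "'v::real_vector set \<Rightarrow> ('v \<Rightarrow> 'v) \<Rightarrow> bool" where
  "linear_operator D K \<longleftrightarrow> subspace D \<and>
     (\<forall>x\<in>D. \<forall>y\<in>D. K (x + y) = K x + K y) \<and> (\<forall>c. \<forall>x\<in>D. K (c *\<^sub>R x) = c *\<^sub>R K x)"

definition closed_operator :: "'v::real_normed_vector set \<Rightarrow> ('v \<Rightarrow> 'v) \<Rightarrow> bool" where
  "closed_operator D K \<longleftrightarrow> closed {(x, K x) | x. x \<in> D}"

definition dom_power :: "'v set \<Rightarrow> ('v \<Rightarrow> 'v) \<Rightarrow> nat \<Rightarrow> 'v set" where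
  "dom_power D K m = {x. \<forall>k<m. (K ^^ k) x \<in> D}"

definition resolvent :: "'v::real_vector set \<Rightarrow> ('v \<Rightarrow> 'v) \<Rightarrow> real \<Rightarrow> 'v \<Rightarrow> 'v" where
  "resolvent D K l = the_inv_into D (\<lambda>v. l *\<^sub>R v - K v)"

text \<open>
  The real part \<open>\<rho>(K) \<inter> \<real>\<close> of the resolvent set.  For real \<open>l\<close>, membership in the resolvent
  set does not depend on whether a complex space is regarded as a real one, or a real space
  is complexified.
\<close>

definition real_resolvent_set :: "'v::real_normed_vector set \<Rightarrow> ('v \<Rightarrow> 'v) \<Rightarrow> real set" where
  "real_resolvent_set D K =
     {l. bij_betw (\<lambda>v. l *\<^sub>R v - K v) D UNIV \<and> bounded_linear (resolvent D K l)}"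

definition strongly_continuous_group ::
    "(real \<Rightarrow> 'v::real_normed_vector \<Rightarrow>\<^sub>L 'v) \<Rightarrow> bool" where
  "strongly_continuous_group G \<longleftrightarrow>
     G 0 = id_blinfun \<and> (\<forall>x y. G (x + y) = G x o\<^sub>L G y) \<and>
     (\<forall>v. continuous_on UNIV (\<lambda>x. G x v))"

definition infinitesimal_generator ::
    "'v::real_normed_vector set \<Rightarrow> ('v \<Rightarrow> 'v) \<Rightarrow> (real \<Rightarrow> 'v \<Rightarrow>\<^sub>L 'v) \<Rightarrow> bool" where
  "infinitesimal_generator D K G \<longleftrightarrow>
     D = {v. \<exists>l. ((\<lambda>h. (1 / h) *\<^sub>R (G h v - v)) \<longlongrightarrow> l) (at 0)} \<and>
     (\<forall>v\<in>D. ((\<lambda>h. (1 / h) *\<^sub>R (G h v - v)) \<longlongrightarrow> K v) (at 0))"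

text \<open>
  The embedded space \<open>Y\<close> is a type of its own together with an embedding \<open>j\<close>; as a subset
  of \<open>V\<close> it is \<^term>\<open>range j\<close>, and \<^term>\<open>inv j v\<close> is \<open>v \<in> Y\<close> regarded as an element of
  the Hilbert space \<open>Y\<close>.
\<close>

definition dense_embedding ::
    "('y::real_normed_vector \<Rightarrow> 'v::real_normed_vector) \<Rightarrow> bool" where
  "dense_embedding j \<longleftrightarrow> bounded_linear j \<and> inj j \<and> closure (range j) = UNIV"

definition restrict_to :: "('y \<Rightarrow> 'v) \<Rightarrow> ('v \<Rightarrow> 'v) \<Rightarrow> 'y \<Rightarrow> 'y" where
  "restrict_to j K = (\<lambda>y. inv j (K (j y)))"

section \<open>The bilinear problem\<close>

definition C_dom :: "'v set \<Rightarrow> 'v set \<Rightarrow> ('v \<Rightarrow> 'v) \<Rightarrow> nat \<Rightarrow> 'v set" where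
  "C_dom DA DB B p = DA \<inter> dom_power DB B p"

definition C_op ::
    "('v::real_vector \<Rightarrow> 'v) \<Rightarrow> ('v \<Rightarrow> 'v) \<Rightarrow> nat \<Rightarrow> (real \<Rightarrow> real) \<Rightarrow> real \<Rightarrow> 'v \<Rightarrow> 'v" where
  "C_op A B p d t v = A v - ((1 / fact p) * d t) *\<^sub>R (B ^^ p) v"

definition strong_solution ::
    "'v::real_normed_vector set \<Rightarrow> ('v \<Rightarrow> 'v) \<Rightarrow> 'v set \<Rightarrow> ('v \<Rightarrow> 'v) \<Rightarrow> nat \<Rightarrow>
     (nat \<Rightarrow> real set) \<Rightarrow> (real \<Rightarrow> real) \<Rightarrow> real \<Rightarrow> real \<Rightarrow> 'v \<Rightarrow> (real \<Rightarrow> 'v) \<Rightarrow> bool" where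
  "strong_solution DA A DB B p \<pi> \<omega> s T x0 X \<longleftrightarrow>
     X s = x0 \<and>
     (\<forall>r\<in>{s..T}. X r \<in> DA \<inter> DB) \<and>
     (\<exists>I. bochner_integral_is (lebesgue_on {s..T}) (\<lambda>r. A (X r)) I) \<and>
     (\<exists>f\<in>C1p p s T.
        (\<forall>r\<in>{s..T}. B (X r) = partial2 f r (\<omega> r)) \<and>
        (\<forall>t\<in>{s<..T}. \<exists>I J.
           bochner_integral_is (lebesgue_on {s..t}) (\<lambda>r. A (X r)) I \<and>
           has_pathwise_integral p (partitions_from s T \<pi>) f \<omega> t J \<and>
           X t = x0 + I + J))"

end

theory Submission
  imports Defs
begin

text \<open>
  The group removes the rough path from the equation. Put \<open>X t = G (\<omega> t) (v t)\<close> and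
  \<open>f t x = G x (v t)\<close>. Then \<open>f\<close> has \<open>k\<close>-th space derivative \<open>G x (B\<^sup>k (v t))\<close>, so
  \<open>B (X t)\<close> is \<open>\<partial>\<^sub>2f t (\<omega> t)\<close>, and a change of variables formula for paths with \<open>p\<close>-th
  variation says that the pathwise integral of \<open>B X\<close> is the increment of \<open>X\<close>, minus the time
  integral of \<open>\<partial>\<^sub>1f t (\<omega> t) = G (\<omega> t) (v' t)\<close>, minus \<open>1 / fact p\<close> times the integral of
  \<open>B\<^sup>p X\<close> against the \<open>p\<close>-th variation, whose density is \<open>d\<close>. Hence \<open>X\<close> solves the bilinear
  problem as soon as \<open>v\<close> is continuously differentiable and \<open>v' t = K t (v t)\<close> with
  \<open>K t = G (- \<omega> t) \<circ> C t \<circ> G (\<omega> t)\<close>: the term \<open>B\<^sup>p\<close> in \<open>C\<close> cancels the correction.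

  This leaves a nonautonomous linear equation with unbounded coefficients of Kato's hyperbolic type.
  Everything about \<open>Y\<close> is expressed by the bounded operator \<open>S = j \<circ> Q\<^sup>-\<^sup>1\<close> on \<open>V\<close>: its range is \<open>Y\<close>,
  it commutes with the group, and \<open>K t (S v) = S (K t v + L' t v)\<close> on the domain of \<open>K t\<close>, where
  \<open>L' t = G (- \<omega> t) \<circ> L t \<circ> G (\<omega> t)\<close>. The map \<open>t \<mapsto> K t \<circ> S\<close> is only strongly continuous, not
  continuous in operator norm, because \<open>G\<close> is only strongly continuous. The Hilbert space structure
  compensates for this: the generators are dissipative, and with their Yosida approximations
  \<open>K\<^sub>n t\<close> an energy estimate compares two approximate solutions for the same time \<open>t\<close>, so that no
  modulus of continuity in \<open>t\<close> enters.

  The equation for \<open>v\<close> is solved through \<open>w = S\<^sup>-\<^sup>1 v\<close>, which formally satisfies \<open>w' = K w + L' w\<close> in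
  \<open>V\<close>. A mild solution of \<open>u' = K u + g\<close> is defined as a uniform limit of near solutions of
  \<open>x' = K\<^sub>n x + g\<close>. For data in the range of \<open>S\<close> the solutions of the regularized equation have
  \<open>K\<^sub>n x\<close> bounded and form a Cauchy sequence (\<open>mild_exists_regular\<close>); a stability estimate
  (\<open>mild_stability\<close>) extends existence to all data and makes \<open>g \<mapsto> u\<close> a Volterra operator, so that
  \<open>g = L' u\<close> is solvable by a fixed point. If \<open>w\<close> is the resulting mild solution, then the identity
  \<open>S (K\<^sub>n x) = K (S (J\<^sub>n x)) - S (L' (J\<^sub>n x))\<close>, with \<open>J\<^sub>n = n (n - K)\<^sup>-\<^sup>1\<close> tending to the identity, allows
  passing to the limit in the derivative of \<open>S x\<close>: the terms with \<open>L'\<close> cancel, and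
  \<open>v = S w\<close> is a classical solution (\<open>evolution_exists\<close>). This also gives the continuity of
  \<open>v\<close> as a path in \<open>Y\<close>, and therefore that of \<open>B\<^sup>k (v t)\<close> and of \<open>v'\<close>.

  The change of variables formula (\<open>pathwise_Ito_formula\<close>) is proved with antiderivatives in
  place of integrals; they are turned into Bochner integrals only at the end.
\<close>

section \<open>Mean value inequalities and uniform limits\<close>

lemma norm_triangle3: "norm (x + y - z) \<le> norm x + norm y + norm (z :: 'a::real_normed_vector)"
  using norm_triangle_ineq4[of "x + y" z] norm_triangle_ineq[of x y] by linarith

text \<open>
  The derivative is taken within a fixed set \<open>I\<close> that may be larger than \<open>{a..b}\<close>. Solutions on
  \<open>{s..T}\<close> are differentiable in this one-sided sense at the endpoints, and the inequality is then
  available on every subinterval.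
\<close>

lemma norm_increment_le:
  fixes f :: "real \<Rightarrow> 'a::real_normed_vector" and \<phi> :: "real \<Rightarrow> real"
  assumes "a \<le> b" "{a..b} \<subseteq> I"
    and f: "\<And>t. t \<in> {a..b} \<Longrightarrow> (f has_vector_derivative f' t) (at t within I)"
    and \<phi>: "\<And>t. t \<in> {a..b} \<Longrightarrow> (\<phi> has_real_derivative \<phi>' t) (at t within I)"
    and le: "\<And>t. t \<in> {a..b} \<Longrightarrow> norm (f' t) \<le> \<phi>' t"
  shows "norm (f b - f a) \<le> \<phi> b - \<phi> a"
proof (cases "a = b")
  case False
  have f1: "(f has_vector_derivative f' t) (at t within {a..b})" if "t \<in> {a..b}" for t
    using f[OF that] assms(2) by (rule has_vector_derivative_within_subset)
  have p1: "(\<phi> has_vector_derivative \<phi>' t) (at t within {a..b})" if "t \<in> {a..b}" for t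
    using \<phi>[OF that] assms(2) has_real_derivative_iff_has_vector_derivative
      has_vector_derivative_within_subset by blast
  show ?thesis
  proof (rule differentiable_bound_general)
    show "a < b" using False assms(1) by simp
    show "continuous_on {a..b} f" using f1 by (rule continuous_on_vector_derivative)
    show "continuous_on {a..b} \<phi>" using p1 by (rule continuous_on_vector_derivative)
    show "(f has_vector_derivative f' x) (at x)" if "a < x" "x < b" for x
      using f1[of x] that by (simp add: at_within_Icc_at)
    show "(\<phi> has_vector_derivative \<phi>' x) (at x)" if "a < x" "x < b" for x
      using p1[of x] that by (simp add: at_within_Icc_at)
  qed (use le in auto)
qed auto

lemma norm_increment_le_const:
  fixes f :: "real \<Rightarrow> 'a::real_normed_vector"
  assumes "a \<le> b" "{a..b} \<subseteq> I"
    and f: "\<And>t. t \<in> {a..b} \<Longrightarrow> (f has_vector_derivative f' t) (at t within I)"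
    and le: "\<And>t. t \<in> {a..b} \<Longrightarrow> norm (f' t) \<le> c"
  shows "norm (f b - f a) \<le> c * (b - a)"
proof -
  have "norm (f b - f a) \<le> c * b - c * a"
    by (rule norm_increment_le[OF assms(1,2) f _ le, of "\<lambda>t. c * t"])
       (auto intro!: derivative_eq_intros)
  then show ?thesis by (simp add: algebra_simps)
qed

lemma uniform_Cauchy_limit:
  fixes z :: "nat \<Rightarrow> 'b \<Rightarrow> 'a::{real_normed_vector, complete_space}"
  assumes z: "\<And>k m t. t \<in> A \<Longrightarrow> k \<le> m \<Longrightarrow> norm (z m t - z k t) \<le> e k"
    and e: "e \<longlonglongrightarrow> (0::real)"
  shows "\<exists>l. \<forall>k. \<forall>t\<in>A. norm (z k t - l t) \<le> e k"
proof -
  have lim: "(\<lambda>m. z m t) \<longlonglongrightarrow> lim (\<lambda>m. z m t)" if t: "t \<in> A" for t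
  proof -
    have "Cauchy (\<lambda>m. z m t)"
    proof (rule metric_CauchyI)
      fix r :: real assume "r > 0"
      then have "eventually (\<lambda>k. e k < r / 2) sequentially"
        using order_tendstoD(2)[OF e, of "r / 2"] by simp
      then obtain K where K: "e K < r / 2" by (auto simp: eventually_sequentially)
      have "dist (z m t) (z n t) < r" if "m \<ge> K" "n \<ge> K" for m n
        using z[OF t that(1)] z[OF t that(2)] K
          norm_triangle_ineq4[of "z m t - z K t" "z n t - z K t"] by (simp add: dist_norm)
      then show "\<exists>M. \<forall>m\<ge>M. \<forall>n\<ge>M. dist (z m t) (z n t) < r" by blast
    qed
    then show ?thesis by (simp add: Cauchy_convergent convergent_LIMSEQ_iff[symmetric])
  qed
  show ?thesis
  proof (intro exI allI ballI)
    fix k t assume t: "t \<in> A"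
    have "(\<lambda>m. norm (z k t - z m t)) \<longlonglongrightarrow> norm (z k t - lim (\<lambda>m. z m t))"
      by (intro tendsto_intros lim t)
    moreover have "\<forall>m\<ge>k. norm (z k t - z m t) \<le> e k"
      using z[OF t] by (metis norm_minus_commute)
    ultimately show "norm (z k t - lim (\<lambda>m. z m t)) \<le> e k"
      using LIMSEQ_le_const2 by blast
  qed
qed

lemma continuous_on_uniform_approximation:
  fixes g :: "'b::topological_space \<Rightarrow> 'a::real_normed_vector"
  assumes "\<And>\<epsilon>. \<epsilon> > 0 \<Longrightarrow> \<exists>h. continuous_on A h \<and> (\<forall>t\<in>A. norm (h t - g t) \<le> \<epsilon>)"
  shows "continuous_on A g"
proof -
  have "\<exists>h. \<forall>k::nat. continuous_on A (h k) \<and> (\<forall>t\<in>A. norm (h k t - g t) \<le> 1 / Suc k)"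
    by (rule choice) (use assms in simp)
  then obtain h where h: "\<And>k::nat. continuous_on A (h k)"
    "\<And>k t. t \<in> A \<Longrightarrow> norm (h k t - g t) \<le> 1 / Suc k" by blast
  have "uniform_limit A h g sequentially"
  proof (rule uniform_limitI)
    fix r :: real assume "r > 0"
    then obtain K where K: "1 / Suc K < r" using nat_approx_posE by blast
    have "dist (h k t) (g t) < r" if "k \<ge> K" "t \<in> A" for k t
    proof -
      have "1 / Suc k \<le> 1 / Suc K" using that by (simp add: frac_le)
      then show ?thesis using h(2)[OF that(2), of k] K by (simp add: dist_norm)
    qed
    then show "\<forall>\<^sub>F k in sequentially. \<forall>t\<in>A. dist (h k t) (g t) < r"
      by (auto simp: eventually_sequentially)
  qed
  then show ?thesis by (rule uniform_limit_theorem[rotated]) (auto simp: h)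
qed

text \<open>
  Strong continuity of an equi-Lipschitz family suffices for continuity along a moving argument.
  All operator families below are bounded uniformly but continuous only pointwise.
\<close>

lemma continuous_on_Lipschitz_family:
  fixes F :: "'b::topological_space \<Rightarrow> 'c::real_normed_vector \<Rightarrow> 'a::real_normed_vector"
  assumes F: "\<And>x. continuous_on A (\<lambda>t. F t x)"
    and Lip: "\<And>t x y. t \<in> A \<Longrightarrow> norm (F t x - F t y) \<le> c * norm (x - y)"
    and g: "continuous_on A g"
  shows "continuous_on A (\<lambda>t. F t (g t))"
  unfolding continuous_on_def
proof
  fix t0 assume t0: "t0 \<in> A"
  have 1: "((\<lambda>t. F t (g t0)) \<longlongrightarrow> F t0 (g t0)) (at t0 within A)"
    using F[of "g t0"] t0 by (simp add: continuous_on_def)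
  have 2: "((\<lambda>t. F t (g t) - F t (g t0)) \<longlongrightarrow> 0) (at t0 within A)"
  proof (rule Lim_null_comparison)
    show "\<forall>\<^sub>F t in at t0 within A. norm (F t (g t) - F t (g t0)) \<le> c * norm (g t - g t0)"
      using Lip by (auto simp: eventually_at_filter)
    have "(g \<longlongrightarrow> g t0) (at t0 within A)" using g t0 by (simp add: continuous_on_def)
    then have "((\<lambda>t. c * norm (g t - g t0)) \<longlongrightarrow> c * norm (g t0 - g t0)) (at t0 within A)"
      by (intro tendsto_intros)
    then show "((\<lambda>t. c * norm (g t - g t0)) \<longlongrightarrow> 0) (at t0 within A)" by simp
  qed
  show "((\<lambda>t. F t (g t)) \<longlongrightarrow> F t0 (g t0)) (at t0 within A)"
    using tendsto_add[OF 1 2] by simp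
qed

section \<open>Antiderivatives of continuous paths\<close>

text \<open>
  Schauder's projection: \<open>g ` A\<close> is compact, so finitely many points of the dense range of \<open>S\<close> form
  an \<open>\<epsilon>\<close>-net, and a partition of unity subordinate to this net averages their preimages. With
  \<open>S\<close> the identity it reduces vector-valued statements to real ones; for general \<open>S\<close> it
  approximates a path in \<open>V\<close> by paths in the smaller space.
\<close>

lemma finite_rank_approximation:
  fixes g :: "'b::topological_space \<Rightarrow> 'a::real_normed_vector" and S :: "'c::real_vector \<Rightarrow> 'a"
  assumes S: "linear S" "closure (range S) = UNIV"
    and A: "compact A" and g: "continuous_on A g" and \<epsilon>: "\<epsilon> > 0"
  obtains I \<phi> where "finite I" "\<And>q. q \<in> I \<Longrightarrow> continuous_on A (\<phi> q)"
    "\<And>t. t \<in> A \<Longrightarrow> norm (S (\<Sum>q\<in>I. (\<phi> q t :: real) *\<^sub>R q) - g t) \<le> \<epsilon>"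
proof -
  have "compact (g ` A)" using g A by (rule compact_continuous_image)
  moreover have "g ` A \<subseteq> (\<Union>q\<in>UNIV. ball (S q) \<epsilon>)"
  proof
    fix x assume "x \<in> g ` A"
    have "x \<in> closure (range S)" using S by simp
    then obtain q where "dist (S q) x < \<epsilon>" using \<epsilon> unfolding closure_approachable by blast
    then show "x \<in> (\<Union>q\<in>UNIV. ball (S q) \<epsilon>)" by auto
  qed
  ultimately obtain I where I: "finite I" "g ` A \<subseteq> (\<Union>q\<in>I. ball (S q) \<epsilon>)"
    by (metis compactE_image open_ball)
  define \<psi> where "\<psi> q t = max 0 (\<epsilon> - norm (S q - g t))" for q t
  define \<Psi> where "\<Psi> t = (\<Sum>q\<in>I. \<psi> q t)" for t
  have \<psi>: "continuous_on A (\<psi> q)" for q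
    unfolding \<psi>_def by (intro continuous_intros g)
  have \<psi>0: "\<psi> q t \<ge> 0" for q t by (simp add: \<psi>_def)
  have pos: "\<Psi> t > 0" if "t \<in> A" for t
  proof -
    have "g t \<in> (\<Union>q\<in>I. ball (S q) \<epsilon>)" using I(2) that by blast
    then obtain q where q: "q \<in> I" "dist (S q) (g t) < \<epsilon>" unfolding mem_ball UN_iff by (elim bexE)
    then have "\<psi> q t > 0" by (simp add: \<psi>_def dist_norm)
    then show ?thesis unfolding \<Psi>_def using I q \<psi>0 by (intro sum_pos2[of _ q]) auto
  qed
  show ?thesis
  proof
    show "continuous_on A (\<lambda>t. \<psi> q t / \<Psi> t)" for q
    proof -
      have "continuous_on A \<Psi>" unfolding \<Psi>_def by (intro continuous_intros \<psi>)
      then show ?thesis using pos by (intro continuous_intros \<psi>) force+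
    qed
    fix t assume t: "t \<in> A"
    have one: "(\<Sum>q\<in>I. \<psi> q t / \<Psi> t) = 1"
      using pos[OF t] by (simp add: sum_divide_distrib[symmetric] \<Psi>_def[symmetric])
    have "S (\<Sum>q\<in>I. (\<psi> q t / \<Psi> t) *\<^sub>R q) - g t
        = (\<Sum>q\<in>I. (\<psi> q t / \<Psi> t) *\<^sub>R S q) - (\<Sum>q\<in>I. \<psi> q t / \<Psi> t) *\<^sub>R g t"
      using S(1) by (simp add: one linear_sum linear_cmul)
    also have "\<dots> = (\<Sum>q\<in>I. (\<psi> q t / \<Psi> t) *\<^sub>R (S q - g t))"
      by (simp add: scaleR_sum_left scaleR_diff_right sum_subtractf)
    finally have "norm (S (\<Sum>q\<in>I. (\<psi> q t / \<Psi> t) *\<^sub>R q) - g t)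
        \<le> (\<Sum>q\<in>I. norm ((\<psi> q t / \<Psi> t) *\<^sub>R (S q - g t)))" by (simp only: norm_sum)
    also have "\<dots> \<le> (\<Sum>q\<in>I. (\<psi> q t / \<Psi> t) * \<epsilon>)"
    proof (rule sum_mono)
      fix q
      have "\<psi> q t * norm (S q - g t) \<le> \<psi> q t * \<epsilon>"
        by (cases "norm (S q - g t) \<le> \<epsilon>") (auto simp: \<psi>_def intro: mult_left_mono)
      then show "norm ((\<psi> q t / \<Psi> t) *\<^sub>R (S q - g t)) \<le> \<psi> q t / \<Psi> t * \<epsilon>"
        using pos[OF t] \<psi>0[of q t] by (simp add: divide_right_mono)
    qed
    also have "\<dots> = (\<Sum>q\<in>I. \<psi> q t / \<Psi> t) * \<epsilon>" by (rule sum_distrib_right[symmetric])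
    also have "\<dots> = \<epsilon>" by (simp only: one mult_1)
    finally show "norm (S (\<Sum>q\<in>I. (\<psi> q t / \<Psi> t) *\<^sub>R q) - g t) \<le> \<epsilon>" .
  qed (use I in auto)
qed

text \<open>
  Paths of finite rank have antiderivatives by the real case, one coefficient at a time. By the mean
  value inequality the antiderivatives of uniformly convergent paths are uniformly Cauchy, and the
  linearization bound survives in the limit.
\<close>

lemma antiderivative_exists:
  fixes g :: "real \<Rightarrow> 'a::{real_normed_vector, complete_space}"
  assumes g: "continuous_on {a..b} g"
  shows "\<exists>Z. Z a = z0 \<and> (\<forall>t\<in>{a..b}. (Z has_vector_derivative g t) (at t within {a..b}))"
proof -
  define P where "P k h Z \<longleftrightarrow> (\<forall>t\<in>{a..b}. norm (h t - g t) \<le> 1 / Suc k \<and> Z a = 0 \<and>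
    (Z has_vector_derivative h t) (at t within {a..b}))" for k :: nat and h Z :: "real \<Rightarrow> 'a"
  have "\<exists>h Z. P k h Z" for k
  proof -
    obtain I and \<phi> :: "'a \<Rightarrow> real \<Rightarrow> real" where I: "finite I" "\<And>q. q \<in> I \<Longrightarrow> continuous_on {a..b} (\<phi> q)"
      "\<And>t. t \<in> {a..b} \<Longrightarrow> norm ((\<Sum>q\<in>I. \<phi> q t *\<^sub>R q) - g t) \<le> 1 / Suc k"
      by (rule finite_rank_approximation[OF linear_ident _ _ g, of "1 / Suc k"]) auto
    have "\<exists>F. \<forall>q\<in>I. \<forall>t\<in>{a..b}. (F q has_vector_derivative \<phi> q t) (at t within {a..b})"
      using antiderivative_continuous[OF I(2)] by (intro bchoice) metis
    then obtain F where F: "\<And>q t. q \<in> I \<Longrightarrow> t \<in> {a..b} \<Longrightarrow>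
        (F q has_vector_derivative \<phi> q t) (at t within {a..b})" by blast
    have "((\<lambda>t. \<Sum>q\<in>I. (F q t - F q a) *\<^sub>R q) has_vector_derivative (\<Sum>q\<in>I. \<phi> q t *\<^sub>R q))
        (at t within {a..b})" if "t \<in> {a..b}" for t
    proof (rule has_vector_derivative_sum)
      fix q assume q: "q \<in> I"
      have "((\<lambda>t. F q t - F q a) has_real_derivative \<phi> q t) (at t within {a..b})"
        using F[OF q that] by (auto simp: has_real_derivative_iff_has_vector_derivative
            intro!: derivative_eq_intros)
      then show "((\<lambda>t. (F q t - F q a) *\<^sub>R q) has_vector_derivative \<phi> q t *\<^sub>R q) (at t within {a..b})"
        by (rule has_vector_derivative_scaleR[where g = "\<lambda>_. q" and g' = 0, simplified])
    qed
    then show ?thesis unfolding P_def using I(3)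
      by (intro exI[of _ "\<lambda>t. \<Sum>q\<in>I. \<phi> q t *\<^sub>R q"] exI[of _ "\<lambda>t. \<Sum>q\<in>I. (F q t - F q a) *\<^sub>R q"]) simp
  qed
  then have "\<exists>h. \<forall>k. \<exists>Z. P k (h k) Z" by (intro choice allI)
  then obtain h where "\<forall>k. \<exists>Z. P k (h k) Z" ..
  then have "\<exists>Z. \<forall>k. P k (h k) (Z k)" by (rule choice)
  then obtain Z where hZ: "\<forall>k. P k (h k) (Z k)" ..
  note hZ = hZ[THEN spec, unfolded P_def, THEN bspec, THEN conjunct1]
    hZ[THEN spec, unfolded P_def, THEN bspec, THEN conjunct2, THEN conjunct1]
    hZ[THEN spec, unfolded P_def, THEN bspec, THEN conjunct2, THEN conjunct2]
  have "norm (Z m t - Z k t) \<le> 2 * (b - a) / Suc k" if t: "t \<in> {a..b}" and km: "k \<le> m" for k m t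
  proof -
    have "norm ((Z m t - Z k t) - (Z m a - Z k a)) \<le> (2 / Suc k) * (t - a)"
    proof (rule norm_increment_le_const[where I = "{a..b}"])
      fix r assume r: "r \<in> {a..t}"
      then have r': "r \<in> {a..b}" using t by auto
      show "((\<lambda>t. Z m t - Z k t) has_vector_derivative (h m r - h k r)) (at r within {a..b})"
        by (intro has_vector_derivative_diff hZ(3) r')
      have "1 / Suc m \<le> 1 / Suc k" using km by (simp add: frac_le)
      then show "norm (h m r - h k r) \<le> 2 / Suc k"
        using hZ(1)[OF r', of m] hZ(1)[OF r', of k]
          norm_triangle_ineq4[of "h m r - g r" "h k r - g r"] by simp
    qed (use t in auto)
    also have "\<dots> \<le> (2 / Suc k) * (b - a)" using t by (intro mult_left_mono) auto
    finally show ?thesis using hZ(2)[OF t] by simp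
  qed
  moreover have "(\<lambda>k. 2 * (b - a) / Suc k) \<longlonglongrightarrow> 0"
    using tendsto_mult_right_zero[OF LIMSEQ_inverse_real_of_nat, of "2 * (b - a)"]
    by (simp add: divide_inverse)
  ultimately have "\<exists>W. \<forall>k. \<forall>t\<in>{a..b}. norm (Z k t - W t) \<le> 2 * (b - a) / Suc k"
    by (rule uniform_Cauchy_limit)
  then obtain W where "\<forall>k. \<forall>t\<in>{a..b}. norm (Z k t - W t) \<le> 2 * (b - a) / Suc k" ..
  then have W: "norm (Z k t - W t) \<le> 2 * (b - a) / Suc k" if "t \<in> {a..b}" for k t
    using that by blast
  have lim: "(\<lambda>k. Z k t) \<longlonglongrightarrow> W t" if "t \<in> {a..b}" for t
  proof -
    have "(\<lambda>k. Z k t - W t) \<longlonglongrightarrow> 0"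
      by (rule Lim_null_comparison[OF _ \<open>(\<lambda>k. 2 * (b - a) / Suc k) \<longlonglongrightarrow> 0\<close>])
         (use W that in auto)
    then show ?thesis by (rule LIM_zero_cancel)
  qed
  have der: "(W has_vector_derivative g t) (at t within {a..b})" if t: "t \<in> {a..b}" for t
    unfolding has_vector_derivative_def has_derivative_within_alt
  proof (intro conjI allI impI)
    show "bounded_linear (\<lambda>x. x *\<^sub>R g t)" by (rule bounded_linear_scaleR_left)
    fix e :: real assume e: "e > 0"
    then obtain d where d: "d > 0" "\<And>r. r \<in> {a..b} \<Longrightarrow> dist r t < d \<Longrightarrow> dist (g r) (g t) < e"
      using g t by (metis continuous_on_iff)
    have "norm (W y - W t - (y - t) *\<^sub>R g t) \<le> e * norm (y - t)"
      if y: "y \<in> {a..b}" "norm (y - t) < d" for y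
    proof -
      have bd: "norm (Z k y - Z k t - (y - t) *\<^sub>R g t) \<le> norm (y - t) * (e + 3 / Suc k)" for k
      proof -
        have "closed_segment t y \<subseteq> {a..b}" using t y by (simp add: closed_segment_subset)
        then have "norm (Z k y - Z k t - (y - t) *\<^sub>R h k t) \<le> norm (y - t) * (e + 2 / Suc k)"
        proof (intro vector_differentiable_bound_linearization[where S = "closed_segment t y"])
          fix x assume x: "x \<in> closed_segment t y"
          then have x': "x \<in> {a..b}" using \<open>closed_segment t y \<subseteq> {a..b}\<close> by auto
          show "(Z k has_vector_derivative h k x) (at x within closed_segment t y)"
            using hZ(3)[OF x'] \<open>closed_segment t y \<subseteq> {a..b}\<close>
            by (rule has_vector_derivative_within_subset)
          have "norm (x - t) \<le> norm (y - t)"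
            using x segment_bound(1)[of x t y] by simp
          then have "norm (g x - g t) < e" using d(2)[OF x'] y(2) by (simp add: dist_norm)
          then show "norm (h k x - h k t) \<le> e + 2 / Suc k"
            using hZ(1)[OF x', of k] hZ(1)[OF t, of k]
              norm_triangle_ineq4[of "h k x - g x + (g x - g t)" "h k t - g t"]
              norm_triangle_ineq[of "h k x - g x" "g x - g t"] by simp
        qed auto
        moreover have "norm ((y - t) *\<^sub>R (h k t - g t)) \<le> norm (y - t) * (1 / Suc k)"
          using hZ(1)[OF t, of k] by (simp only: norm_scaleR real_norm_def) (rule mult_left_mono, auto)
        ultimately show ?thesis
          using norm_triangle_ineq[of "Z k y - Z k t - (y - t) *\<^sub>R h k t" "(y - t) *\<^sub>R (h k t - g t)"]
          by (simp add: algebra_simps)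
      qed
      show ?thesis
      proof (rule LIMSEQ_le)
        show "(\<lambda>k. norm (Z k y - Z k t - (y - t) *\<^sub>R g t)) \<longlonglongrightarrow> norm (W y - W t - (y - t) *\<^sub>R g t)"
          by (intro tendsto_intros lim y t)
        have "(\<lambda>k. norm (y - t) * (e + 3 * inverse (Suc k))) \<longlonglongrightarrow> norm (y - t) * (e + 3 * 0)"
          by (intro tendsto_intros LIMSEQ_inverse_real_of_nat)
        then show "(\<lambda>k. norm (y - t) * (e + 3 / Suc k)) \<longlonglongrightarrow> e * norm (y - t)"
          by (simp add: divide_inverse mult.commute)
      qed (use bd in auto)
    qed
    then show "\<exists>d>0. \<forall>y\<in>{a..b}. norm (y - t) < d \<longrightarrow>
        norm (W y - W t - (y - t) *\<^sub>R g t) \<le> e * norm (y - t)" using d(1) by blast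
  qed
  show ?thesis
  proof (intro exI[of _ "\<lambda>t. W t - W a + z0"] conjI ballI)
    show "((\<lambda>t. W t - W a + z0) has_vector_derivative g t) (at t within {a..b})" if "t \<in> {a..b}" for t
      using der[OF that] by (auto intro!: derivative_eq_intros)
  qed simp
qed


text \<open>
  The approximations \<open>x\<close> are close to \<open>w\<close> and, by the mean value inequality, also to the
  antiderivative of \<open>g\<close> that agrees with \<open>w\<close> at \<open>a\<close>. Hence \<open>w\<close> is this antiderivative.
\<close>

lemma vector_derivative_of_uniform_limit:
  fixes w g :: "real \<Rightarrow> 'a::{real_normed_vector, complete_space}"
  assumes g: "continuous_on {a..b} g"
    and approx: "\<And>\<epsilon>. \<epsilon> > 0 \<Longrightarrow> \<exists>x x'. \<forall>t\<in>{a..b}.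
        (x has_vector_derivative x' t) (at t within {a..b}) \<and>
        norm (x t - w t) \<le> \<epsilon> \<and> norm (x' t - g t) \<le> \<epsilon>"
    and t: "t \<in> {a..b}"
  shows "(w has_vector_derivative g t) (at t within {a..b})"
proof -
  obtain Z where Z: "Z a = w a"
    "\<And>t. t \<in> {a..b} \<Longrightarrow> (Z has_vector_derivative g t) (at t within {a..b})"
    using antiderivative_exists[OF g, of "w a"] by blast
  have "w t = Z t" if t: "t \<in> {a..b}" for t
  proof -
    have "norm (w t - Z t) \<le> 0 + \<eta>" if \<eta>: "\<eta> > 0" for \<eta>
    proof -
      define \<epsilon> where "\<epsilon> = \<eta> / (2 + (b - a))"
      have pos: "2 + (b - a) > 0" using t by auto
      then have \<epsilon>: "\<epsilon> > 0" using \<eta> by (simp add: \<epsilon>_def)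
      obtain x x' where x: "\<And>t. t \<in> {a..b} \<Longrightarrow> (x has_vector_derivative x' t) (at t within {a..b})"
        "\<And>t. t \<in> {a..b} \<Longrightarrow> norm (x t - w t) \<le> \<epsilon>" "\<And>t. t \<in> {a..b} \<Longrightarrow> norm (x' t - g t) \<le> \<epsilon>"
        using approx[OF \<epsilon>] by blast
      have "norm ((x t - Z t) - (x a - Z a)) \<le> \<epsilon> * (t - a)"
        by (rule norm_increment_le_const[where I = "{a..b}" and f' = "\<lambda>t. x' t - g t"])
           (use t x Z in \<open>auto intro!: has_vector_derivative_diff\<close>)
      also have "\<dots> \<le> \<epsilon> * (b - a)" using \<epsilon> t by (intro mult_left_mono) auto
      finally have 1: "norm ((x t - Z t) - (x a - Z a)) \<le> \<epsilon> * (b - a)" .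
      have "a \<in> {a..b}" using t by auto
      have eq: "w t - Z t = ((x t - Z t) - (x a - Z a)) + (x a - w a) - (x t - w t)"
        using Z(1) by simp
      have "norm (w t - Z t) \<le> \<epsilon> * (b - a) + \<epsilon> + \<epsilon>"
        using 1 x(2)[OF t] x(2)[OF \<open>a \<in> {a..b}\<close>]
          norm_triangle3[of "(x t - Z t) - (x a - Z a)" "x a - w a" "x t - w t", folded eq]
        by linarith
      also have "\<dots> = \<epsilon> * (2 + (b - a))" by (simp add: algebra_simps)
      also have "\<dots> = \<eta>" using pos by (simp add: \<epsilon>_def)
      finally show ?thesis by simp
    qed
    then show ?thesis using field_le_epsilon[of "norm (w t - Z t)" 0] by simp
  qed
  then show ?thesis
    using has_vector_derivative_transform[OF t, of w Z] Z(2)[OF t] by simp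
qed

section \<open>Differential equations and a priori bounds\<close>

lemma exp_weight_bound:
  fixes f :: "real \<Rightarrow> 'a::real_normed_vector"
  assumes t: "t \<in> {s..T}" and \<mu>: "\<mu> > 0" and c: "c \<ge> 0"
    and f: "\<And>t. t \<in> {s..T} \<Longrightarrow> (f has_vector_derivative f' t) (at t within {s..T})"
    and fs: "f s = 0"
    and le: "\<And>t. t \<in> {s..T} \<Longrightarrow> norm (f' t) \<le> \<mu> * c * exp (\<mu> * (t - s))"
  shows "norm (f t) \<le> c * exp (\<mu> * (t - s))"
proof -
  have "norm (f t - f s) \<le> c * exp (\<mu> * (t - s)) - c * exp (\<mu> * (s - s))"
    by (rule norm_increment_le[where I = "{s..T}" and f' = f' and
            \<phi>' = "\<lambda>t. \<mu> * c * exp (\<mu> * (t - s))"])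
       (use t f le in \<open>auto intro!: derivative_eq_intros\<close>)
  then show ?thesis using fs c by simp
qed

text \<open>
  Measured with the weight \<open>exp (\<mu> * (r - s))\<close>, a Volterra operator with Lipschitz constant at
  most \<open>\<mu> / 2\<close> is a contraction on the whole interval, whatever its length. It serves twice: for
  ordinary differential equations, and for absorbing the bounded perturbation \<open>L\<close> in the evolution
  equation.
\<close>

lemma Volterra_fixed_point:
  fixes \<Phi> :: "(real \<Rightarrow> 'a::{real_normed_vector, complete_space}) \<Rightarrow> real \<Rightarrow> 'a"
  assumes \<mu>: "\<mu> \<ge> 0"
    and cont: "\<And>g. continuous_on {s..T} g \<Longrightarrow> continuous_on {s..T} (\<Phi> g)"
    and contr: "\<And>g g' c t. \<lbrakk>continuous_on {s..T} g; continuous_on {s..T} g'; c \<ge> 0;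
        \<forall>r\<in>{s..T}. norm (g r - g' r) \<le> c * exp (\<mu> * (r - s)); t \<in> {s..T}\<rbrakk> \<Longrightarrow>
        norm (\<Phi> g t - \<Phi> g' t) \<le> c / 2 * exp (\<mu> * (t - s))"
  obtains g where "continuous_on {s..T} g" "\<And>t. t \<in> {s..T} \<Longrightarrow> \<Phi> g t = g t"
proof -
  define z where "z k = (\<Phi> ^^ k) (\<lambda>_. 0)" for k
  have zS: "z (Suc k) = \<Phi> (z k)" for k by (simp add: z_def)
  have zc: "continuous_on {s..T} (z k)" for k
    by (induction k) (auto simp: zS cont, simp add: z_def)
  have "bounded (z 1 ` {s..T})"
    by (intro compact_imp_bounded compact_continuous_image zc compact_Icc)
  then obtain c where c: "c \<ge> 0" "\<And>t. t \<in> {s..T} \<Longrightarrow> norm (z 1 t) \<le> c"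
    unfolding bounded_pos by (metis imageI less_imp_le)
  have w1: "exp (\<mu> * (t - s)) \<ge> 1" if "t \<in> {s..T}" for t using \<mu> that by simp
  have step: "\<forall>t\<in>{s..T}. norm (z (Suc k) t - z k t) \<le> c / 2 ^ k * exp (\<mu> * (t - s))" for k
  proof (induction k)
    case 0
    have "c * 1 \<le> c * exp (\<mu> * (t - s))" if "t \<in> {s..T}" for t
      using w1[OF that] c(1) by (rule mult_left_mono)
    then show ?case using c(2) by (force simp: z_def)
  next
    case (Suc k)
    then show ?case
      using contr[OF zc zc, of "c / 2 ^ k" "Suc k" k] c(1) by (simp add: zS field_simps)
  qed
  have tail: "norm (z (k + i) t - z k t) \<le> (2 * c / 2 ^ k - 2 * c / 2 ^ (k + i)) * exp (\<mu> * (t - s))"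
    if t: "t \<in> {s..T}" for k i t
  proof (induction i)
    case (Suc i)
    have "norm (z (k + Suc i) t - z k t) \<le>
        norm (z (Suc (k + i)) t - z (k + i) t) + norm (z (k + i) t - z k t)"
      using norm_triangle_ineq[of "z (Suc (k + i)) t - z (k + i) t" "z (k + i) t - z k t"] by simp
    also have "\<dots> \<le> c / 2 ^ (k + i) * exp (\<mu> * (t - s)) +
        (2 * c / 2 ^ k - 2 * c / 2 ^ (k + i)) * exp (\<mu> * (t - s))"
      using step[of "k + i"] t Suc by (intro add_mono) auto
    also have "\<dots> = (2 * c / 2 ^ k - 2 * c / 2 ^ (k + Suc i)) * exp (\<mu> * (t - s))"
      by (simp add: field_simps)
    finally show ?case .
  qed auto
  define E where "E = exp (\<mu> * (T - s))"
  have E: "exp (\<mu> * (t - s)) \<le> E" if "t \<in> {s..T}" for t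
    using that \<mu> by (auto simp: E_def intro!: mult_left_mono)
  have "norm (z m t - z k t) \<le> 2 * c * E / 2 ^ k" if t: "t \<in> {s..T}" and km: "k \<le> m" for k m t
  proof -
    obtain i where i: "m = k + i" using km le_Suc_ex by blast
    have "norm (z m t - z k t) \<le> (2 * c / 2 ^ k - 2 * c / 2 ^ (k + i)) * exp (\<mu> * (t - s))"
      unfolding i by (rule tail[OF t])
    also have "\<dots> \<le> 2 * c / 2 ^ k * E"
      using E[OF t] c(1) by (intro mult_mono) auto
    finally show ?thesis by simp
  qed
  moreover have e0: "(\<lambda>k. 2 * c * E / 2 ^ k) \<longlonglongrightarrow> 0"
    using tendsto_mult_right_zero[OF LIMSEQ_inverse_realpow_zero[of 2], of "2 * c * E"]
    by (simp add: divide_inverse)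
  ultimately have "\<exists>g. \<forall>k. \<forall>t\<in>{s..T}. norm (z k t - g t) \<le> 2 * c * E / 2 ^ k"
    by (rule uniform_Cauchy_limit)
  then obtain g where "\<forall>k. \<forall>t\<in>{s..T}. norm (z k t - g t) \<le> 2 * c * E / 2 ^ k" ..
  then have g: "norm (z k t - g t) \<le> 2 * c * E / 2 ^ k" if "t \<in> {s..T}" for k t
    using that by blast
  have gc: "continuous_on {s..T} g"
  proof (rule continuous_on_uniform_approximation)
    fix r :: real assume "r > 0"
    then obtain k where "2 * c * E / 2 ^ k < r"
      using order_tendstoD(2)[OF e0] by (auto simp: eventually_sequentially)
    then have "norm (z k t - g t) \<le> r" if "t \<in> {s..T}" for t using g[OF that, of k] by simp
    then show "\<exists>h. continuous_on {s..T} h \<and> (\<forall>t\<in>{s..T}. norm (h t - g t) \<le> r)"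
      using zc by blast
  qed
  have "\<Phi> g t = g t" if t: "t \<in> {s..T}" for t
  proof -
    have bd: "norm (\<Phi> g t - g t) \<le> (2 * c * E / 2 ^ k) * (E + 1)" for k
    proof -
      have e: "2 * c * E / 2 ^ k \<ge> 0" using c by (simp add: E_def)
      have "\<forall>r\<in>{s..T}. norm (g r - z k r) \<le> 2 * c * E / 2 ^ k * exp (\<mu> * (r - s))"
      proof
        fix r assume r: "r \<in> {s..T}"
        have "2 * c * E / 2 ^ k * 1 \<le> 2 * c * E / 2 ^ k * exp (\<mu> * (r - s))"
          using w1[OF r] e by (rule mult_left_mono)
        then show "norm (g r - z k r) \<le> 2 * c * E / 2 ^ k * exp (\<mu> * (r - s))"
          using g[OF r, of k] by (simp add: norm_minus_commute)
      qed
      then have "norm (\<Phi> g t - z (Suc k) t) \<le> 2 * c * E / 2 ^ k / 2 * exp (\<mu> * (t - s))"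
        using contr[OF gc zc e _ t] by (simp add: zS)
      also have "\<dots> \<le> 2 * c * E / 2 ^ k * E"
      proof (rule mult_mono)
        have "x / 2 \<le> x" if "x \<ge> 0" for x :: real using that by simp
        then show "2 * c * E / 2 ^ k / 2 \<le> 2 * c * E / 2 ^ k" using e by blast
      qed (use E[OF t] e in auto)
      finally have "norm (\<Phi> g t - z (Suc k) t) \<le> 2 * c * E / 2 ^ k * E" .
      moreover have "norm (z (Suc k) t - g t) \<le> 2 * c * E / 2 ^ k"
        using g[OF t, of "Suc k"] c(1) E_def
        by (elim order_trans) (simp add: field_simps)
      ultimately show ?thesis
        using norm_triangle_ineq[of "\<Phi> g t - z (Suc k) t" "z (Suc k) t - g t"]
        by (simp add: distrib_left)
    qed
    have "(\<lambda>k. (2 * c * E / 2 ^ k) * (E + 1)) \<longlonglongrightarrow> 0"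
      using tendsto_mult_left_zero[OF e0] by simp
    then have "norm (\<Phi> g t - g t) \<le> 0"
      using bd by (intro LIMSEQ_le_const) auto
    then show ?thesis by simp
  qed
  with gc show ?thesis by (rule that)
qed

lemma Picard_Lindeloef_global:
  fixes F :: "real \<Rightarrow> 'a::{real_normed_vector, complete_space} \<Rightarrow> 'a"
  assumes F: "\<And>x. continuous_on {s..T} (\<lambda>t. F t x)"
    and Lip: "\<And>t x y. t \<in> {s..T} \<Longrightarrow> norm (F t x - F t y) \<le> N * norm (x - y)" and N: "N > 0"
  obtains y where "y s = y0"
    "\<And>t. t \<in> {s..T} \<Longrightarrow> (y has_vector_derivative F t (y t)) (at t within {s..T})"
proof -
  have Fc: "continuous_on {s..T} (\<lambda>t. F t (g t))" if "continuous_on {s..T} g" for g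
    using F Lip that by (rule continuous_on_Lipschitz_family)
  define P where "P g Z \<longleftrightarrow> Z s = y0 \<and>
    (\<forall>t\<in>{s..T}. (Z has_vector_derivative F t (g t)) (at t within {s..T}))" for g Z
  define \<Phi> where "\<Phi> g = (SOME Z. P g Z)" for g
  have \<Phi>: "P g (\<Phi> g)" if "continuous_on {s..T} g" for g
  proof -
    have "\<exists>Z. P g Z" unfolding P_def by (rule antiderivative_exists[OF Fc[OF that]])
    then show ?thesis unfolding \<Phi>_def by (rule someI_ex)
  qed
  obtain g where g: "continuous_on {s..T} g" "\<And>t. t \<in> {s..T} \<Longrightarrow> \<Phi> g t = g t"
  proof (rule Volterra_fixed_point[of "2 * N" s T \<Phi>])
    show "continuous_on {s..T} (\<Phi> g)" if "continuous_on {s..T} g" for g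
      using \<Phi>[OF that] unfolding P_def by (intro continuous_on_vector_derivative) auto
    show "norm (\<Phi> g t - \<Phi> g' t) \<le> c / 2 * exp (2 * N * (t - s))"
      if g: "continuous_on {s..T} g" "continuous_on {s..T} g'" and c: "0 \<le> c"
        and le: "\<forall>r\<in>{s..T}. norm (g r - g' r) \<le> c * exp (2 * N * (r - s))"
        and t: "t \<in> {s..T}" for g g' c t
    proof (rule exp_weight_bound[OF t])
      fix r assume r: "r \<in> {s..T}"
      show "((\<lambda>t. \<Phi> g t - \<Phi> g' t) has_vector_derivative (F r (g r) - F r (g' r))) (at r within {s..T})"
        using \<Phi>[OF g(1)] \<Phi>[OF g(2)] r unfolding P_def by (intro has_vector_derivative_diff) auto
      have "norm (F r (g r) - F r (g' r)) \<le> N * norm (g r - g' r)" by (rule Lip[OF r])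
      also have "\<dots> \<le> N * (c * exp (2 * N * (r - s)))" using le r N by (intro mult_left_mono) auto
      finally show "norm (F r (g r) - F r (g' r)) \<le> 2 * N * (c / 2) * exp (2 * N * (r - s))" by simp
    next
      show "\<Phi> g s - \<Phi> g' s = 0" using \<Phi>[OF g(1)] \<Phi>[OF g(2)] by (simp add: P_def)
    qed (use N c in auto)
  qed (use N in auto)
  show ?thesis
  proof
    show "\<Phi> g s = y0" using \<Phi>[OF g(1)] by (simp add: P_def)
    show "(\<Phi> g has_vector_derivative F t (\<Phi> g t)) (at t within {s..T})" if "t \<in> {s..T}" for t
      using \<Phi>[OF g(1)] that g(2) by (simp add: P_def)
  qed
qed

text \<open>
  The inequality is needed only where \<open>y\<close> exceeds the bound: there the function
  \<open>(norm (y t))\<^sup>2 * exp (- 2 * \<mu> * (t - s))\<close> is nonincreasing, so it cannot rise above \<open>a\<^sup>2\<close> after the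
  last time at which it was at most \<open>a\<^sup>2\<close>. This form absorbs inhomogeneous terms without
  integrating them.
\<close>

lemma exponential_bound_from_dissipativity:
  fixes y :: "real \<Rightarrow> 'a::real_inner"
  assumes y: "\<And>t. t \<in> {s..T} \<Longrightarrow> (y has_vector_derivative y' t) (at t within {s..T})"
    and ys: "norm (y s) \<le> a"
    and diss: "\<And>t. t \<in> {s..T} \<Longrightarrow> norm (y t) > a * exp (\<mu> * (t - s)) \<Longrightarrow>
        inner (y' t) (y t) \<le> \<mu> * (norm (y t))\<^sup>2"
    and t: "t \<in> {s..T}"
  shows "norm (y t) \<le> a * exp (\<mu> * (t - s))"
proof (rule ccontr)
  assume con: "\<not> norm (y t) \<le> a * exp (\<mu> * (t - s))"
  have a: "a \<ge> 0" using ys norm_ge_zero order_trans by blast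
  define \<psi> where "\<psi> t = inner (y t) (y t) * exp (- (2 * \<mu>) * (t - s))" for t
  define \<psi>' where "\<psi>' t = 2 * (inner (y' t) (y t) - \<mu> * inner (y t) (y t)) * exp (- (2 * \<mu>) * (t - s))" for t
  have \<psi>: "(\<psi> has_real_derivative \<psi>' t) (at t within {s..T})" if "t \<in> {s..T}" for t
  proof -
    have "((\<lambda>t. inner (y t) (y t)) has_real_derivative 2 * inner (y' t) (y t)) (at t within {s..T})"
      using y[OF that]
      by (auto simp: has_field_derivative_def has_vector_derivative_def inner_commute algebra_simps
          intro!: derivative_eq_intros)
    then show ?thesis unfolding \<psi>_def[abs_def] \<psi>'_def
      by (auto intro!: derivative_eq_intros simp: algebra_simps)
  qed
  have ineq: "norm (y t) > a * exp (\<mu> * (t - s)) \<longleftrightarrow> \<psi> t > a\<^sup>2" for t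
  proof -
    have "exp (- (2 * \<mu>) * (t - s)) = (exp (- (\<mu> * (t - s))))\<^sup>2"
      by (simp add: power2_eq_square flip: exp_add)
    then have "\<psi> t = (norm (y t) * exp (- (\<mu> * (t - s))))\<^sup>2"
      by (simp add: \<psi>_def power2_norm_eq_inner power_mult_distrib)
    then have "\<psi> t > a\<^sup>2 \<longleftrightarrow> norm (y t) * exp (- (\<mu> * (t - s))) > a"
      using a power_mono_iff[of "norm (y t) * exp (- (\<mu> * (t - s)))" a 2] by (simp add: not_le[symmetric])
    also have "\<dots> \<longleftrightarrow> norm (y t) > a * exp (\<mu> * (t - s))"
      by (simp only: exp_minus divide_inverse[symmetric] pos_less_divide_eq[OF exp_gt_zero])
    finally show ?thesis by simp
  qed
  have cont: "continuous_on {s..t} \<psi>"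
    using DERIV_continuous_on[OF \<psi>] by (rule continuous_on_subset) (use t in auto)
  define A where "A = {r \<in> {s..t}. \<psi> r \<le> a\<^sup>2}"
  have "closed A" unfolding A_def
    using cont by (intro continuous_on_closed_Collect_le continuous_intros) auto
  moreover have "bounded A" unfolding A_def by (rule bounded_subset[of "{s..t}"]) auto
  ultimately have "compact A" by (simp add: compact_eq_bounded_closed)
  moreover have "s \<in> A" using t ys ineq[of s] by (auto simp: A_def)
  ultimately obtain r where r: "r \<in> A" "\<And>x. x \<in> A \<Longrightarrow> x \<le> r"
    using compact_attains_sup[of A] by blast
  have rt: "r \<le> t" "s \<le> r" using r by (auto simp: A_def)
  have above: "\<psi> x > a\<^sup>2" if "x \<in> {r<..t}" for x
  proof -
    have "x \<notin> A" using r(2)[of x] that by auto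
    then show ?thesis using that rt by (auto simp: A_def)
  qed
  have "\<psi> t \<le> \<psi> r"
  proof (rule DERIV_nonpos_imp_decreasing_open[OF rt(1)])
    fix x assume x: "r < x" "x < t"
    then have xin: "x \<in> {s..T}" using rt t by auto
    have "inner (y' x) (y x) \<le> \<mu> * (norm (y x))\<^sup>2"
      using above[of x] x ineq[of x] diss[OF xin] by auto
    then have "\<psi>' x \<le> 0" by (simp add: \<psi>'_def power2_norm_eq_inner mult_le_0_iff)
    moreover have "(\<psi> has_real_derivative \<psi>' x) (at x)"
      using \<psi>[OF xin] x rt t by (simp add: at_within_Icc_at)
    ultimately show "\<exists>y. (\<psi> has_real_derivative y) (at x) \<and> y \<le> 0" by blast
  next
    show "continuous_on {r..t} \<psi>" using cont rt by (auto intro: continuous_on_subset)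
  qed
  then show False using con ineq[of t] r by (auto simp: A_def)
qed

section \<open>The uniform boundedness principle\<close>

text \<open>
  Banach-Steinhaus: by Baire's theorem some set on which the family is bounded by a constant has
  an interior point, and linearity moves this bound to a ball around the origin.
\<close>

lemma uniform_boundedness:
  fixes F :: "'i \<Rightarrow> 'a::{real_normed_vector, complete_space} \<Rightarrow> 'b::real_normed_vector"
  assumes F: "\<And>i. i \<in> I \<Longrightarrow> bounded_linear (F i)" and bd: "\<And>x. \<exists>b. \<forall>i\<in>I. norm (F i x) \<le> b"
  shows "\<exists>M\<ge>0. \<forall>i\<in>I. \<forall>x. norm (F i x) \<le> M * norm x"
proof -
  define C where "C n = {x. \<forall>i\<in>I. norm (F i x) \<le> real n}" for n :: nat
  have closed: "closed (C n)" for n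
  proof -
    have "closed {x. norm (F i x) \<le> real n}" if "i \<in> I" for i
      by (intro closed_Collect_le continuous_intros bounded_linear.continuous_on[OF F[OF that]])
    moreover have "C n = (\<Inter>i\<in>I. {x. norm (F i x) \<le> real n})" by (auto simp: C_def)
    ultimately show ?thesis by (simp add: closed_INT)
  qed
  have "(\<Union>n. C n) = UNIV"
  proof (intro equalityI subset_UNIV subsetI)
    fix x
    obtain b where b: "\<forall>i\<in>I. norm (F i x) \<le> b" using bd by blast
    obtain n where "b \<le> real n" using real_arch_simple by blast
    then have "x \<in> C n" using b by (force simp: C_def)
    then show "x \<in> (\<Union>n. C n)" by blast
  qed
  have "\<exists>n. interior (C n) \<noteq> {}"
  proof (rule ccontr)
    assume "\<not> ?thesis"
    then have "Met_TC.mtopology interior_of \<Union>(range C) = {}"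
      using closed by (intro Met_TC.metric_Baire_category_alt) (auto simp: complete_UNIV)
    then show False using \<open>(\<Union>n. C n) = UNIV\<close> by simp
  qed
  then obtain n x0 where "x0 \<in> interior (C n)" by blast
  then obtain r where r: "r > 0" "ball x0 r \<subseteq> C n" by (auto simp: mem_interior)
  have "norm (F i x) \<le> (4 * real n / r) * norm x" if i: "i \<in> I" for i x
  proof (cases "x = 0")
    case True
    then show ?thesis using linear_0[OF bounded_linear.linear[OF F[OF i]]] by simp
  next
    case False
    define c where "c = r / 2 / norm x"
    have c: "c > 0" using False r by (simp add: c_def)
    have "x0 + c *\<^sub>R x \<in> ball x0 r" "x0 \<in> ball x0 r" using r False by (auto simp: dist_norm c_def)
    then have "norm (F i (x0 + c *\<^sub>R x)) \<le> n" "norm (F i x0) \<le> n" using r(2) i unfolding C_def by blast+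
    moreover have "c *\<^sub>R F i x = F i (x0 + c *\<^sub>R x) - F i x0"
      using bounded_linear.linear[OF F[OF i]] by (simp add: linear_add linear_cmul)
    ultimately have "norm (c *\<^sub>R F i x) \<le> 2 * real n"
      using norm_triangle_ineq4[of "F i (x0 + c *\<^sub>R x)" "F i x0"] by simp
    then show ?thesis using False r(1) by (simp add: c_def field_simps)
  qed
  moreover have "4 * real n / r \<ge> 0" using r by simp
  ultimately show ?thesis by blast
qed

text \<open>
  Compositions of an unbounded operator with a bounded one are recognized as bounded in this way:
  they are pointwise limits of difference quotients or of Yosida approximations.
\<close>

lemma bounded_linear_pointwise_limit:
  fixes F :: "nat \<Rightarrow> 'a::{real_normed_vector, complete_space} \<Rightarrow> 'b::real_normed_vector"
  assumes F: "\<And>n. bounded_linear (F n)" and lim: "\<And>x. (\<lambda>n. F n x) \<longlonglongrightarrow> f x"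
  shows "bounded_linear f"
proof -
  have "\<exists>b. \<forall>n\<in>UNIV. norm (F n x) \<le> b" for x
    using convergent_imp_Bseq[OF convergentI[OF lim[of x]]] by (auto simp: Bseq_def)
  then obtain M where M: "\<And>n x. norm (F n x) \<le> M * norm x"
    using uniform_boundedness[of UNIV F] F by auto
  show ?thesis
  proof (rule bounded_linear_intro)
    note lin = bounded_linear.linear[OF F]
    show "f (x + y) = f x + f y" for x y
      using tendsto_add[OF lim[of x] lim[of y]] lim[of "x + y"]
      by (simp add: linear_add[OF lin] LIMSEQ_unique)
    show "f (c *\<^sub>R x) = c *\<^sub>R f x" for c x
      using tendsto_scaleR[OF tendsto_const lim[of x], of c] lim[of "c *\<^sub>R x"]
      by (simp add: linear_cmul[OF lin] LIMSEQ_unique)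
    show "norm (f x) \<le> norm x * M" for x
      using LIMSEQ_le_const2[OF tendsto_norm[OF lim[of x]]] M[of _ x] by (simp add: mult.commute)
  qed
qed

section \<open>Dissipative operators and Yosida approximations\<close>

text \<open>
  In a Hilbert space this is the Lumer-Phillips form of the resolvent bound
  \<open>norm (n - K)\<^sup>-\<^sup>1 \<le> 1 / (n - \<kappa>)\<close> for all \<open>n > \<kappa>\<close>. The version with the inner product yields the
  energy estimates and is stable under bounded perturbations.
\<close>

definition m_dissipative :: "real \<Rightarrow> 'v::real_inner set \<Rightarrow> ('v \<Rightarrow> 'v) \<Rightarrow> bool" where
  "m_dissipative \<kappa> D K \<longleftrightarrow> linear_operator D K \<and>
     (\<forall>v\<in>D. inner (K v) v \<le> \<kappa> * (norm v)\<^sup>2) \<and> (\<forall>n>\<kappa>. \<forall>x. \<exists>v\<in>D. n *\<^sub>R v - K v = x)"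

lemma linear_operatorD:
  assumes "linear_operator D K"
  shows "0 \<in> D" "K 0 = 0" "x \<in> D \<Longrightarrow> y \<in> D \<Longrightarrow> x + y \<in> D" "x \<in> D \<Longrightarrow> y \<in> D \<Longrightarrow> x - y \<in> D"
    "x \<in> D \<Longrightarrow> c *\<^sub>R x \<in> D" "x \<in> D \<Longrightarrow> y \<in> D \<Longrightarrow> K (x + y) = K x + K y"
    "x \<in> D \<Longrightarrow> y \<in> D \<Longrightarrow> K (x - y) = K x - K y" "x \<in> D \<Longrightarrow> K (c *\<^sub>R x) = c *\<^sub>R K x"
proof -
  have D: "subspace D" and add: "\<And>x y. x \<in> D \<Longrightarrow> y \<in> D \<Longrightarrow> K (x + y) = K x + K y"
    and sc: "\<And>c x. x \<in> D \<Longrightarrow> K (c *\<^sub>R x) = c *\<^sub>R K x"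
    using assms by (auto simp: linear_operator_def)
  show "0 \<in> D" using D by (rule subspace_0)
  then show "K 0 = 0" using sc[of 0 0] by simp
  show "x \<in> D \<Longrightarrow> y \<in> D \<Longrightarrow> x - y \<in> D" using D by (rule subspace_diff)
  show "x \<in> D \<Longrightarrow> y \<in> D \<Longrightarrow> K (x - y) = K x - K y"
    using add[of x "(-1) *\<^sub>R y"] sc[of y "-1"] subspace_scale[OF D, of y "-1"] by simp
qed (use assms in \<open>auto simp: linear_operator_def subspace_add subspace_scale\<close>)

lemma m_dissipative_imp_linear_operator: "m_dissipative \<kappa> D K \<Longrightarrow> linear_operator D K"
  by (simp add: m_dissipative_def)

lemma m_dissipative_lower_bound:
  assumes K: "m_dissipative \<kappa> D K" and v: "v \<in> D"
  shows "(n - \<kappa>) * norm v \<le> norm (n *\<^sub>R v - K v)"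
proof (cases "v = 0")
  case False
  have "(n - \<kappa>) * (norm v)\<^sup>2 \<le> inner (n *\<^sub>R v - K v) v"
    using K v by (simp add: m_dissipative_def inner_diff_left power2_norm_eq_inner algebra_simps)
  also have "\<dots> \<le> norm (n *\<^sub>R v - K v) * norm v" by (rule norm_cauchy_schwarz)
  finally show ?thesis using False by (simp add: power2_eq_square)
qed simp

lemma m_dissipative_bij:
  assumes K: "m_dissipative \<kappa> D K" and n: "n > \<kappa>"
  shows "bij_betw (\<lambda>v. n *\<^sub>R v - K v) D UNIV"
proof -
  note lin = linear_operatorD[OF m_dissipative_imp_linear_operator[OF K]]
  have "inj_on (\<lambda>v. n *\<^sub>R v - K v) D"
  proof (rule inj_onI)
    fix x y assume xy: "x \<in> D" "y \<in> D" "n *\<^sub>R x - K x = n *\<^sub>R y - K y"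
    have "n *\<^sub>R (x - y) - K (x - y) = (n *\<^sub>R x - K x) - (n *\<^sub>R y - K y)"
      by (simp only: lin(7)[OF xy(1,2)]) (simp add: algebra_simps)
    then have "n *\<^sub>R (x - y) - K (x - y) = 0" using xy(3) by simp
    then have "(n - \<kappa>) * norm (x - y) \<le> 0"
      using m_dissipative_lower_bound[OF K, of "x - y" n] lin xy by simp
    then show "x = y" using n by (simp add: mult_le_0_iff)
  qed
  moreover have "(\<lambda>v. n *\<^sub>R v - K v) ` D = UNIV"
  proof (intro equalityI subset_UNIV subsetI)
    fix x
    obtain v where "v \<in> D" "n *\<^sub>R v - K v = x" using K n unfolding m_dissipative_def by blast
    then show "x \<in> (\<lambda>v. n *\<^sub>R v - K v) ` D" by (intro rev_image_eqI[of v]) simp_all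
  qed
  ultimately show ?thesis by (simp add: bij_betw_def)
qed

text \<open>
  Expanding the square of \<open>norm ((n - \<kappa>) *\<^sub>R v + w)\<close> with \<open>w = \<kappa> *\<^sub>R v - K v\<close>, the lower bound says
  \<open>0 \<le> 2 * (n - \<kappa>) * inner v w + (norm w)\<^sup>2\<close>. As \<open>n\<close> is arbitrarily large, \<open>inner v w \<ge> 0\<close>.
\<close>

lemma m_dissipativeI:
  assumes lin: "linear_operator D K"
    and low: "\<And>n v. n > \<kappa> \<Longrightarrow> v \<in> D \<Longrightarrow> (n - \<kappa>) * norm v \<le> norm (n *\<^sub>R v - K v)"
    and surj: "\<And>n x. n > \<kappa> \<Longrightarrow> \<exists>v\<in>D. n *\<^sub>R v - K v = x"
  shows "m_dissipative \<kappa> D K"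
  unfolding m_dissipative_def
proof (intro conjI ballI allI impI lin surj)
  fix v assume v: "v \<in> D"
  define w where "w = \<kappa> *\<^sub>R v - K v"
  have pos: "0 \<le> 2 * m * inner v w + (norm w)\<^sup>2" if m: "m > 0" for m
  proof -
    have "(m * norm v)\<^sup>2 \<le> (norm (m *\<^sub>R v + w))\<^sup>2"
      using low[of "m + \<kappa>" v] v m by (intro power_mono) (auto simp: w_def algebra_simps)
    also have "\<dots> = (m * norm v)\<^sup>2 + 2 * m * inner v w + (norm w)\<^sup>2"
      by (simp only: power2_norm_eq_inner power_mult_distrib)
        (simp add: inner_add_left inner_add_right inner_commute power2_eq_square algebra_simps)
    finally show ?thesis by simp
  qed
  have "inner v w \<ge> 0"
  proof (rule ccontr)
    assume "\<not> ?thesis"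
    then have neg: "inner v w < 0" by simp
    define m where "m = ((norm w)\<^sup>2 + 1) / (- 2 * inner v w)"
    have "m > 0" unfolding m_def using neg by (intro divide_pos_pos) (auto intro: add_nonneg_pos)
    moreover have "2 * m * inner v w = - ((norm w)\<^sup>2 + 1)" using neg by (simp add: m_def field_simps)
    ultimately show False using pos[of m] by simp
  qed
  then show "inner (K v) v \<le> \<kappa> * (norm v)\<^sup>2"
    by (simp add: w_def inner_diff_right power2_norm_eq_inner inner_commute)
qed

context
  fixes \<kappa> n :: real and D :: "'v::real_inner set" and K
  assumes K: "m_dissipative \<kappa> D K" and n: "n > \<kappa>"
begin

lemma resolvent_in_domain: "resolvent D K n x \<in> D"
  and resolvent_right_inverse: "n *\<^sub>R resolvent D K n x - K (resolvent D K n x) = x"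
proof -
  note b = m_dissipative_bij[OF K n, unfolded bij_betw_def]
  show "resolvent D K n x \<in> D"
    unfolding resolvent_def using b by (intro the_inv_into_into) auto
  show "n *\<^sub>R resolvent D K n x - K (resolvent D K n x) = x"
    unfolding resolvent_def using b f_the_inv_into_f[of "\<lambda>v. n *\<^sub>R v - K v" D x] by simp
qed

lemma resolvent_left_inverse: "v \<in> D \<Longrightarrow> resolvent D K n (n *\<^sub>R v - K v) = v"
  unfolding resolvent_def
  using the_inv_into_f_f[OF bij_betw_imp_inj_on[OF m_dissipative_bij[OF K n]], of v] by simp

lemma resolvent_eqI: "v \<in> D \<Longrightarrow> n *\<^sub>R v - K v = x \<Longrightarrow> resolvent D K n x = v"
  using resolvent_left_inverse by blast

lemma linear_resolvent: "linear (resolvent D K n)"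
proof
  note lin = linear_operatorD[OF m_dissipative_imp_linear_operator[OF K]]
  show "resolvent D K n (x + y) = resolvent D K n x + resolvent D K n y" for x y
    using resolvent_right_inverse[of x] resolvent_right_inverse[of y]
    by (intro resolvent_eqI) (simp_all add: lin resolvent_in_domain algebra_simps)
  show "resolvent D K n (c *\<^sub>R x) = c *\<^sub>R resolvent D K n x" for c x
  proof (rule resolvent_eqI)
    have "n *\<^sub>R c *\<^sub>R resolvent D K n x - K (c *\<^sub>R resolvent D K n x)
        = c *\<^sub>R (n *\<^sub>R resolvent D K n x - K (resolvent D K n x))"
      by (simp add: lin resolvent_in_domain algebra_simps)
    then show "n *\<^sub>R c *\<^sub>R resolvent D K n x - K (c *\<^sub>R resolvent D K n x) = c *\<^sub>R x"
      by (simp add: resolvent_right_inverse)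
  qed (simp add: lin resolvent_in_domain)
qed

lemma norm_resolvent_le: "norm (resolvent D K n x) \<le> norm x / (n - \<kappa>)"
  using m_dissipative_lower_bound[OF K resolvent_in_domain, of n x] n resolvent_right_inverse[of x]
  by (simp add: field_simps)

end

definition yosida :: "'v::real_vector set \<Rightarrow> ('v \<Rightarrow> 'v) \<Rightarrow> real \<Rightarrow> 'v \<Rightarrow> 'v" where
  "yosida D K n x = n *\<^sub>R (n *\<^sub>R resolvent D K n x - x)"

context
  fixes \<kappa> n :: real and D :: "'v::real_inner set" and K
  assumes K: "m_dissipative \<kappa> D K" and \<kappa>: "\<kappa> \<ge> 0" and n: "n \<ge> 2 * \<kappa>" "n > 0"
begin

lemma yosida_index_gt: "n > \<kappa>" using \<kappa> n by linarith

lemma ratio_le_2: "n / (n - \<kappa>) \<le> 2"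
  using yosida_index_gt n by (simp add: field_simps)

lemma norm_scaled_resolvent_le: "norm (n *\<^sub>R resolvent D K n x) \<le> 2 * norm x"
proof -
  have "norm (n *\<^sub>R resolvent D K n x) = n * norm (resolvent D K n x)" using n by simp
  also have "\<dots> \<le> n * (norm x / (n - \<kappa>))"
    using norm_resolvent_le[OF K yosida_index_gt, of x] n by (intro mult_left_mono) auto
  also have "\<dots> = n / (n - \<kappa>) * norm x" by simp
  also have "\<dots> \<le> 2 * norm x" using ratio_le_2 by (rule mult_right_mono) simp
  finally show ?thesis .
qed

lemma linear_yosida: "linear (yosida D K n)"
proof -
  interpret linear "resolvent D K n" by (rule linear_resolvent[OF K yosida_index_gt])
  show ?thesis by unfold_locales (simp_all add: yosida_def add scale algebra_simps)
qed

lemma yosida_eq: "yosida D K n x = K (n *\<^sub>R resolvent D K n x)"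
proof -
  have "K (resolvent D K n x) = n *\<^sub>R resolvent D K n x - x"
    using resolvent_right_inverse[OF K yosida_index_gt, of x] by (metis add_diff_cancel_left' diff_add_cancel)
  then show ?thesis
    using linear_operatorD(8)[OF m_dissipative_imp_linear_operator[OF K] resolvent_in_domain[OF K yosida_index_gt]]
    by (simp add: yosida_def)
qed

lemma norm_yosida_Lipschitz: "norm (yosida D K n x - yosida D K n y) \<le> 3 * n * norm (x - y)"
proof -
  have "yosida D K n x - yosida D K n y = n *\<^sub>R (n *\<^sub>R resolvent D K n (x - y) - (x - y))"
    using linear_diff[OF linear_yosida, of x y] by (simp add: yosida_def)
  also have "norm \<dots> \<le> n * (2 * norm (x - y) + norm (x - y))"
    using norm_scaled_resolvent_le[of "x - y"] n
      norm_triangle_ineq4[of "n *\<^sub>R resolvent D K n (x - y)" "x - y"]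
    by (simp only: norm_scaleR) (intro mult_mono, auto)
  finally show ?thesis by (simp add: algebra_simps)
qed

lemma yosida_on_domain:
  assumes v: "v \<in> D" shows "yosida D K n v = n *\<^sub>R resolvent D K n (K v)"
proof -
  have "resolvent D K n (n *\<^sub>R v - K v) = v" by (rule resolvent_left_inverse[OF K yosida_index_gt v])
  then have "n *\<^sub>R resolvent D K n v - v = resolvent D K n (K v)"
    by (simp add: linear_diff[OF linear_resolvent[OF K yosida_index_gt]] linear_cmul[OF linear_resolvent[OF K yosida_index_gt]])
       (metis add_diff_cancel_left' diff_add_cancel)
  then show ?thesis by (simp add: yosida_def)
qed

lemma norm_yosida_le: "v \<in> D \<Longrightarrow> norm (yosida D K n v) \<le> 2 * norm (K v)"
  using norm_scaled_resolvent_le[of "K v"] yosida_on_domain by simp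

lemma scaled_resolvent_minus_self: "n *\<^sub>R resolvent D K n x - x = (1 / n) *\<^sub>R yosida D K n x"
  using n by (simp add: yosida_def)

lemma yosida_dissipative: "inner (yosida D K n x) x \<le> 2 * \<kappa> * (norm x)\<^sup>2"
proof -
  have "inner (resolvent D K n x) x \<le> norm x / (n - \<kappa>) * norm x"
    using norm_cauchy_schwarz norm_resolvent_le[OF K yosida_index_gt, of x]
    by (meson mult_right_mono norm_ge_zero order_trans)
  then have "n * inner (resolvent D K n x) x \<le> n * (norm x / (n - \<kappa>) * norm x)"
    using n by (intro mult_left_mono) auto
  then have "n * (n * inner (resolvent D K n x) x - (norm x)\<^sup>2) \<le>
      n * (n * (norm x / (n - \<kappa>) * norm x) - (norm x)\<^sup>2)"
    using n by (intro mult_left_mono) auto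
  moreover have "inner (yosida D K n x) x = n * (n * inner (resolvent D K n x) x - (norm x)\<^sup>2)"
    by (simp add: yosida_def inner_diff_left power2_norm_eq_inner)
  ultimately have "inner (yosida D K n x) x \<le> n * (n * (norm x / (n - \<kappa>) * norm x) - (norm x)\<^sup>2)"
    by simp
  also have "\<dots> = (\<kappa> * (n / (n - \<kappa>))) * (norm x)\<^sup>2"
    using yosida_index_gt by (simp add: field_simps power2_eq_square)
  also have "\<dots> \<le> (\<kappa> * 2) * (norm x)\<^sup>2"
    using ratio_le_2 \<kappa> by (intro mult_right_mono mult_left_mono) auto
  finally show ?thesis by (simp add: mult.commute)
qed

end

text \<open>
  The equation \<open>n v - K v - L v = x\<close> is the fixed point equation \<open>v = (n - K)\<^sup>-\<^sup>1 (x + L v)\<close>, a contraction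
  for \<open>n > \<kappa> + l\<close>.
\<close>

lemma m_dissipative_add_bounded:
  fixes D :: "'v::{real_inner, complete_space} set"
  assumes K: "m_dissipative \<kappa> D K" and L: "linear L" "\<And>x. norm (L x) \<le> l * norm x" and l: "l \<ge> 0"
  shows "m_dissipative (\<kappa> + l) D (\<lambda>v. K v + L v)"
  unfolding m_dissipative_def
proof (intro conjI ballI allI impI)
  note lin = linear_operatorD[OF m_dissipative_imp_linear_operator[OF K]]
  show "linear_operator D (\<lambda>v. K v + L v)"
    using m_dissipative_imp_linear_operator[OF K] L(1)
    by (simp add: linear_operator_def linear_add linear_cmul algebra_simps)
  fix v assume v: "v \<in> D"
  have "inner (L v) v \<le> l * norm v * norm v"
    using norm_cauchy_schwarz L(2)[of v] by (meson mult_right_mono norm_ge_zero order_trans)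
  then show "inner (K v + L v) v \<le> (\<kappa> + l) * (norm v)\<^sup>2"
    using K v by (simp add: m_dissipative_def inner_add_left algebra_simps power2_eq_square) fastforce
next
  fix n x assume n: "\<kappa> + l < n"
  then have n': "n > \<kappa>" using l by simp
  let ?f = "\<lambda>v. resolvent D K n (x + L v)"
  have "\<exists>!v. ?f v = v"
  proof (rule banach_fix_type)
    show "0 \<le> l / (n - \<kappa>)" "l / (n - \<kappa>) < 1" using l n by auto
    show "\<forall>v w. dist (?f v) (?f w) \<le> l / (n - \<kappa>) * dist v w"
    proof (intro allI)
      fix v w
      have "?f v - ?f w = resolvent D K n (L (v - w))"
        by (simp add: linear_diff[OF linear_resolvent[OF K n'], symmetric] linear_diff[OF L(1)])
      also have "norm \<dots> \<le> norm (L (v - w)) / (n - \<kappa>)" by (rule norm_resolvent_le[OF K n'])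
      also have "\<dots> \<le> l * norm (v - w) / (n - \<kappa>)" using L(2) n' by (intro divide_right_mono) auto
      finally show "dist (?f v) (?f w) \<le> l / (n - \<kappa>) * dist v w" by (simp add: dist_norm)
    qed
  qed
  then obtain v where v: "?f v = v" by blast
  then have "v \<in> D" using resolvent_in_domain[OF K n', of "x + L v"] by simp
  moreover have "n *\<^sub>R v - (K v + L v) = x"
    using resolvent_right_inverse[OF K n', of "x + L v"] unfolding v by (simp add: algebra_simps)
  ultimately show "\<exists>v\<in>D. n *\<^sub>R v - (K v + L v) = x" by blast
qed

text \<open>
  On the range of \<open>S\<close> the Yosida approximations \<open>J\<^sub>n K\<close> converge to \<open>K\<close>, because \<open>J\<^sub>n\<close>
  converges strongly to the identity: it does so on the dense domain, and \<open>norm J\<^sub>n \<le> 2\<close>.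
\<close>

lemma bounded_linear_dissipative_comp:
  fixes S :: "'v::{real_inner, complete_space} \<Rightarrow> 'v"
  assumes K: "m_dissipative \<kappa> D K" and \<kappa>: "\<kappa> \<ge> 0"
    and S: "bounded_linear S" "closure (range S) = UNIV" "range S \<subseteq> D"
  shows "bounded_linear (\<lambda>v. K (S v))"
proof -
  define n where "n k = 2 * \<kappa> + 1 + real k" for k
  have n: "n k \<ge> 2 * \<kappa>" "n k > 0" for k using \<kappa> by (auto simp: n_def)
  note ngt = yosida_index_gt[OF K \<kappa> n]
  define J where "J k x = n k *\<^sub>R resolvent D K (n k) x" for k x
  have n_lim: "(\<lambda>k. c / n k) \<longlonglongrightarrow> 0" for c
  proof -
    have "filterlim n at_top sequentially"
      by (rule filterlim_at_top_mono[OF filterlim_real_sequentially]) (use \<kappa> in \<open>simp add: n_def\<close>)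
    then show ?thesis by (intro tendsto_divide_0[OF tendsto_const] filterlim_at_top_imp_at_infinity)
  qed
  have J2: "norm (J k x) \<le> 2 * norm x" for k x
    unfolding J_def by (rule norm_scaled_resolvent_le[OF K \<kappa> n])
  have Jd: "J k (x - y) = J k x - J k y" for k x y
    unfolding J_def by (simp add: linear_diff[OF linear_resolvent[OF K ngt]] scaleR_diff_right)
  have J_lim: "(\<lambda>k. J k x) \<longlonglongrightarrow> x" for x
  proof (rule LIMSEQ_I)
    fix r :: real assume r: "r > 0"
    have "x \<in> closure (range S)" using S by simp
    then obtain q where q: "dist (S q) x < r / 6"
      using r unfolding closure_approachable by (metis (no_types, lifting) imageE zero_less_divide_iff zero_less_numeral)
    define y where "y = S q"
    have y: "y \<in> D" using S(3) by (auto simp: y_def)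
    obtain k0 where k0: "\<And>k. k \<ge> k0 \<Longrightarrow> 2 * norm (K y) / n k < r / 2"
      using order_tendstoD(2)[OF n_lim[of "2 * norm (K y)"], of "r / 2"] r by (auto simp: eventually_sequentially)
    have "norm (J k x - x) < r" if k: "k \<ge> k0" for k
    proof -
      have "norm (J k y - y) \<le> 2 * norm (K y) / n k"
        unfolding J_def scaled_resolvent_minus_self[OF K \<kappa> n]
        using norm_yosida_le[OF K \<kappa> n y, of k] n(2)[of k] by (simp add: divide_right_mono)
      then have 1: "norm (J k y - y) < r / 2" using k0[OF k] by simp
      have 2: "norm (y - x) < r / 6" using q by (simp add: y_def dist_norm)
      have 3: "norm (J k (y - x)) < r / 3" using J2[of k "y - x"] 2 by simp
      have eq: "J k x - x = (J k y - y) + (y - x) - J k (y - x)" by (simp add: Jd)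
      show ?thesis using norm_triangle3[of "J k y - y" "y - x" "J k (y - x)", folded eq] 1 2 3 by linarith
    qed
    then show "\<exists>no. \<forall>k\<ge>no. norm (J k x - x) < r" by blast
  qed
  show ?thesis
  proof (rule bounded_linear_pointwise_limit)
    show "bounded_linear (\<lambda>v. yosida D K (n k) (S v))" for k
    proof -
      have "bounded_linear (yosida D K (n k))"
      proof (rule bounded_linear_intro)
        show "norm (yosida D K (n k) x) \<le> norm x * (3 * n k)" for x
          using norm_yosida_Lipschitz[OF K \<kappa> n, of k x 0] linear_0[OF linear_yosida[OF K \<kappa> n, of k]]
          by (simp add: mult.commute)
      qed (simp_all add: linear_add[OF linear_yosida[OF K \<kappa> n]] linear_cmul[OF linear_yosida[OF K \<kappa> n]])
      then show ?thesis using S(1) by (rule bounded_linear_compose)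
    qed
    show "(\<lambda>k. yosida D K (n k) (S v)) \<longlonglongrightarrow> K (S v)" for v
    proof -
      have "yosida D K (n k) (S v) = J k (K (S v))" for k
        unfolding J_def by (rule yosida_on_domain[OF K \<kappa> n]) (use S(3) in auto)
      then show ?thesis using J_lim by simp
    qed
  qed
qed

section \<open>The hyperbolic evolution equation\<close>

text \<open>
  The operator \<open>S\<close> stands for the embedding of the smaller space, identified with \<open>V\<close> through
  the isomorphism. The commutator condition says that \<open>K t\<close>, transported to the smaller space, is
  a bounded perturbation of \<open>K t\<close>.
\<close>

locale kato_family =
  fixes s T \<kappa> l M :: real
    and D :: "real \<Rightarrow> 'v::{real_inner, complete_space} set" and K :: "real \<Rightarrow> 'v \<Rightarrow> 'v"
    and S :: "'v \<Rightarrow> 'v" and L :: "real \<Rightarrow> 'v \<Rightarrow> 'v"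
  assumes sT: "s < T" and \<kappa>: "\<kappa> \<ge> 0" and l: "l \<ge> 0" and M: "M \<ge> 0"
    and K: "\<And>t. t \<in> {s..T} \<Longrightarrow> m_dissipative \<kappa> (D t) (K t)"
    and S: "bounded_linear S" "closure (range S) = UNIV"
    and SD: "\<And>t x. t \<in> {s..T} \<Longrightarrow> S x \<in> D t"
    and KS: "\<And>t x. t \<in> {s..T} \<Longrightarrow> norm (K t (S x)) \<le> M * norm x"
    and KS_cont: "\<And>x. continuous_on {s..T} (\<lambda>t. K t (S x))"
    and L: "\<And>t. t \<in> {s..T} \<Longrightarrow> linear (L t)"
    and L_le: "\<And>t x. t \<in> {s..T} \<Longrightarrow> norm (L t x) \<le> l * norm x"
    and L_cont: "\<And>x. continuous_on {s..T} (\<lambda>t. L t x)"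
    and commutator: "\<And>t v. t \<in> {s..T} \<Longrightarrow> v \<in> D t \<Longrightarrow> K t (S v) = S (K t v + L t v)"
begin

abbreviation "R n t \<equiv> resolvent (D t) (K t) n"
abbreviation "KL t \<equiv> (\<lambda>v. K t v + L t v)"
abbreviation "RL n t \<equiv> resolvent (D t) (KL t) n"

lemma S_lin: "linear S" using S(1) by (rule bounded_linear.linear)

lemma KL: "t \<in> {s..T} \<Longrightarrow> m_dissipative (\<kappa> + l) (D t) (KL t)"
  by (rule m_dissipative_add_bounded[OF K L L_le l])

lemma S_diff: "S (x - y) = S x - S y" and S_add: "S (x + y) = S x + S y"
  and S_scale: "S (c *\<^sub>R x) = c *\<^sub>R S x"
  using S_lin by (auto simp: linear_diff linear_add linear_cmul)

text \<open>
  The smaller space is invariant under the resolvent of \<open>K t\<close>, and there this resolvent acts as that of the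
  perturbed operator \<open>K t + L t\<close>.
\<close>

lemma resolvent_S:
  assumes t: "t \<in> {s..T}" and n: "n > \<kappa> + l"
  shows "R n t (S q) = S (RL n t q)"
proof (rule resolvent_eqI[OF K[OF t]])
  show "n > \<kappa>" using n l by simp
  show "S (RL n t q) \<in> D t" using SD t .
  have "n *\<^sub>R S (RL n t q) - K t (S (RL n t q)) = S (n *\<^sub>R RL n t q - KL t (RL n t q))"
    using resolvent_in_domain[OF KL[OF t] n] by (simp add: commutator[OF t] S_diff S_scale)
  then show "n *\<^sub>R S (RL n t q) - K t (S (RL n t q)) = S q"
    using resolvent_right_inverse[OF KL[OF t] n] by simp
qed

lemma yosida_S:
  assumes t: "t \<in> {s..T}" and n: "n > \<kappa> + l"
  shows "yosida (D t) (K t) n (S q) = S (yosida (D t) (KL t) n q)"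
  by (simp add: yosida_def resolvent_S[OF t n] S_diff S_scale)

text \<open>
  The resolvent identity \<open>R t - R t0 = R t (K t - K t0) (R t0)\<close> makes sense on the range of \<open>S\<close>, which
  \<open>R t0\<close> preserves and on which \<open>K\<close> is strongly continuous. Density and the uniform bound on the
  resolvents do the rest.
\<close>

lemma continuous_resolvent:
  assumes n: "n > \<kappa> + l"
  shows "continuous_on {s..T} (\<lambda>t. R n t x)"
proof -
  have n': "n > \<kappa>" using n l by simp
  have dense: "continuous_on {s..T} (\<lambda>t. R n t (S q))" for q
    unfolding continuous_on_def
  proof
    fix t0 assume t0: "t0 \<in> {s..T}"
    define p where "p = RL n t0 q"
    have Sq: "S q = n *\<^sub>R S p - K t0 (S p)"
      using resolvent_right_inverse[OF K[OF t0] n', of "S q"] resolvent_S[OF t0 n] by (simp add: p_def)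
    have "((\<lambda>t. R n t (S q) - S p) \<longlongrightarrow> 0) (at t0 within {s..T})"
    proof (rule Lim_transform_bound)
      show "\<forall>\<^sub>F t in at t0 within {s..T}. norm (R n t (S q) - S p) \<le> norm ((K t (S p) - K t0 (S p)) /\<^sub>R (n - \<kappa>))"
        unfolding eventually_at_filter
      proof (intro always_eventually allI impI)
        fix t assume t: "t \<in> {s..T}"
        have "S p = R n t (n *\<^sub>R S p - K t (S p))"
          using resolvent_left_inverse[OF K[OF t] n' SD[OF t]] by simp
        then have "R n t (S q) - S p = R n t (S q - (n *\<^sub>R S p - K t (S p)))"
          by (metis linear_diff[OF linear_resolvent[OF K[OF t] n']])
        also have "S q - (n *\<^sub>R S p - K t (S p)) = K t (S p) - K t0 (S p)" by (simp add: Sq)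
        finally show "norm (R n t (S q) - S p) \<le> norm ((K t (S p) - K t0 (S p)) /\<^sub>R (n - \<kappa>))"
          using norm_resolvent_le[OF K[OF t] n', of "K t (S p) - K t0 (S p)"] n'
          by (simp add: divide_inverse mult.commute)
      qed
      have "((\<lambda>t. K t (S p)) \<longlongrightarrow> K t0 (S p)) (at t0 within {s..T})"
        using KS_cont[of p] t0 by (simp add: continuous_on_def)
      then have "((\<lambda>t. (K t (S p) - K t0 (S p)) /\<^sub>R (n - \<kappa>)) \<longlongrightarrow> (K t0 (S p) - K t0 (S p)) /\<^sub>R (n - \<kappa>))
          (at t0 within {s..T})" by (intro tendsto_intros)
      then show "((\<lambda>t. (K t (S p) - K t0 (S p)) /\<^sub>R (n - \<kappa>)) \<longlongrightarrow> 0) (at t0 within {s..T})" by simp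
    qed
    then show "((\<lambda>t. R n t (S q)) \<longlongrightarrow> R n t0 (S q)) (at t0 within {s..T})"
      by (simp add: resolvent_S[OF t0 n] p_def LIM_zero_cancel)
  qed
  show ?thesis
  proof (rule continuous_on_uniform_approximation)
    fix \<epsilon> :: real assume "\<epsilon> > 0"
    then have e: "\<epsilon> * (n - \<kappa>) > 0" using n' by simp
    have "x \<in> closure (range S)" using S by simp
    then obtain q where q: "dist (S q) x < \<epsilon> * (n - \<kappa>)"
      using e unfolding closure_approachable by blast
    have "norm (R n t (S q) - R n t x) \<le> \<epsilon>" if t: "t \<in> {s..T}" for t
    proof -
      have "norm (R n t (S q) - R n t x) \<le> norm (S q - x) / (n - \<kappa>)"
        using norm_resolvent_le[OF K[OF t] n', of "S q - x"]
        by (simp add: linear_diff[OF linear_resolvent[OF K[OF t] n']])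
      also have "\<dots> \<le> \<epsilon>" using q n' by (simp add: dist_norm pos_divide_le_eq)
      finally show ?thesis .
    qed
    with dense show "\<exists>h. continuous_on {s..T} h \<and> (\<forall>t\<in>{s..T}. norm (h t - R n t x) \<le> \<epsilon>)" by blast
  qed
qed

text \<open>
  The perturbed resolvent \<open>y t\<close> of \<open>x\<close> solves \<open>y t = R n t (x + L t (y t))\<close>, with contraction constant
  \<open>l / (n - \<kappa>)\<close> independent of \<open>t\<close>.
\<close>

lemma continuous_perturbed_resolvent:
  assumes n: "n > \<kappa> + l"
  shows "continuous_on {s..T} (\<lambda>t. RL n t x)"
  unfolding continuous_on_def
proof
  have n': "n > \<kappa>" using n l by simp
  fix t0 assume t0: "t0 \<in> {s..T}"
  define p where "p = RL n t0 x"
  define f where "f t = R n t (x + L t p)" for t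
  have eq: "RL n t x = R n t (x + L t (RL n t x))" if t: "t \<in> {s..T}" for t
    using resolvent_in_domain[OF KL[OF t] n, of x] resolvent_right_inverse[OF KL[OF t] n, of x]
    by (intro resolvent_eqI[OF K[OF t] n', symmetric]) (auto simp: algebra_simps)
  have fc: "continuous_on {s..T} f" unfolding f_def
  proof (rule continuous_on_Lipschitz_family[where F = "R n" and c = "1 / (n - \<kappa>)"])
    show "norm (R n t v - R n t w) \<le> 1 / (n - \<kappa>) * norm (v - w)" if t: "t \<in> {s..T}" for t v w
      using norm_resolvent_le[OF K[OF t] n', of "v - w"]
      by (simp add: linear_diff[OF linear_resolvent[OF K[OF t] n']])
  qed (auto intro!: continuous_resolvent n continuous_intros L_cont)
  define q where "q = l / (n - \<kappa>)"
  have q: "0 \<le> q" "q < 1" using l n by (auto simp: q_def)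
  have bd: "norm (RL n t x - p) \<le> norm ((f t - f t0) /\<^sub>R (1 - q))" if t: "t \<in> {s..T}" for t
  proof -
    have ft0: "f t0 = p" using eq[OF t0] by (simp add: f_def p_def)
    have "RL n t x - f t = R n t (L t (RL n t x - p))"
      unfolding f_def by (subst eq[OF t])
        (simp add: linear_diff[OF L[OF t]] linear_diff[OF linear_resolvent[OF K[OF t] n'], symmetric])
    also have "norm \<dots> \<le> norm (L t (RL n t x - p)) / (n - \<kappa>)" by (rule norm_resolvent_le[OF K[OF t] n'])
    also have "\<dots> \<le> l * norm (RL n t x - p) / (n - \<kappa>)"
      using L_le[OF t] n' by (intro divide_right_mono) auto
    finally have "norm (RL n t x - f t) \<le> q * norm (RL n t x - p)" by (simp add: q_def)
    then have "norm (RL n t x - p) \<le> q * norm (RL n t x - p) + norm (f t - f t0)"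
      using norm_triangle_ineq[of "RL n t x - f t" "f t - f t0"] ft0 by simp
    then have "(1 - q) * norm (RL n t x - p) \<le> norm (f t - f t0)" by (simp add: algebra_simps)
    then have "norm (RL n t x - p) \<le> norm (f t - f t0) / (1 - q)"
      using q by (simp add: pos_le_divide_eq mult.commute)
    also have "\<dots> = norm ((f t - f t0) /\<^sub>R (1 - q))" using q by (simp add: divide_inverse mult.commute)
    finally show ?thesis .
  qed
  have "((\<lambda>t. RL n t x - p) \<longlongrightarrow> 0) (at t0 within {s..T})"
  proof (rule Lim_transform_bound)
    show "\<forall>\<^sub>F t in at t0 within {s..T}. norm (RL n t x - p) \<le> norm ((f t - f t0) /\<^sub>R (1 - q))"
      using bd by (auto simp: eventually_at_filter)
    have "((\<lambda>t. (f t - f t0) /\<^sub>R (1 - q)) \<longlongrightarrow> (f t0 - f t0) /\<^sub>R (1 - q)) (at t0 within {s..T})"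
      using fc t0 by (intro tendsto_intros) (simp add: continuous_on_def)
    then show "((\<lambda>t. (f t - f t0) /\<^sub>R (1 - q)) \<longlongrightarrow> 0) (at t0 within {s..T})" by simp
  qed
  then show "((\<lambda>t. RL n t x) \<longlongrightarrow> RL n t0 x) (at t0 within {s..T})"
    by (simp add: p_def LIM_zero_cancel)
qed

text \<open>
  The offset makes every index admissible for the Yosida approximations of both \<open>K t\<close> and
  \<open>K t + L t\<close>, with bounds that do not depend on the index.
\<close>

definition \<nu> :: "nat \<Rightarrow> real" where "\<nu> k = 2 * (\<kappa> + l) + 1 + real k"

abbreviation "Y k t \<equiv> yosida (D t) (K t) (\<nu> k)"

lemma \<nu>: "\<nu> k > \<kappa> + l" "\<nu> k \<ge> 2 * (\<kappa> + l)" "\<nu> k > 0" "\<nu> k \<ge> 2 * \<kappa>" "\<nu> k \<ge> 1" "\<nu> k \<ge> real k"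
  "\<kappa> + l \<ge> 0"
  using \<kappa> l by (auto simp: \<nu>_def)


lemma divide_\<nu>_tendsto_0: "(\<lambda>k. c / \<nu> k) \<longlonglongrightarrow> 0"
proof -
  have "filterlim \<nu> at_top sequentially"
    by (rule filterlim_at_top_mono[OF filterlim_real_sequentially]) (simp add: \<nu>)
  then show ?thesis by (intro tendsto_divide_0[OF tendsto_const] filterlim_at_top_imp_at_infinity)
qed

definition near_solution ::
    "real \<Rightarrow> nat \<Rightarrow> 'v \<Rightarrow> (real \<Rightarrow> 'v) \<Rightarrow> (real \<Rightarrow> 'v) \<Rightarrow> (real \<Rightarrow> 'v) \<Rightarrow> (real \<Rightarrow> 'v) \<Rightarrow> bool" where
  "near_solution \<epsilon> k u0 g u x x' \<longleftrightarrow> norm (x s - u0) \<le> \<epsilon> \<and>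
     (\<forall>t\<in>{s..T}. (x has_vector_derivative x' t) (at t within {s..T}) \<and>
        norm (x t - u t) \<le> \<epsilon> \<and> norm (x' t - Y k t (x t) - g t) \<le> \<epsilon>)"

text \<open>
  A mild solution of \<open>u' = K u + g\<close>, \<open>u s = u0\<close> is a uniform limit of curves that solve the regularized
  equation up to a uniformly small error. The curves are required for all large \<open>k\<close>, so
  two mild solutions can be compared with approximations having the same \<open>k\<close>. The notion is closed
  under uniform limits of solutions and data.
\<close>

definition mild :: "'v \<Rightarrow> (real \<Rightarrow> 'v) \<Rightarrow> (real \<Rightarrow> 'v) \<Rightarrow> bool" where
  "mild u0 g u \<longleftrightarrow> continuous_on {s..T} u \<and>
     (\<forall>\<epsilon>>0. \<exists>N. \<forall>k\<ge>N. \<exists>x x'. near_solution \<epsilon> k u0 g u x x')"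

text \<open>
  The difference of two approximating curves solves a linear equation with the bounded
  dissipative operator \<open>Y k t\<close>, whose constant \<open>2 * \<kappa>\<close> does not depend on \<open>k\<close>. The exponential weight
  is the one required by the fixed point argument.
\<close>

lemma mild_stability:
  assumes u: "mild u0 g u" and v: "mild v0 h v" and \<mu>: "\<mu> > 2 * \<kappa>"
    and b: "norm (u0 - v0) \<le> b"
    and gh: "\<And>t. t \<in> {s..T} \<Longrightarrow> norm (g t - h t) \<le> (\<mu> - 2 * \<kappa>) * b * exp (\<mu> * (t - s))"
    and t: "t \<in> {s..T}"
  shows "norm (u t - v t) \<le> b * exp (\<mu> * (t - s))"
proof (rule field_le_epsilon)
  fix \<eta> :: real assume \<eta>: "\<eta> > 0"
  define E where "E = exp (\<mu> * (t - s))"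
  define \<delta> where "\<delta> = \<mu> - 2 * \<kappa>"
  have \<delta>: "\<delta> > 0" using \<mu> by (simp add: \<delta>_def)
  have \<mu>0: "\<mu> \<ge> 0" using \<mu> \<kappa> by linarith
  have b0: "b \<ge> 0" using b norm_ge_zero order_trans by blast
  define c where "c = (2 + 2 / \<delta>) * E + 2"
  have "c > 0" unfolding c_def using \<delta> by (intro add_nonneg_pos mult_nonneg_nonneg) (auto simp: E_def)
  define \<epsilon> where "\<epsilon> = \<eta> / c"
  have \<epsilon>: "\<epsilon> > 0" using \<eta> \<open>c > 0\<close> by (simp add: \<epsilon>_def)
  obtain N1 where N1: "\<forall>k\<ge>N1. \<exists>x x'. near_solution \<epsilon> k u0 g u x x'"
    using u \<epsilon> unfolding mild_def by blast
  obtain N2 where N2: "\<forall>k\<ge>N2. \<exists>x x'. near_solution \<epsilon> k v0 h v x x'"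
    using v \<epsilon> unfolding mild_def by blast
  obtain k where "N1 \<le> k" "N2 \<le> k" using max.cobounded1 max.cobounded2 by blast
  obtain x x' where x: "norm (x s - u0) \<le> \<epsilon>"
    "\<And>t. t \<in> {s..T} \<Longrightarrow> (x has_vector_derivative x' t) (at t within {s..T})"
    "\<And>t. t \<in> {s..T} \<Longrightarrow> norm (x t - u t) \<le> \<epsilon>"
    "\<And>t. t \<in> {s..T} \<Longrightarrow> norm (x' t - Y k t (x t) - g t) \<le> \<epsilon>"
    using N1 \<open>N1 \<le> k\<close> unfolding near_solution_def by blast
  obtain z z' where z: "norm (z s - v0) \<le> \<epsilon>"
    "\<And>t. t \<in> {s..T} \<Longrightarrow> (z has_vector_derivative z' t) (at t within {s..T})"
    "\<And>t. t \<in> {s..T} \<Longrightarrow> norm (z t - v t) \<le> \<epsilon>"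
    "\<And>t. t \<in> {s..T} \<Longrightarrow> norm (z' t - Y k t (z t) - h t) \<le> \<epsilon>"
    using N2 \<open>N2 \<le> k\<close> unfolding near_solution_def by blast
  define a where "a = b + 2 * \<epsilon> + 2 * \<epsilon> / \<delta>"
  have a0: "a \<ge> 0" unfolding a_def using b0 \<epsilon> \<delta> by simp
  have "norm (x t - z t) \<le> a * exp (\<mu> * (t - s))"
  proof (rule exponential_bound_from_dissipativity[OF _ _ _ t])
    show "((\<lambda>t. x t - z t) has_vector_derivative (x' r - z' r)) (at r within {s..T})" if "r \<in> {s..T}" for r
      using x(2) z(2) that by (intro has_vector_derivative_diff) auto
    have eq: "x s - z s = (x s - u0) + (u0 - v0) - (z s - v0)" by simp
    then have "norm (x s - z s) \<le> \<epsilon> + b + \<epsilon>"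
      using norm_triangle3[of "x s - u0" "u0 - v0" "z s - v0", folded eq] x(1) z(1) b by linarith
    also have "\<dots> \<le> a" unfolding a_def using \<epsilon> \<delta> by simp
    finally show "norm (x s - z s) \<le> a" .
    fix r assume r: "r \<in> {s..T}" and big: "a * exp (\<mu> * (r - s)) < norm (x r - z r)"
    define e where "e = exp (\<mu> * (r - s))"
    have e1: "e \<ge> 1" using r \<mu>0 by (simp add: e_def)
    define \<gamma> where "\<gamma> = x' r - z' r - Y k r (x r - z r)"
    have Ylin: "Y k r (x r - z r) = Y k r (x r) - Y k r (z r)"
      by (rule linear_diff[OF linear_yosida[OF K \<kappa> \<nu>(4,3)]]) (rule r)
    have "\<gamma> = (x' r - Y k r (x r) - g r) + (g r - h r) - (z' r - Y k r (z r) - h r)"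
      by (simp add: \<gamma>_def Ylin)
    then have "norm \<gamma> \<le> \<epsilon> + \<delta> * b * e + \<epsilon>"
      using norm_triangle3[of "x' r - Y k r (x r) - g r" "g r - h r" "z' r - Y k r (z r) - h r"]
        x(4)[OF r] z(4)[OF r] gh[OF r] by (simp add: e_def \<delta>_def)
    also have "\<dots> \<le> \<delta> * (a * e)"
    proof -
      have "2 * \<epsilon> * 1 \<le> 2 * \<epsilon> * e" using e1 \<epsilon> by (intro mult_left_mono) auto
      moreover have "\<delta> * (a * e) = \<delta> * b * e + \<delta> * (2 * \<epsilon>) * e + 2 * \<epsilon> * e"
        unfolding a_def using \<delta> by (simp add: field_simps)
      moreover have "\<delta> * (2 * \<epsilon>) * e \<ge> 0" using \<delta> \<epsilon> e1 by simp
      ultimately show ?thesis by linarith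
    qed
    also have "\<dots> \<le> \<delta> * norm (x r - z r)" using big \<delta> by (simp add: e_def)
    finally have \<gamma>: "norm \<gamma> \<le> \<delta> * norm (x r - z r)" .
    have "inner (x' r - z' r) (x r - z r) = inner (Y k r (x r - z r)) (x r - z r) + inner \<gamma> (x r - z r)"
      by (simp add: \<gamma>_def inner_diff_left)
    also have "inner (Y k r (x r - z r)) (x r - z r) \<le> 2 * \<kappa> * (norm (x r - z r))\<^sup>2"
      by (rule yosida_dissipative[OF K \<kappa> \<nu>(4,3)]) (rule r)
    also have "inner \<gamma> (x r - z r) \<le> norm \<gamma> * norm (x r - z r)" by (rule norm_cauchy_schwarz)
    also have "\<dots> \<le> \<delta> * norm (x r - z r) * norm (x r - z r)" using \<gamma> by (rule mult_right_mono) simp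
    finally show "inner (x' r - z' r) (x r - z r) \<le> \<mu> * (norm (x r - z r))\<^sup>2"
      by (simp add: \<delta>_def power2_eq_square algebra_simps)
  qed
  then have 1: "norm (x t - z t) \<le> a * E" by (simp add: E_def)
  have eq: "u t - v t = (x t - z t) + (z t - v t) - (x t - u t)" by simp
  then have "norm (u t - v t) \<le> a * E + \<epsilon> + \<epsilon>"
    using norm_triangle3[of "x t - z t" "z t - v t" "x t - u t", folded eq] x(3)[OF t] z(3)[OF t] 1 by linarith
  also have "\<dots> = b * E + \<epsilon> * c" unfolding a_def c_def by (simp add: field_simps)
  also have "\<dots> = b * E + \<eta>" using \<open>c > 0\<close> by (simp add: \<epsilon>_def)
  finally show "norm (u t - v t) \<le> b * exp (\<mu> * (t - s)) + \<eta>" by (simp add: E_def)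
qed

lemma mild_closed:
  assumes "\<And>\<epsilon>. \<epsilon> > 0 \<Longrightarrow> \<exists>v0 h v. mild v0 h v \<and> norm (v0 - u0) \<le> \<epsilon> \<and>
      (\<forall>t\<in>{s..T}. norm (h t - g t) \<le> \<epsilon> \<and> norm (v t - u t) \<le> \<epsilon>)"
  shows "mild u0 g u"
  unfolding mild_def
proof (intro conjI allI impI)
  show "continuous_on {s..T} u"
  proof (rule continuous_on_uniform_approximation)
    show "\<exists>h. continuous_on {s..T} h \<and> (\<forall>t\<in>{s..T}. norm (h t - u t) \<le> \<epsilon>)" if "\<epsilon> > 0" for \<epsilon>
      using assms[OF that] unfolding mild_def by blast
  qed
  fix \<epsilon> :: real assume "\<epsilon> > 0"
  then have e2: "\<epsilon> / 2 > 0" by simp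
  obtain v0 h v where v: "mild v0 h v" "norm (v0 - u0) \<le> \<epsilon> / 2"
    "\<And>t. t \<in> {s..T} \<Longrightarrow> norm (h t - g t) \<le> \<epsilon> / 2" "\<And>t. t \<in> {s..T} \<Longrightarrow> norm (v t - u t) \<le> \<epsilon> / 2"
    using assms[OF e2] by blast
  obtain N where N: "\<forall>k\<ge>N. \<exists>x x'. near_solution (\<epsilon> / 2) k v0 h v x x'"
    using v(1) e2 unfolding mild_def by blast
  show "\<exists>N. \<forall>k\<ge>N. \<exists>x x'. near_solution \<epsilon> k u0 g u x x'"
  proof (intro exI[of _ N] allI impI)
    fix k assume "k \<ge> N"
    then obtain x x' where x: "norm (x s - v0) \<le> \<epsilon> / 2"
      "\<And>t. t \<in> {s..T} \<Longrightarrow> (x has_vector_derivative x' t) (at t within {s..T})"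
      "\<And>t. t \<in> {s..T} \<Longrightarrow> norm (x t - v t) \<le> \<epsilon> / 2"
      "\<And>t. t \<in> {s..T} \<Longrightarrow> norm (x' t - Y k t (x t) - h t) \<le> \<epsilon> / 2"
      using N unfolding near_solution_def by blast
    have "norm (x s - u0) \<le> \<epsilon>" using x(1) v(2) norm_triangle_ineq[of "x s - v0" "v0 - u0"] by simp
    moreover have "norm (x t - u t) \<le> \<epsilon>" if "t \<in> {s..T}" for t
      using x(3)[OF that] v(4)[OF that] norm_triangle_ineq[of "x t - v t" "v t - u t"] by simp
    moreover have "norm (x' t - Y k t (x t) - g t) \<le> \<epsilon>" if "t \<in> {s..T}" for t
      using x(4)[OF that] v(3)[OF that]
        norm_triangle_ineq[of "x' t - Y k t (x t) - h t" "h t - g t"] by simp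
    ultimately show "\<exists>x x'. near_solution \<epsilon> k u0 g u x x'"
      using x(2) unfolding near_solution_def by - (rule exI[of _ x], rule exI[of _ x'], simp)
  qed
qed

text \<open>
  The equation is solved in the smaller space: \<open>q\<close> solves it with \<open>K t + L t\<close> in place of \<open>K t\<close>,
  stays bounded by \<open>B\<close> independently of \<open>k\<close>, and \<open>x = S q\<close> is an exact solution of the regularized
  equation for which \<open>Y k t (x k t)\<close> is bounded by a constant \<open>C\<close>. For two indices the difference
  \<open>y\<close> of the solutions satisfies
  \<open>inner y' y = inner (K p1 - K p2) (p1 - p2) - inner (K p1 - K p2) d\<close>, where \<open>p1\<close>, \<open>p2\<close> are the
  images under \<open>J\<^sub>n\<close> of the two solutions and \<open>d = p1 - p2 - y\<close> is of order \<open>C / \<nu> k\<close>. Hence the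
  solutions form a Cauchy sequence with rate \<open>\<nu> k\<close> to the power \<open>- 1 / 2\<close>. Only one time \<open>t\<close> occurs in
  this comparison, so strong continuity of \<open>K t \<circ> S\<close> is sufficient.
\<close>

lemma mild_exists_regular:
  assumes h: "continuous_on {s..T} h"
  shows "\<exists>u. mild (S q0) (\<lambda>t. S (h t)) u"
proof -
  have "\<exists>q. q s = q0 \<and> (\<forall>t\<in>{s..T}. (q has_vector_derivative
      (yosida (D t) (KL t) (\<nu> k) (q t) + h t)) (at t within {s..T}))" for k
  proof -
    define F where "F t x = yosida (D t) (KL t) (\<nu> k) x + h t" for t x
    obtain y where "y s = q0"
      "\<And>t. t \<in> {s..T} \<Longrightarrow> (y has_vector_derivative F t (y t)) (at t within {s..T})"
    proof (rule Picard_Lindeloef_global[of s T F "3 * \<nu> k" q0])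
      show "continuous_on {s..T} (\<lambda>t. F t x)" for x
        unfolding F_def yosida_def
        by (intro continuous_intros h continuous_perturbed_resolvent \<nu>)
      show "norm (F t x - F t y) \<le> 3 * \<nu> k * norm (x - y)" if "t \<in> {s..T}" for t x y
        using norm_yosida_Lipschitz[OF KL[OF that] \<nu>(7,2,3), of k x y] by (simp add: F_def)
    qed (use \<nu>(3)[of k] in auto)
    then show ?thesis unfolding F_def by blast
  qed
  then obtain q where q0: "\<And>k. q k s = q0"
    and q: "\<And>k t. t \<in> {s..T} \<Longrightarrow> (q k has_vector_derivative
      (yosida (D t) (KL t) (\<nu> k) (q k t) + h t)) (at t within {s..T})"
    by metis
  obtain H where H: "\<And>t. t \<in> {s..T} \<Longrightarrow> norm (h t) \<le> H"
    using continuous_on_compact_bound[OF compact_Icc h] by blast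
  define \<mu>1 where "\<mu>1 = 2 * (\<kappa> + l) + 1"
  have \<mu>1: "\<mu>1 \<ge> 1" using \<nu>(7) by (simp add: \<mu>1_def)
  define a where "a = max (norm q0) H"
  have a0: "a \<ge> 0" by (simp add: a_def le_max_iff_disj)
  define B where "B = a * exp (\<mu>1 * (T - s))"
  have qB: "norm (q k t) \<le> B" if t: "t \<in> {s..T}" for k t
  proof -
    have "norm (q k t) \<le> a * exp (\<mu>1 * (t - s))"
    proof (rule exponential_bound_from_dissipativity[OF q _ _ t])
      show "norm (q k s) \<le> a" by (simp add: q0 a_def)
      fix r assume r: "r \<in> {s..T}" and big: "a * exp (\<mu>1 * (r - s)) < norm (q k r)"
      have "a * 1 \<le> a * exp (\<mu>1 * (r - s))" using a0 \<mu>1 r by (intro mult_left_mono) auto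
      then have "norm (h r) \<le> norm (q k r)" using H[OF r] big by (simp add: a_def)
      then have "norm (h r) * norm (q k r) \<le> (norm (q k r))\<^sup>2"
        by (simp add: power2_eq_square mult_right_mono)
      then have "inner (h r) (q k r) \<le> (norm (q k r))\<^sup>2"
        using norm_cauchy_schwarz[of "h r" "q k r"] by linarith
      then show "inner (yosida (D r) (KL r) (\<nu> k) (q k r) + h r) (q k r) \<le> \<mu>1 * (norm (q k r))\<^sup>2"
        using yosida_dissipative[OF KL[OF r] \<nu>(7,2,3), of k "q k r"]
        by (simp add: inner_add_left \<mu>1_def algebra_simps)
    qed
    also have "\<dots> \<le> B" unfolding B_def using t a0 \<mu>1 by (intro mult_left_mono) auto
    finally show ?thesis .
  qed
  have B0: "B \<ge> 0" using a0 by (simp add: B_def)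
  define x where "x k t = S (q k t)" for k t
  define x' where "x' k t = Y k t (x k t) + S (h t)" for k t
  have x: "(x k has_vector_derivative x' k t) (at t within {s..T})" if t: "t \<in> {s..T}" for k t
    using bounded_linear.has_vector_derivative[OF S(1) q[OF t, of k]]
    unfolding x_def[abs_def] x'_def by (simp add: S_add yosida_S[OF t \<nu>(1)])
  define C where "C = 2 * (M * B)"
  have C0: "C \<ge> 0" using M B0 by (simp add: C_def)
  have YC: "norm (Y k t (x k t)) \<le> C" if t: "t \<in> {s..T}" for k t
  proof -
    have "norm (Y k t (x k t)) \<le> 2 * norm (K t (x k t))"
      unfolding x_def by (rule norm_yosida_le[OF K[OF t] \<kappa> \<nu>(4,3) SD[OF t]])
    also have "norm (K t (x k t)) \<le> M * B"
      unfolding x_def using KS[OF t] mult_left_mono[OF qB[OF t] M] order_trans by blast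
    finally show ?thesis by (simp add: C_def)
  qed
  define \<mu> where "\<mu> = 2 * \<kappa> + 1"
  \<comment> \<open>\<open>A k\<close> is chosen so that its square dominates the error term \<open>8 * \<kappa> * f\<^sup>2 + 4 * C * f\<close>
    of the energy inequality, where \<open>f = C / \<nu> k\<close>.\<close>
  define A where "A k = sqrt ((8 * \<kappa> + 4) * C\<^sup>2 / \<nu> k)" for k
  define e where "e k = A k * exp (\<mu> * (T - s))" for k
  have diff: "norm (x m t - x k t) \<le> e k" if t: "t \<in> {s..T}" and km: "k \<le> m" for k m t
  proof -
    have A0: "A k \<ge> 0" using \<kappa> \<nu>(3)[of k] by (simp add: A_def)
    have Asq: "(A k)\<^sup>2 = (8 * \<kappa> + 4) * C\<^sup>2 / \<nu> k" using \<kappa> \<nu>(3)[of k] by (simp add: A_def)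
    have "norm (x m t - x k t) \<le> A k * exp (\<mu> * (t - s))"
    proof (rule exponential_bound_from_dissipativity[OF _ _ _ t])
      show "((\<lambda>t. x m t - x k t) has_vector_derivative (x' m r - x' k r)) (at r within {s..T})"
        if "r \<in> {s..T}" for r using x that by (intro has_vector_derivative_diff) auto
      show "norm (x m s - x k s) \<le> A k" using A0 by (simp add: x_def q0)
      fix r assume r: "r \<in> {s..T}" and big: "A k * exp (\<mu> * (r - s)) < norm (x m r - x k r)"
      define f where "f = C / \<nu> k"
      have f0: "f \<ge> 0" using C0 \<nu>(3)[of k] by (simp add: f_def)
      define p1 where "p1 = \<nu> m *\<^sub>R R (\<nu> m) r (x m r)"
      define p2 where "p2 = \<nu> k *\<^sub>R R (\<nu> k) r (x k r)"
      note lin = linear_operatorD[OF m_dissipative_imp_linear_operator[OF K[OF r]]]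
      have inD: "p1 \<in> D r" "p2 \<in> D r"
        unfolding p1_def p2_def using \<nu>(4,3) yosida_index_gt[OF K[OF r] \<kappa> \<nu>(4,3)]
        by (auto intro!: lin(5) resolvent_in_domain[OF K[OF r]])
      have Kp: "K r p1 = Y m r (x m r)" "K r p2 = Y k r (x k r)"
        unfolding p1_def p2_def by (simp_all add: yosida_eq[OF K[OF r] \<kappa> \<nu>(4,3)])
      have d2: "norm (p2 - x k r) \<le> f"
        unfolding p2_def scaled_resolvent_minus_self[OF K[OF r] \<kappa> \<nu>(4,3)] f_def
        using YC[OF r, of k] \<nu>(3)[of k] by (simp add: divide_right_mono)
      have "norm (p1 - x m r) \<le> C / \<nu> m"
        unfolding p1_def scaled_resolvent_minus_self[OF K[OF r] \<kappa> \<nu>(4,3)]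
        using YC[OF r, of m] \<nu>(3)[of m] by (simp add: divide_right_mono)
      also have "\<dots> \<le> f" unfolding f_def using C0 km \<nu>(3)[of k]
        by (intro divide_left_mono mult_pos_pos \<nu>) (auto simp: \<nu>_def)
      finally have d1: "norm (p1 - x m r) \<le> f" .
      define y where "y = x m r - x k r"
      define d where "d = (p1 - x m r) - (p2 - x k r)"
      have dn: "norm d \<le> 2 * f"
        using d1 d2 norm_triangle_ineq4[of "p1 - x m r" "p2 - x k r"] by (simp add: d_def)
      have yd: "p1 - p2 = y + d" by (simp add: y_def d_def)
      have "inner (K r (p1 - p2)) (p1 - p2) = inner (K r p1 - K r p2) (y + d)"
        by (subst lin(7)[OF inD]) (simp only: yd)
      then have i1: "inner (x' m r - x' k r) y = inner (K r (p1 - p2)) (p1 - p2) - inner (K r p1 - K r p2) d"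
        by (simp add: x'_def Kp inner_add_right)
      have "inner (K r (p1 - p2)) (p1 - p2) \<le> \<kappa> * (norm (p1 - p2))\<^sup>2"
        using K[OF r] lin(4)[OF inD] by (simp add: m_dissipative_def)
      also have "\<dots> \<le> \<kappa> * (2 * (norm y)\<^sup>2 + 8 * f\<^sup>2)"
      proof (rule mult_left_mono[OF _ \<kappa>])
        have "(norm (p1 - p2))\<^sup>2 \<le> (norm y + 2 * f)\<^sup>2"
          unfolding yd using norm_triangle_ineq[of y d] dn by (intro power_mono) auto
        also have "\<dots> \<le> 2 * (norm y)\<^sup>2 + 8 * f\<^sup>2"
          using zero_le_power2[of "norm y - 2 * f"] by (simp add: power2_eq_square algebra_simps)
        finally show "(norm (p1 - p2))\<^sup>2 \<le> 2 * (norm y)\<^sup>2 + 8 * f\<^sup>2" .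
      qed
      finally have i2: "inner (K r (p1 - p2)) (p1 - p2) \<le> \<kappa> * (2 * (norm y)\<^sup>2 + 8 * f\<^sup>2)" .
      have i3: "- inner (K r p1 - K r p2) d \<le> 2 * C * (2 * f)"
      proof -
        have "norm (K r p1 - K r p2) \<le> 2 * C"
          using YC[OF r, of m] YC[OF r, of k] norm_triangle_ineq4[of "K r p1" "K r p2"] by (simp add: Kp)
        then have "norm (K r p1 - K r p2) * norm d \<le> 2 * C * (2 * f)"
          using dn C0 by (intro mult_mono) auto
        then show ?thesis using Cauchy_Schwarz_ineq2[of "K r p1 - K r p2" d] by linarith
      qed
      have est: "inner (x' m r - x' k r) y \<le> 2 * \<kappa> * (norm y)\<^sup>2 + (8 * \<kappa> * f\<^sup>2 + 4 * C * f)"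
        using i1 i2 i3 by (simp add: algebra_simps)
      have "f\<^sup>2 \<le> C\<^sup>2 / \<nu> k"
        using \<nu>(5)[of k] \<nu>(3)[of k] by (simp add: f_def power_divide power2_eq_square divide_left_mono)
      then have "8 * \<kappa> * f\<^sup>2 \<le> 8 * \<kappa> * (C\<^sup>2 / \<nu> k)" using \<kappa> by (intro mult_left_mono) auto
      then have "8 * \<kappa> * f\<^sup>2 + 4 * C * f \<le> (A k)\<^sup>2"
        unfolding Asq by (simp add: f_def power2_eq_square add_divide_distrib distrib_right)
      also have "\<dots> \<le> (norm y)\<^sup>2"
      proof (rule power_mono[OF _ A0])
        have "A k * 1 \<le> A k * exp (\<mu> * (r - s))"
          using A0 r \<kappa> by (intro mult_left_mono) (auto simp: \<mu>_def)
        then show "A k \<le> norm y" using big by (simp add: y_def)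
      qed
      finally show "inner (x' m r - x' k r) (x m r - x k r) \<le> \<mu> * (norm (x m r - x k r))\<^sup>2"
        using est by (simp add: y_def \<mu>_def algebra_simps)
    qed
    also have "\<dots> \<le> e k" unfolding e_def using A0 t \<kappa> by (intro mult_left_mono) (auto simp: \<mu>_def)
    finally show ?thesis .
  qed
  have "(\<lambda>k. sqrt ((8 * \<kappa> + 4) * C\<^sup>2 / \<nu> k) * exp (\<mu> * (T - s))) \<longlonglongrightarrow> sqrt 0 * exp (\<mu> * (T - s))"
    by (intro tendsto_intros divide_\<nu>_tendsto_0)
  then have e: "e \<longlonglongrightarrow> 0" by (simp add: e_def[abs_def] A_def)
  have "\<exists>u. \<forall>k. \<forall>t\<in>{s..T}. norm (x k t - u t) \<le> e k"
    using diff e by (rule uniform_Cauchy_limit)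
  then obtain u where u: "\<forall>k. \<forall>t\<in>{s..T}. norm (x k t - u t) \<le> e k" ..
  have small: "\<exists>N. \<forall>k\<ge>N. e k \<le> \<epsilon>" if "\<epsilon> > 0" for \<epsilon>
    using order_tendstoD(2)[OF e that] by (auto simp: eventually_sequentially intro: less_imp_le)
  have "mild (S q0) (\<lambda>t. S (h t)) u"
    unfolding mild_def
  proof (intro conjI allI impI)
    show "continuous_on {s..T} u"
    proof (rule continuous_on_uniform_approximation)
      fix \<epsilon> :: real assume "\<epsilon> > 0"
      then obtain k where "e k \<le> \<epsilon>" using small by blast
      moreover have "continuous_on {s..T} (x k)" using x by (rule continuous_on_vector_derivative)
      ultimately show "\<exists>h. continuous_on {s..T} h \<and> (\<forall>t\<in>{s..T}. norm (h t - u t) \<le> \<epsilon>)"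
        using u by (meson order_trans)
    qed
    fix \<epsilon> :: real assume \<epsilon>: "\<epsilon> > 0"
    then obtain N where N: "\<forall>k\<ge>N. e k \<le> \<epsilon>" using small by blast
    show "\<exists>N. \<forall>k\<ge>N. \<exists>x x'. near_solution \<epsilon> k (S q0) (\<lambda>t. S (h t)) u x x'"
    proof (intro exI[of _ N] allI impI)
      fix k assume "k \<ge> N"
      then have "norm (x k t - u t) \<le> \<epsilon>" if "t \<in> {s..T}" for t using u N that by (meson order_trans)
      moreover have "norm (x k s - S q0) \<le> \<epsilon>" using \<epsilon> by (simp add: x_def q0)
      moreover have "norm (x' k t - Y k t (x k t) - S (h t)) \<le> \<epsilon>" for t using \<epsilon> by (simp add: x'_def)
      ultimately show "\<exists>x x'. near_solution \<epsilon> k (S q0) (\<lambda>t. S (h t)) u x x'"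
        using x unfolding near_solution_def by - (rule exI[of _ "x k"], rule exI[of _ "x' k"], simp)
    qed
  qed
  then show ?thesis by blast
qed

lemma mild_exists:
  assumes g: "continuous_on {s..T} g"
  shows "\<exists>u. mild u0 g u"
proof -
  have "\<exists>q h. norm (S q - u0) \<le> 1 / Suc i \<and> continuous_on {s..T} h \<and>
      (\<forall>t\<in>{s..T}. norm (S (h t) - g t) \<le> 1 / Suc i)" for i :: nat
  proof -
    have "u0 \<in> closure (range S)" using S by simp
    then obtain q where q: "dist (S q) u0 < 1 / Suc i"
      unfolding closure_approachable by (metis (no_types, lifting) imageE of_nat_0_less_iff zero_less_Suc zero_less_divide_1_iff)
    obtain I and \<phi> :: "'v \<Rightarrow> real \<Rightarrow> real" where I: "finite I" "\<And>q. q \<in> I \<Longrightarrow> continuous_on {s..T} (\<phi> q)"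
      "\<And>t. t \<in> {s..T} \<Longrightarrow> norm (S (\<Sum>q\<in>I. \<phi> q t *\<^sub>R q) - g t) \<le> 1 / Suc i"
      by (rule finite_rank_approximation[OF S_lin S(2) compact_Icc g, of "1 / Suc i"]) auto
    have "continuous_on {s..T} (\<lambda>t. \<Sum>q\<in>I. \<phi> q t *\<^sub>R q)" by (intro continuous_intros I)
    moreover have "norm (S q - u0) \<le> 1 / Suc i" using q by (simp add: dist_norm)
    ultimately show ?thesis using I(3)
      by - (rule exI[of _ q], rule exI[of _ "\<lambda>t. \<Sum>q\<in>I. \<phi> q t *\<^sub>R q"], simp)
  qed
  then obtain q h where q: "\<And>i. norm (S (q i) - u0) \<le> 1 / Suc i"
    and hc: "\<And>i. continuous_on {s..T} (h i)"
    and h: "\<And>i t. t \<in> {s..T} \<Longrightarrow> norm (S (h i t) - g t) \<le> 1 / Suc i"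
    by metis
  have "\<exists>u. \<forall>i. mild (S (q i)) (\<lambda>t. S (h i t)) (u i)"
    using mild_exists_regular[OF hc] by (intro choice) blast
  then obtain u where u: "\<And>i. mild (S (q i)) (\<lambda>t. S (h i t)) (u i)" by blast
  define \<mu> where "\<mu> = 2 * \<kappa> + 1"
  define E where "E = exp (\<mu> * (T - s))"
  have \<mu>: "\<mu> \<ge> 0" using \<kappa> by (simp add: \<mu>_def)
  have "norm (u j t - u i t) \<le> (2 / Suc i) * E" if t: "t \<in> {s..T}" and ij: "i \<le> j" for i j t
  proof -
    have le: "1 / Suc j \<le> 1 / Suc i" using ij by (simp add: frac_le)
    have "norm (u j t - u i t) \<le> 2 / Suc i * exp (\<mu> * (t - s))"
    proof (rule mild_stability[OF u u _ _ _ t])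
      show "norm (S (q j) - S (q i)) \<le> 2 / Suc i"
        using q[of i] q[of j] le norm_triangle_ineq4[of "S (q j) - u0" "S (q i) - u0"] by simp
      fix r assume r: "r \<in> {s..T}"
      have "norm (S (h j r) - S (h i r)) \<le> 2 / Suc i"
        using h[OF r, of i] h[OF r, of j] le norm_triangle_ineq4[of "S (h j r) - g r" "S (h i r) - g r"]
        by simp
      also have "\<dots> \<le> 2 / Suc i * exp (\<mu> * (r - s))"
        using mult_left_mono[of 1 "exp (\<mu> * (r - s))" "2 / Suc i"] r \<mu> by simp
      finally show "norm (S (h j r) - S (h i r)) \<le> (\<mu> - 2 * \<kappa>) * (2 / Suc i) * exp (\<mu> * (r - s))"
        by (simp add: \<mu>_def)
    qed (simp add: \<mu>_def)
    also have "\<dots> \<le> 2 / Suc i * E" unfolding E_def using t \<mu>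
      by (intro mult_left_mono) (auto intro!: mult_left_mono)
    finally show ?thesis .
  qed
  moreover have lim: "(\<lambda>i. (2 / Suc i) * E) \<longlonglongrightarrow> 0"
    using tendsto_mult_right_zero[OF LIMSEQ_inverse_real_of_nat, of "2 * E"]
    by (simp add: divide_inverse mult_ac)
  ultimately have "\<exists>v. \<forall>i. \<forall>t\<in>{s..T}. norm (u i t - v t) \<le> (2 / Suc i) * E"
    by (rule uniform_Cauchy_limit)
  then obtain v where v: "\<forall>i. \<forall>t\<in>{s..T}. norm (u i t - v t) \<le> (2 / Suc i) * E" ..
  have "mild u0 g v"
  proof (rule mild_closed)
    fix \<epsilon> :: real assume \<epsilon>: "\<epsilon> > 0"
    obtain i where i: "(2 / Suc i) * E < \<epsilon>"
      using order_tendstoD(2)[OF lim \<epsilon>] by (auto simp: eventually_sequentially)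
    have "E \<ge> 1" using \<mu> sT by (simp add: E_def)
    then have "(2 / Suc i) * 1 \<le> (2 / Suc i) * E" by (intro mult_left_mono) auto
    moreover have "1 / Suc i \<le> 2 / Suc i" by (simp add: divide_right_mono)
    ultimately have i': "1 / Suc i \<le> \<epsilon>" using i by linarith
    show "\<exists>v0 h va. mild v0 h va \<and> norm (v0 - u0) \<le> \<epsilon> \<and>
        (\<forall>t\<in>{s..T}. norm (h t - g t) \<le> \<epsilon> \<and> norm (va t - v t) \<le> \<epsilon>)"
    proof (rule exI[of _ "S (q i)"], rule exI[of _ "\<lambda>t. S (h i t)"], rule exI[of _ "u i"], intro conjI ballI)
      show "mild (S (q i)) (\<lambda>t. S (h i t)) (u i)" by (rule u)
      show "norm (S (q i) - u0) \<le> \<epsilon>" using q[of i] i' by simp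
      show "norm (S (h i t) - g t) \<le> \<epsilon>" if "t \<in> {s..T}" for t using h[OF that, of i] i' by simp
      show "norm (u i t - v t) \<le> \<epsilon>" if "t \<in> {s..T}" for t using v[rule_format, OF that, of i] i by linarith
    qed
  qed
  then show ?thesis by blast
qed

text \<open>
  The mild solution depends on its right-hand side through a Volterra operator, and \<open>L t\<close> is bounded
  by \<open>l\<close>; the weight \<open>2 * \<kappa> + 2 * l + 1\<close> makes the composition contract by one half.
\<close>

lemma mild_fixed_point: "\<exists>w. mild w0 (\<lambda>t. L t (w t)) w"
proof -
  define \<Phi> where "\<Phi> g = (SOME u. mild w0 (\<lambda>t. L t (g t)) u)" for g
  have Lc: "continuous_on {s..T} (\<lambda>t. L t (g t))" if "continuous_on {s..T} g" for g
  proof (rule continuous_on_Lipschitz_family[OF L_cont _ that])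
    show "norm (L t x - L t y) \<le> l * norm (x - y)" if "t \<in> {s..T}" for t x y
      using L_le[OF that, of "x - y"] by (simp add: linear_diff[OF L[OF that]])
  qed
  have \<Phi>: "mild w0 (\<lambda>t. L t (g t)) (\<Phi> g)" if "continuous_on {s..T} g" for g
    unfolding \<Phi>_def using mild_exists[OF Lc[OF that]] by (rule someI_ex)
  define \<mu> where "\<mu> = 2 * \<kappa> + 2 * l + 1"
  obtain w where w: "continuous_on {s..T} w" "\<And>t. t \<in> {s..T} \<Longrightarrow> \<Phi> w t = w t"
  proof (rule Volterra_fixed_point[of \<mu> s T \<Phi>])
    show "0 \<le> \<mu>" using \<kappa> l by (simp add: \<mu>_def)
    show "continuous_on {s..T} (\<Phi> g)" if "continuous_on {s..T} g" for g
      using \<Phi>[OF that] by (simp add: mild_def)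
    show "norm (\<Phi> g t - \<Phi> g' t) \<le> c / 2 * exp (\<mu> * (t - s))"
      if g: "continuous_on {s..T} g" "continuous_on {s..T} g'" and c: "0 \<le> c"
        and le: "\<forall>r\<in>{s..T}. norm (g r - g' r) \<le> c * exp (\<mu> * (r - s))"
        and t: "t \<in> {s..T}" for g g' c t
    proof (rule mild_stability[OF \<Phi>[OF g(1)] \<Phi>[OF g(2)] _ _ _ t])
      show "2 * \<kappa> < \<mu>" using l by (simp add: \<mu>_def)
      show "norm (w0 - w0) \<le> c / 2" using c by simp
      fix r assume r: "r \<in> {s..T}"
      have "norm (L r (g r) - L r (g' r)) \<le> l * norm (g r - g' r)"
        using L_le[OF r, of "g r - g' r"] by (simp add: linear_diff[OF L[OF r]])
      also have "\<dots> \<le> l * (c * exp (\<mu> * (r - s)))" using le r l by (intro mult_left_mono) auto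
      also have "\<dots> \<le> (l + 1 / 2) * (c * exp (\<mu> * (r - s)))" using c by (intro mult_right_mono) auto
      also have "\<dots> = (\<mu> - 2 * \<kappa>) * (c / 2) * exp (\<mu> * (r - s))" by (simp add: \<mu>_def field_simps)
      finally show "norm (L r (g r) - L r (g' r)) \<le> (\<mu> - 2 * \<kappa>) * (c / 2) * exp (\<mu> * (r - s))" .
    qed
  qed blast
  have "mild w0 (\<lambda>t. L t (w t)) w"
  proof (rule mild_closed)
    fix \<epsilon> :: real assume "\<epsilon> > 0"
    then show "\<exists>v0 h v. mild v0 h v \<and> norm (v0 - w0) \<le> \<epsilon> \<and>
        (\<forall>t\<in>{s..T}. norm (h t - L t (w t)) \<le> \<epsilon> \<and> norm (v t - w t) \<le> \<epsilon>)"
      using \<Phi>[OF w(1)] w(2)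
      by - (rule exI[of _ w0], rule exI[of _ "\<lambda>t. L t (w t)"], rule exI[of _ "\<Phi> w"], simp)
  qed
  then show ?thesis by blast
qed

lemma scaled_resolvent_tendsto_id:
  assumes g: "continuous_on {s..T} g" and \<epsilon>: "\<epsilon> > 0"
  shows "\<exists>N. \<forall>k\<ge>N. \<forall>t\<in>{s..T}. norm (\<nu> k *\<^sub>R R (\<nu> k) t (g t) - g t) \<le> \<epsilon>"
proof -
  obtain I and \<phi> :: "'v \<Rightarrow> real \<Rightarrow> real" where I: "finite I" "\<And>q. q \<in> I \<Longrightarrow> continuous_on {s..T} (\<phi> q)"
    "\<And>t. t \<in> {s..T} \<Longrightarrow> norm (S (\<Sum>q\<in>I. \<phi> q t *\<^sub>R q) - g t) \<le> \<epsilon> / 6"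
    by (rule finite_rank_approximation[OF S_lin S(2) compact_Icc g, of "\<epsilon> / 6"]) (use \<epsilon> in auto)
  define h where "h t = (\<Sum>q\<in>I. \<phi> q t *\<^sub>R q)" for t
  have hc: "continuous_on {s..T} h" unfolding h_def by (intro continuous_intros I)
  obtain H where H: "\<And>t. t \<in> {s..T} \<Longrightarrow> norm (h t) \<le> H"
    using continuous_on_compact_bound[OF compact_Icc hc] by blast
  obtain N where N: "\<And>k. k \<ge> N \<Longrightarrow> 2 * (M * H) / \<nu> k < \<epsilon> / 2"
    using order_tendstoD(2)[OF divide_\<nu>_tendsto_0[of "2 * (M * H)"], of "\<epsilon> / 2"] \<epsilon> by (auto simp: eventually_sequentially)
  have "norm (\<nu> k *\<^sub>R R (\<nu> k) t (g t) - g t) \<le> \<epsilon>" if k: "k \<ge> N" and t: "t \<in> {s..T}" for k t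
  proof -
    define J where "J x = \<nu> k *\<^sub>R R (\<nu> k) t x" for x
    have J2: "norm (J x) \<le> 2 * norm x" for x
      unfolding J_def by (rule norm_scaled_resolvent_le[OF K[OF t] \<kappa> \<nu>(4,3)])
    have Jd: "J (x - y) = J x - J y" for x y
      unfolding J_def using yosida_index_gt[OF K[OF t] \<kappa> \<nu>(4,3)]
      by (simp add: linear_diff[OF linear_resolvent[OF K[OF t]]] scaleR_diff_right)
    have near: "norm (S (h t) - g t) \<le> \<epsilon> / 6" using I(3)[OF t] by (simp add: h_def)
    have "norm (J (S (h t)) - S (h t)) \<le> 2 * (M * H) / \<nu> k"
    proof -
      have "norm (Y k t (S (h t))) \<le> 2 * norm (K t (S (h t)))"
        by (rule norm_yosida_le[OF K[OF t] \<kappa> \<nu>(4,3) SD[OF t]])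
      also have "norm (K t (S (h t))) \<le> M * H"
        using KS[OF t] mult_left_mono[OF H[OF t] M] order_trans by blast
      finally show ?thesis
        unfolding J_def scaled_resolvent_minus_self[OF K[OF t] \<kappa> \<nu>(4,3)]
        using \<nu>(3)[of k] by (simp add: divide_right_mono)
    qed
    then have mid: "norm (J (S (h t)) - S (h t)) \<le> \<epsilon> / 2" using N[OF k] by simp
    have "norm (J (S (h t) - g t)) \<le> \<epsilon> / 3" using J2[of "S (h t) - g t"] near by simp
    moreover have eq: "J (g t) - g t = (J (S (h t)) - S (h t)) + (S (h t) - g t) - J (S (h t) - g t)"
      by (simp add: Jd)
    ultimately show ?thesis
      using norm_triangle3[of "J (S (h t)) - S (h t)" "S (h t) - g t" "J (S (h t) - g t)", folded eq]
        mid near unfolding J_def by linarith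
  qed
  then show ?thesis by blast
qed

text \<open>
  For the regularized solutions \<open>x\<close> near the mild solution \<open>w\<close> of \<open>w' = K w + L w\<close>, the commutator
  identity turns \<open>S (x')\<close> into \<open>K (S (J x))\<close> plus \<open>S (L (w - J x))\<close> and a small error. All operators in
  this expression are bounded uniformly in time and \<open>J x\<close> is close to \<open>w\<close>, so \<open>S (x')\<close> converges
  uniformly to \<open>K (S w)\<close>, although \<open>x'\<close> itself need not converge.
\<close>

theorem evolution_exists:
  "\<exists>w. continuous_on {s..T} w \<and> w s = w0 \<and>
     (\<forall>t\<in>{s..T}. ((\<lambda>t. S (w t)) has_vector_derivative K t (S (w t))) (at t within {s..T}))"
proof -
  obtain w where w: "mild w0 (\<lambda>t. L t (w t)) w" using mild_fixed_point by blast
  have wc: "continuous_on {s..T} w" using w by (simp add: mild_def)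
  obtain B where B: "\<And>x. norm (S x) \<le> B * norm x" "B > 0"
    using bounded_linear.pos_bounded[OF S(1)] by (auto simp: mult.commute)
  have ws: "w s = w0"
  proof -
    have "norm (w s - w0) \<le> 0 + \<eta>" if "\<eta> > 0" for \<eta>
    proof -
      have "\<eta> / 2 > 0" using that by simp
      then obtain k x where x: "norm (x s - w0) \<le> \<eta> / 2" "\<And>t. t \<in> {s..T} \<Longrightarrow> norm (x t - w t) \<le> \<eta> / 2"
        using w unfolding mild_def near_solution_def by blast
      have "s \<in> {s..T}" using sT by simp
      then show ?thesis
        using x(1) x(2)[of s] norm_triangle_ineq4[of "x s - w0" "x s - w s"] by simp
    qed
    then show ?thesis using field_le_epsilon[of "norm (w s - w0)" 0] by simp
  qed
  have KSc: "continuous_on {s..T} (\<lambda>t. K t (S (w t)))"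
  proof (rule continuous_on_Lipschitz_family[where F = "\<lambda>t x. K t (S x)", OF KS_cont _ wc])
    show "norm (K t (S x) - K t (S y)) \<le> M * norm (x - y)" if "t \<in> {s..T}" for t x y
      using KS[OF that, of "x - y"]
        linear_operatorD(7)[OF m_dissipative_imp_linear_operator[OF K[OF that]] SD[OF that] SD[OF that]]
      by (simp add: S_diff)
  qed
  have "((\<lambda>t. S (w t)) has_vector_derivative K t (S (w t))) (at t within {s..T})" if t: "t \<in> {s..T}" for t
  proof (rule vector_derivative_of_uniform_limit[OF KSc _ t])
    fix \<epsilon> :: real assume \<epsilon>: "\<epsilon> > 0"
    define c where "c = 3 * (M + B * l) + B"
    have c: "c > 0" using M l B by (simp add: c_def add_nonneg_pos)
    define \<delta> where "\<delta> = \<epsilon> / c"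
    have \<delta>: "\<delta> > 0" using \<epsilon> c by (simp add: \<delta>_def)
    obtain N1 where N1: "\<forall>k\<ge>N1. \<forall>t\<in>{s..T}. norm (\<nu> k *\<^sub>R R (\<nu> k) t (w t) - w t) \<le> \<delta>"
      using scaled_resolvent_tendsto_id[OF wc \<delta>] by blast
    obtain N2 where N2: "\<forall>k\<ge>N2. \<exists>x x'. near_solution \<delta> k w0 (\<lambda>t. L t (w t)) w x x'"
      using w \<delta> unfolding mild_def by blast
    obtain k where k: "N1 \<le> k" "N2 \<le> k" using max.cobounded1 max.cobounded2 by blast
    obtain x x' where x: "\<And>t. t \<in> {s..T} \<Longrightarrow> (x has_vector_derivative x' t) (at t within {s..T})"
      "\<And>t. t \<in> {s..T} \<Longrightarrow> norm (x t - w t) \<le> \<delta>"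
      "\<And>t. t \<in> {s..T} \<Longrightarrow> norm (x' t - Y k t (x t) - L t (w t)) \<le> \<delta>"
      using N2 k unfolding near_solution_def by blast
    have 1: "((\<lambda>t. S (x t)) has_vector_derivative S (x' r)) (at r within {s..T})" if "r \<in> {s..T}" for r
      using bounded_linear.has_vector_derivative[OF S(1) x(1)[OF that]] .
    have 2: "norm (S (x r) - S (w r)) \<le> \<epsilon>" if r: "r \<in> {s..T}" for r
    proof -
      have "norm (S (x r) - S (w r)) \<le> B * \<delta>"
        using B(1)[of "x r - w r"] mult_left_mono[OF x(2)[OF r] less_imp_le[OF B(2)]] by (simp add: S_diff)
      also have "\<dots> \<le> c * \<delta>" using M l B \<delta> by (intro mult_right_mono) (auto simp: c_def)
      finally show ?thesis using c by (simp add: \<delta>_def)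
    qed
    have 3: "norm (S (x' r) - K r (S (w r))) \<le> \<epsilon>" if r: "r \<in> {s..T}" for r
    proof -
      define J where "J x = \<nu> k *\<^sub>R R (\<nu> k) r x" for x
      note lin = linear_operatorD[OF m_dissipative_imp_linear_operator[OF K[OF r]]]
      have n: "\<nu> k > \<kappa>" by (rule yosida_index_gt[OF K[OF r] \<kappa> \<nu>(4,3)])
      have JD: "J x \<in> D r" for x
        unfolding J_def by (intro lin(5) resolvent_in_domain[OF K[OF r] n])
      have Jd: "J (x - y) = J x - J y" for x y
        unfolding J_def by (simp add: linear_diff[OF linear_resolvent[OF K[OF r] n]] scaleR_diff_right)
      have J2: "norm (J x) \<le> 2 * norm x" for x
        unfolding J_def by (rule norm_scaled_resolvent_le[OF K[OF r] \<kappa> \<nu>(4,3)])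
      define z where "z = J (x r) - w r"
      define \<gamma> where "\<gamma> = x' r - Y k r (x r) - L r (w r)"
      have "norm (J (x r - w r)) \<le> 2 * \<delta>" using J2[of "x r - w r"] x(2)[OF r] by simp
      moreover have "norm (J (w r) - w r) \<le> \<delta>" using N1 k r by (simp add: J_def)
      moreover have "z = J (x r - w r) + (J (w r) - w r)" by (simp add: z_def Jd)
      ultimately have z: "norm z \<le> 3 * \<delta>"
        using norm_triangle_ineq[of "J (x r - w r)" "J (w r) - w r"] by simp
      have "x' r = K r (J (x r)) + L r (w r) + \<gamma>"
        by (simp add: \<gamma>_def yosida_eq[OF K[OF r] \<kappa> \<nu>(4,3)] J_def)
      then have "S (x' r) = S (K r (J (x r)) + L r (J (x r))) - S (L r z) + S \<gamma>"
        by (simp add: S_add S_diff z_def linear_diff[OF L[OF r]])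
      also have "S (K r (J (x r)) + L r (J (x r))) = K r (S (J (x r)))"
        using commutator[OF r JD] by simp
      also have "\<dots> = K r (S z) + K r (S (w r))"
        using lin(6)[OF SD[OF r] SD[OF r], of z "w r"] by (simp add: z_def S_add[symmetric])
      finally have eq: "S (x' r) - K r (S (w r)) = K r (S z) + S \<gamma> - S (L r z)" by simp
      have "norm (K r (S z)) \<le> M * (3 * \<delta>)"
        using KS[OF r, of z] mult_left_mono[OF z M] by linarith
      moreover have "norm (S \<gamma>) \<le> B * \<delta>"
        using B(1)[of \<gamma>] mult_left_mono[OF x(3)[OF r] less_imp_le[OF B(2)]] unfolding \<gamma>_def by linarith
      moreover have "norm (S (L r z)) \<le> B * (l * (3 * \<delta>))"
      proof -
        have "norm (L r z) \<le> l * (3 * \<delta>)" using L_le[OF r, of z] mult_left_mono[OF z l] by linarith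
        then show ?thesis using B(1)[of "L r z"] mult_left_mono[of _ _ B] B(2) by (meson less_imp_le order_trans)
      qed
      ultimately have "norm (S (x' r) - K r (S (w r))) \<le> M * (3 * \<delta>) + B * \<delta> + B * (l * (3 * \<delta>))"
        unfolding eq using norm_triangle3[of "K r (S z)" "S \<gamma>" "S (L r z)"] by linarith
      also have "\<dots> = c * \<delta>" by (simp add: c_def algebra_simps)
      finally show ?thesis using c by (simp add: \<delta>_def)
    qed
    show "\<exists>x x'. \<forall>t\<in>{s..T}. (x has_vector_derivative x' t) (at t within {s..T}) \<and>
        norm (x t - S (w t)) \<le> \<epsilon> \<and> norm (x' t - K t (S (w t))) \<le> \<epsilon>"
      by (rule exI[of _ "\<lambda>t. S (x t)"], rule exI[of _ "\<lambda>t. S (x' t)"]) (use 1 2 3 in simp)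
  qed
  with wc ws show ?thesis by blast
qed

end

section \<open>Sums over partitions\<close>

lemma finite_consec: "finite P \<Longrightarrow> finite (consec P)"
  by (rule finite_subset[of _ "P \<times> P"]) (auto simp: consec_def)

lemma consec_insert_greatest:
  assumes P: "finite P" "P \<noteq> {}" and m: "\<And>x. x \<in> P \<Longrightarrow> x < m"
  shows "consec (insert m P) = insert (Max P, m) (consec P)"
proof (intro set_eqI iffI)
  fix e assume "e \<in> consec (insert m P)"
  then obtain u v where e: "e = (u, v)" and uv: "u \<in> insert m P" "v \<in> insert m P" "u < v"
    "insert m P \<inter> {u<..<v} = {}" unfolding consec_def by auto
  have uP: "u \<in> P" using uv m by (auto dest: less_trans)
  show "e \<in> insert (Max P, m) (consec P)"
  proof (cases "v = m")
    case True
    have "Max P \<le> u"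
    proof (rule Max.boundedI[OF P])
      fix x assume x: "x \<in> P"
      then have "x \<notin> {u<..<v}" using uv(4) by blast
      then show "x \<le> u" using m[OF x] True by auto
    qed
    moreover have "u \<le> Max P" using P uP by simp
    ultimately show ?thesis using e True by simp
  next
    case False
    then show ?thesis using e uv uP by (auto simp: consec_def)
  qed
next
  fix e assume "e \<in> insert (Max P, m) (consec P)"
  then show "e \<in> consec (insert m P)"
  proof
    assume "e = (Max P, m)"
    moreover have "\<not> Max P < x" if "x \<in> P" for x
      using Max_ge[OF P(1) that] by (rule leD)
    moreover have "Max P < m" using m Max_in[OF P] by blast
    ultimately show ?thesis using Max_in[OF P] by (auto simp: consec_def)
  next
    assume "e \<in> consec P"
    then show ?thesis using m by (force simp: consec_def)
  qed
qed

text \<open>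
  Adding a new greatest point \<open>m\<close> to \<open>P\<close> adds exactly the pair \<open>(Max P, m)\<close>.
\<close>

lemma sum_consec_telescope:
  fixes Z :: "real \<Rightarrow> 'a::ab_group_add"
  assumes "finite P" "P \<noteq> {}"
  shows "(\<Sum>(u, v)\<in>consec P. Z v - Z u) = Z (Max P) - Z (Min P)"
  using assms
proof (induction rule: finite_linorder_max_induct)
  case (insert m P)
  show ?case
  proof (cases "P = {}")
    case True
    then have "consec (insert m P) = {}" by (auto simp: consec_def)
    then show ?thesis using True by simp
  next
    case False
    have m: "x < m" if "x \<in> P" for x using insert.hyps that by blast
    have notin: "(Max P, m) \<notin> consec P" using m by (auto simp: consec_def)
    have "Max P < m" "Min P < m" using m Max_in Min_in insert.hyps(1) False by auto
    then have "Max (insert m P) = m" "Min (insert m P) = Min P"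
      unfolding Max_insert[OF insert.hyps(1) False] Min_insert[OF insert.hyps(1) False]
      by (simp_all only: max.absorb1[OF less_imp_le] min.absorb2[OF less_imp_le])
    then show ?thesis
      using insert False notin
      by (simp add: consec_insert_greatest[OF insert.hyps(1) False m] finite_consec)
  qed
qed simp

lemma consec_unique:
  assumes "(u, v) \<in> consec P" "(u', v') \<in> consec P" "u < c" "c < v" "u' < c" "c < v'"
  shows "u = u' \<and> v = v'"
proof -
  have a: "\<And>x. x \<in> P \<Longrightarrow> \<not> (u < x \<and> x < v)" "\<And>x. x \<in> P \<Longrightarrow> \<not> (u' < x \<and> x < v')"
    and i: "u \<in> P" "v \<in> P" "u' \<in> P" "v' \<in> P"
    using assms(1,2) by (auto simp: consec_def)
  show ?thesis
    using a(1)[OF i(3)] a(1)[OF i(4)] a(2)[OF i(1)] a(2)[OF i(2)] assms(3-6) by linarith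
qed

lemma card_consec_across:
  assumes P: "finite P"
  shows "card {(u, v) \<in> consec P. u < c \<and> c < v} \<le> 1"
proof -
  have "finite {(u, v) \<in> consec P. u < c \<and> c < v}"
    by (rule finite_subset[OF _ finite_consec[OF P]]) auto
  moreover have "\<And>x y. x \<in> {(u, v) \<in> consec P. u < c \<and> c < v} \<Longrightarrow>
      y \<in> {(u, v) \<in> consec P. u < c \<and> c < v} \<Longrightarrow> x = y"
    using consec_unique by fast
  ultimately show ?thesis by (subst One_nat_def, subst card_le_Suc0_iff_eq) blast+
qed

text \<open>
  Restricting the partition to \<open>{s..T}\<close> leaves the intervals to the right of \<open>s\<close> unchanged and cuts the one
  that contains \<open>s\<close> in its interior. All sums over restricted partitions can thus be taken over
  intervals of the original partition.
\<close>

lemma bij_betw_consec_partitions_from: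
  assumes P: "partition_of 0 T P" and s: "s \<in> {0..<T}"
  shows "bij_betw (\<lambda>(u, v). (max u s, v)) {(u, v) \<in> consec P. s < v} (consec ({s} \<union> (P \<inter> {s..T})))"
proof (rule bij_betw_imageI)
  have fin: "finite P" and sub: "P \<subseteq> {0..T}" and P0: "0 \<in> P" using P by (auto simp: partition_of_def)
  show "inj_on (\<lambda>(u, v). (max u s, v)) {(u, v) \<in> consec P. s < v}"
  proof (rule inj_onI)
    fix e e' assume "e \<in> {(u, v) \<in> consec P. s < v}" "e' \<in> {(u, v) \<in> consec P. s < v}"
      "(\<lambda>(u, v). (max u s, v)) e = (\<lambda>(u, v). (max u s, v)) e'"
    then obtain u v u' where e: "e = (u, v)" "e' = (u', v)"
      and a: "(u, v) \<in> consec P" "(u', v) \<in> consec P" by auto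
    have "u < v" "u' < v" using a by (auto simp: consec_def)
    then obtain c where "max u u' < c" "c < v" using dense[of "max u u'" v] by auto
    then show "e = e'" using consec_unique[OF a, of c] e by simp
  qed
  show "(\<lambda>(u, v). (max u s, v)) ` {(u, v) \<in> consec P. s < v} = consec ({s} \<union> (P \<inter> {s..T}))" (is "?L = ?R")
  proof (intro equalityI subsetI)
    fix e assume "e \<in> ?L"
    then obtain u v where e: "e = (max u s, v)" and uv: "(u, v) \<in> consec P" "s < v" by auto
    then have "u \<in> P" "v \<in> P" "u < v" "P \<inter> {u<..<v} = {}" by (auto simp: consec_def)
    then show "e \<in> ?R" using uv(2) sub unfolding e consec_def
      by (auto simp: max_def)
  next
    fix e assume "e \<in> ?R"
    then obtain u v where e: "e = (u, v)" and u: "u = s \<or> u \<in> P \<and> s \<le> u" and v: "v = s \<or> v \<in> P" and uv: "u < v"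
      and em: "({s} \<union> (P \<inter> {s..T})) \<inter> {u<..<v} = {}"
      unfolding consec_def by auto
    have no: "\<not> (u < x \<and> x < v)" if "x \<in> P" "s \<le> x" "x \<le> T" for x using em that by auto
    have vP: "v \<in> P" and sv: "s < v" using u v uv by auto
    have vT: "v \<le> T" using vP sub by auto
    show "e \<in> ?L"
    proof (cases "u \<in> P")
      case True
      have su: "s \<le> u" using u by auto
      have "(u, v) \<in> consec P"
        unfolding consec_def using True vP uv no su vT by force
      then show ?thesis using e su sv by (intro image_eqI[of _ _ "(u, v)"]) auto
    next
      case False
      then have us: "u = s" using u by auto
      define Q where "Q = P \<inter> {..<s}"
      have "0 < s" using False us P0 s by (cases "s = 0") auto
      then have Q: "finite Q" "Q \<noteq> {}" using fin P0 by (auto simp: Q_def)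
      then have mQ: "Max Q \<in> Q" by (rule Max_in)
      have "(Max Q, v) \<in> consec P"
        unfolding consec_def
      proof (clarify, intro conjI)
        show "Max Q \<in> P" "v \<in> P" "Max Q < v" using mQ vP sv by (auto simp: Q_def)
        show "P \<inter> {Max Q<..<v} = {}"
        proof (rule ccontr)
          assume "P \<inter> {Max Q<..<v} \<noteq> {}"
          then obtain x where x: "x \<in> P" "Max Q < x" "x < v" by auto
          have "\<not> x < s" using x Q Max_ge[OF Q(1), of x] by (auto simp: Q_def)
          then show False using no[OF x(1)] x us vT False by (cases "x = s") auto
        qed
      qed
      then show ?thesis using e us sv mQ by (intro image_eqI[of _ _ "(Max Q, v)"]) (auto simp: Q_def)
    qed
  qed
qed

lemma osc_bound:
  assumes S: "continuous_on {a..b} S" and P: "finite P" "P \<subseteq> {a..b}"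
    and uv: "(u, v) \<in> consec P" and x: "x \<in> {u..v}" and y: "y \<in> {u..v}"
  shows "\<bar>S x - S y\<bar> \<le> osc S P"
proof -
  have "{u..v} \<subseteq> {a..b}" using uv P by (auto simp: consec_def)
  then have "compact (S ` {u..v})"
    using S by (intro compact_continuous_image) (auto intro: continuous_on_subset)
  then have "dist (S x) (S y) \<le> diameter (S ` {u..v})"
    using x y by (intro diameter_bounded_bound compact_imp_bounded) auto
  also have "\<dots> \<le> osc S P"
    unfolding osc_def using uv P finite_consec by (intro Max_ge) (auto intro!: image_eqI[of _ _ "(u, v)"])
  finally show ?thesis by (simp add: dist_real_def)
qed

lemma integral_variation_measure:
  assumes P: "finite P" "P \<subseteq> {a..b}" and g: "continuous_on {a..b} (g :: real \<Rightarrow> real)"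
  shows "integral\<^sup>L (variation_measure p a b S P) g = (\<Sum>(u, v)\<in>consec P. \<bar>S v - S u\<bar> ^ p * g u)"
proof -
  have eq: "(\<lambda>(u, v). ennreal (\<bar>S v - S u\<bar> ^ p)) = (\<lambda>e. ennreal (case e of (u, v) \<Rightarrow> \<bar>S v - S u\<bar> ^ p))"
    by auto
  have "integral\<^sup>L (variation_measure p a b S P) g =
      integral\<^sup>L (point_measure (consec P) (\<lambda>(u, v). ennreal (\<bar>S v - S u\<bar> ^ p))) (\<lambda>e. g (fst e))"
    unfolding variation_measure_def
  proof (rule integral_distr)
    show "fst \<in> point_measure (consec P) (\<lambda>(u, v). ennreal (\<bar>S v - S u\<bar> ^ p)) \<rightarrow>\<^sub>M restrict_space borel {a..b}"
      using P by (auto simp: measurable_point_measure_eq1 space_restrict_space consec_def)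
    show "g \<in> borel_measurable (restrict_space borel {a..b})"
      using g by (rule borel_measurable_continuous_on_restrict)
  qed
  also have "\<dots> = (\<Sum>e\<in>consec P. (case e of (u, v) \<Rightarrow> \<bar>S v - S u\<bar> ^ p) *\<^sub>R g (fst e))"
    unfolding eq by (rule lebesgue_integral_point_measure_finite) (auto simp: finite_consec P)
  also have "\<dots> = (\<Sum>(u, v)\<in>consec P. \<bar>S v - S u\<bar> ^ p * g u)"
    by (intro sum.cong) auto
  finally show ?thesis .
qed

lemma non_atomic_singleton:
  assumes "non_atomic M" "finite_measure M" "{x} \<in> sets M"
  shows "measure M {x} = 0"
proof (rule ccontr)
  assume "measure M {x} \<noteq> 0"
  then have pos: "emeasure M {x} > 0"
    using finite_measure.emeasure_eq_measure[OF assms(2)] by (simp add: zero_less_measure_iff)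
  have "emeasure M F = 0" if "F \<in> sets M" "F \<subseteq> {x} \<and> emeasure M F < emeasure M {x}" for F
    using that by (cases "F = {}") (auto simp: subset_singleton_iff)
  then show False using assms(1,3) pos unfolding non_atomic_def by blast
qed

text \<open>
  The distribution function of the limit measure is continuous, so weak convergence gives
  convergence of distribution functions at every point: the indicator of \<open>{..<t}\<close> is squeezed
  between two continuous ramps of width \<open>d / 2\<close>, whose integrals differ little. The absence of atoms is
  used for the point \<open>0\<close>.
\<close>

lemma cumulative_variation_tendsto:
  assumes T: "T > 0" and P: "\<And>n. partition_of 0 T (\<pi> n)"
    and \<omega>: "finite_pth_variation p 0 T \<pi> \<omega>"
    and cont: "continuous_on {0..T} (pth_variation p 0 T \<pi> \<omega>)" and t: "t \<in> {0..T}"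
  shows "(\<lambda>n. \<Sum>(u, v)\<in>{(u, v) \<in> consec (\<pi> n). u < t}. \<bar>\<omega> v - \<omega> u\<bar> ^ p)
    \<longlonglongrightarrow> pth_variation p 0 T \<pi> \<omega> t"
proof -
  define \<mu> where "\<mu> = (SOME \<mu>. is_variation_limit p 0 T \<pi> \<omega> \<mu>)"
  define F where "F = pth_variation p 0 T \<pi> \<omega>"
  have F: "F r = measure \<mu> {0..r}" for r by (simp add: F_def pth_variation_def \<mu>_def)
  have "\<exists>\<mu>. is_variation_limit p 0 T \<pi> \<omega> \<mu>"
    using \<omega> unfolding finite_pth_variation_def by (rule conjunct2)
  then have "is_variation_limit p 0 T \<pi> \<omega> \<mu>" unfolding \<mu>_def by (rule someI_ex)
  then have sets: "sets \<mu> = sets (restrict_space borel {0..T})" and fin: "finite_measure \<mu>"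
    and na: "non_atomic \<mu>" and wc: "weakly_converges 0 T (\<lambda>n. variation_measure p 0 T \<omega> (\<pi> n)) \<mu>"
    by (auto simp: is_variation_limit_def)
  interpret finite_measure \<mu> by (rule fin)
  have space: "space \<mu> = {0..T}" using sets_eq_imp_space_eq[OF sets] by (simp add: space_restrict_space)
  have in_sets: "{0..r} \<in> sets \<mu>" if "r \<le> T" for r
    unfolding sets using that by (subst sets_restrict_space_iff) auto
  have F0: "F 0 = 0"
    unfolding F using T in_sets[of 0] by (simp add: non_atomic_singleton[OF na fin])
  \<comment> \<open>The distribution function on the whole line; it is continuous at \<open>0\<close> since \<open>F 0 = 0\<close>.\<close>
  define Fx where "Fx r = F (max 0 (min T r))" for r
  have Fx_cont: "continuous_on UNIV Fx"
    unfolding Fx_def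
    by (rule continuous_on_compose2[OF cont[folded F_def]]) (use T in \<open>auto intro!: continuous_intros\<close>)
  have Fxt: "Fx t = F t" using t by (simp add: Fx_def)
  have Pn: "finite (\<pi> n)" "\<pi> n \<subseteq> {0..T}" for n using P[of n] by (auto simp: partition_of_def)
  have fc: "finite (consec (\<pi> n))" for n by (rule finite_consec[OF Pn(1)])
  define m where "m n = (\<Sum>(u, v)\<in>{(u, v) \<in> consec (\<pi> n). u < t}. \<bar>\<omega> v - \<omega> u\<bar> ^ p)" for n
  have m_alt: "m n = (\<Sum>(u, v)\<in>consec (\<pi> n). \<bar>\<omega> v - \<omega> u\<bar> ^ p * (if u < t then 1 else 0))" for n
    unfolding m_def by (rule sum.mono_neutral_cong_left[OF fc]) (auto split: if_splits)
  \<comment> \<open>equal to 1 up to \<open>c - \<delta>\<close>, equal to 0 from \<open>c\<close> on\<close>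
  define ramp where "ramp c \<delta> r = max 0 (min 1 ((c - r) / \<delta>))" for c \<delta> r :: real
  have ramp_cont: "continuous_on A (ramp c \<delta>)" for A c \<delta>
    unfolding ramp_def divide_inverse by (intro continuous_intros)
  have ramp_bounds: "0 \<le> ramp c \<delta> r" "ramp c \<delta> r \<le> 1" for c \<delta> r by (auto simp: ramp_def)
  have ramp_0: "ramp c \<delta> r = 0" if "c \<le> r" "\<delta> > 0" for c \<delta> r
  proof -
    have "(c - r) / \<delta> \<le> 0" using that by (simp add: divide_nonpos_pos)
    then show ?thesis by (simp add: ramp_def)
  qed
  have ramp_1: "ramp c \<delta> r = 1" if "r \<le> c - \<delta>" "\<delta> > 0" for c \<delta> r
    using that by (simp add: ramp_def max_def min_def)
  have ramp_lim: "(\<lambda>n. \<Sum>(u, v)\<in>consec (\<pi> n). \<bar>\<omega> v - \<omega> u\<bar> ^ p * ramp c \<delta> u) \<longlonglongrightarrow> integral\<^sup>L \<mu> (ramp c \<delta>)" for c \<delta>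
    using wc ramp_cont[of "{0..T}" c \<delta>] unfolding weakly_converges_def
    by (auto simp: integral_variation_measure[OF Pn ramp_cont])
  have ramp_meas: "ramp c \<delta> \<in> borel_measurable \<mu>" for c \<delta>
    using borel_measurable_continuous_on_restrict[OF ramp_cont[of "{0..T}" c \<delta>]]
    by (simp add: measurable_cong_sets[OF sets refl])
  have ramp_int: "integrable \<mu> (ramp c \<delta>)" for c \<delta>
    by (rule integrable_const_bound[of _ 1]) (use ramp_bounds ramp_meas in auto)
  have set_c: "{0..T} \<inter> {..c} \<in> sets \<mu>" for c
    unfolding sets by (subst sets_restrict_space_iff) auto
  have meas_c: "measure \<mu> ({0..T} \<inter> {..c}) = Fx c" for c
  proof (cases "c < 0")
    case True
    then have "{0..T} \<inter> {..c} = {}" by auto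
    then show ?thesis using True T F0 by (simp add: Fx_def max_def)
  next
    case False
    then have "{0..T} \<inter> {..c} = {0..min T c}" by auto
    then show ?thesis using False T by (simp add: Fx_def F max_def)
  qed
  have ind_int: "integral\<^sup>L \<mu> (indicator ({0..T} \<inter> {..c})) = Fx c" for c
    using meas_c set_c[of c] sets.sets_into_space[OF set_c] by (simp add: Int_absorb2)
  have ind_integrable: "integrable \<mu> (indicator ({0..T} \<inter> {..c}) :: real \<Rightarrow> real)" for c
    by (rule integrable_real_indicator[OF set_c]) (simp add: less_top[symmetric])
  have ramp_upper: "integral\<^sup>L \<mu> (ramp c \<delta>) \<le> Fx c" if "\<delta> > 0" for c \<delta>
    unfolding ind_int[symmetric]
    by (rule integral_mono[OF ramp_int ind_integrable])
       (use ramp_bounds ramp_0 that in \<open>auto simp: space indicator_def\<close>)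
  have ramp_lower: "Fx (c - \<delta>) \<le> integral\<^sup>L \<mu> (ramp c \<delta>)" if "\<delta> > 0" for c \<delta>
    unfolding ind_int[symmetric]
    by (rule integral_mono[OF ind_integrable ramp_int])
       (use ramp_bounds ramp_1 that in \<open>auto simp: space indicator_def\<close>)
  have "m \<longlonglongrightarrow> F t"
  proof (rule order_tendstoI)
    fix a assume a: "a < F t"
    have "Fx \<midarrow>t\<rightarrow> Fx t" using Fx_cont by (simp add: continuous_on_def)
    then have "\<forall>\<^sub>F r in at t. a < Fx r" using a by (intro order_tendstoD) (auto simp: Fxt)
    then obtain d where d: "d > 0" "\<And>r. r \<noteq> t \<Longrightarrow> dist r t < d \<Longrightarrow> a < Fx r"
      by (auto simp: eventually_at)
    have "a < Fx (t - d / 2)" using d by (intro d(2)) (auto simp: dist_real_def)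
    also have "\<dots> \<le> integral\<^sup>L \<mu> (ramp t (d / 2))" using d by (intro ramp_lower) auto
    finally have "\<forall>\<^sub>F n in sequentially. a < (\<Sum>(u, v)\<in>consec (\<pi> n). \<bar>\<omega> v - \<omega> u\<bar> ^ p * ramp t (d / 2) u)"
      by (rule order_tendstoD(1)[OF ramp_lim])
    then show "\<forall>\<^sub>F n in sequentially. a < m n"
    proof (rule eventually_mono)
      fix n assume "a < (\<Sum>(u, v)\<in>consec (\<pi> n). \<bar>\<omega> v - \<omega> u\<bar> ^ p * ramp t (d / 2) u)"
      also have "\<dots> \<le> m n"
        unfolding m_alt using ramp_bounds ramp_0[of t _ "d / 2"] d
        by (intro sum_mono) (auto intro!: mult_left_mono)
      finally show "a < m n" .
    qed
  next
    fix a assume a: "F t < a"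
    have "Fx \<midarrow>t\<rightarrow> Fx t" using Fx_cont by (simp add: continuous_on_def)
    then have "\<forall>\<^sub>F r in at t. Fx r < a" using a by (intro order_tendstoD) (auto simp: Fxt)
    then obtain d where d: "d > 0" "\<And>r. r \<noteq> t \<Longrightarrow> dist r t < d \<Longrightarrow> Fx r < a"
      by (auto simp: eventually_at)
    have "integral\<^sup>L \<mu> (ramp (t + d / 2) (d / 2)) \<le> Fx (t + d / 2)" using d by (intro ramp_upper) auto
    also have "\<dots> < a" using d by (intro d(2)) (auto simp: dist_real_def)
    finally have "\<forall>\<^sub>F n in sequentially. (\<Sum>(u, v)\<in>consec (\<pi> n). \<bar>\<omega> v - \<omega> u\<bar> ^ p * ramp (t + d / 2) (d / 2) u) < a"
      by (rule order_tendstoD(2)[OF ramp_lim])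
    then show "\<forall>\<^sub>F n in sequentially. m n < a"
    proof (rule eventually_mono)
      fix n
      have "m n \<le> (\<Sum>(u, v)\<in>consec (\<pi> n). \<bar>\<omega> v - \<omega> u\<bar> ^ p * ramp (t + d / 2) (d / 2) u)"
        unfolding m_alt using ramp_bounds ramp_1[of _ "t + d / 2" "d / 2"] d
        by (intro sum_mono) (auto intro!: mult_left_mono)
      also assume "\<dots> < a"
      finally show "m n < a" .
    qed
  qed
  then show ?thesis unfolding m_def[abs_def] F_def .
qed

text \<open>
  Convergence of scalar distribution functions upgrades to norm convergence of vector-valued
  Riemann-Stieltjes sums. On a short interval \<open>\<phi>\<close> is almost constant, and there the statement is the
  scalar one up to an error proportional to the mass and the length. The errors are additive, so
  Bolzano's bisection principle passes from short intervals to \<open>{s..t}\<close>.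
\<close>

lemma Stieltjes_sums_tendsto:
  fixes \<phi> :: "real \<Rightarrow> 'a::real_normed_vector"
  assumes fin: "\<And>n. finite (C n)" and W: "\<And>n e. W n e \<ge> (0::real)" and st: "s \<le> t"
    and F: "\<And>r. r \<in> {s..t} \<Longrightarrow> (\<lambda>n. \<Sum>e\<in>{e \<in> C n. x e < r}. W n e) \<longlonglongrightarrow> F r"
    and F': "\<And>r. r \<in> {s..t} \<Longrightarrow> (F has_real_derivative d r) (at r within {s..t})"
    and d: "continuous_on {s..t} d" and \<phi>: "continuous_on {s..t} \<phi>"
    and \<Psi>: "\<And>r. r \<in> {s..t} \<Longrightarrow> (\<Psi> has_vector_derivative d r *\<^sub>R \<phi> r) (at r within {s..t})"
  shows "(\<lambda>n. \<Sum>e\<in>{e \<in> C n. s \<le> x e \<and> x e < t}. W n e *\<^sub>R \<phi> (x e)) \<longlonglongrightarrow> \<Psi> t - \<Psi> s"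
proof -
  have "bounded (d ` {s..t})" by (intro compact_imp_bounded compact_continuous_image d compact_Icc)
  then obtain B where B: "B > 0" "\<And>r. r \<in> {s..t} \<Longrightarrow> \<bar>d r\<bar> \<le> B"
    unfolding bounded_pos by auto
  define E where "E n a b = {e \<in> C n. a \<le> x e \<and> x e < b}" for n a b
  define X where "X n a b = (\<Sum>e\<in>E n a b. W n e *\<^sub>R \<phi> (x e))" for n a b
  define m where "m n a b = (\<Sum>e\<in>E n a b. W n e)" for n a b
  have finE: "finite (E n a b)" for n a b using fin by (simp add: E_def)
  have E_split: "E n a c = E n a b \<union> E n b c" "E n a b \<inter> E n b c = {}" if "a \<le> b" "b \<le> c" for n a b c
    using that by (auto simp: E_def)
  have X_add: "X n a c = X n a b + X n b c" if "a \<le> b" "b \<le> c" for n a b c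
    unfolding X_def E_split(1)[OF that] by (rule sum.union_disjoint[OF finE finE E_split(2)[OF that]])
  have m_lim: "(\<lambda>n. m n a b) \<longlonglongrightarrow> F b - F a" if "s \<le> a" "a \<le> b" "b \<le> t" for a b
  proof -
    have "m n a b = (\<Sum>e\<in>{e \<in> C n. x e < b}. W n e) - (\<Sum>e\<in>{e \<in> C n. x e < a}. W n e)" for n
    proof -
      have "{e \<in> C n. x e < b} = {e \<in> C n. x e < a} \<union> E n a b" "{e \<in> C n. x e < a} \<inter> E n a b = {}"
        using that by (auto simp: E_def)
      then show ?thesis unfolding m_def using fin finE by (simp add: sum.union_disjoint)
    qed
    then show ?thesis using that by (auto intro!: tendsto_diff F)
  qed
  have key: "\<forall>\<eta>>0. \<forall>\<^sub>F n in sequentially.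
      norm (X n s t - (\<Psi> t - \<Psi> s)) \<le> \<epsilon> * (F t - F s) + \<epsilon> * B * (t - s) + \<eta>" if \<epsilon>: "\<epsilon> > 0" for \<epsilon>
  proof -
    define Q where "Q a b \<longleftrightarrow> (s \<le> a \<longrightarrow> b \<le> t \<longrightarrow> (\<forall>\<eta>>0. \<forall>\<^sub>F n in sequentially.
      norm (X n a b - (\<Psi> b - \<Psi> a)) \<le> \<epsilon> * (F b - F a) + \<epsilon> * B * (b - a) + \<eta>))" for a b
    have "Q s t"
      using st
    proof (induction rule: Bolzano)
      case (trans a b c)
      show ?case unfolding Q_def
      proof (intro impI allI)
        fix \<eta> :: real assume a: "s \<le> a" "c \<le> t" "0 < \<eta>"
        then have \<eta>: "\<eta> / 2 > 0" by simp
        have "\<forall>\<^sub>F n in sequentially. norm (X n a b - (\<Psi> b - \<Psi> a)) \<le> \<epsilon> * (F b - F a) + \<epsilon> * B * (b - a) + \<eta> / 2"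
          "\<forall>\<^sub>F n in sequentially. norm (X n b c - (\<Psi> c - \<Psi> b)) \<le> \<epsilon> * (F c - F b) + \<epsilon> * B * (c - b) + \<eta> / 2"
          using trans a \<eta> unfolding Q_def by auto
        then show "\<forall>\<^sub>F n in sequentially. norm (X n a c - (\<Psi> c - \<Psi> a)) \<le> \<epsilon> * (F c - F a) + \<epsilon> * B * (c - a) + \<eta>"
        proof eventually_elim
          case (elim n)
          have eq: "X n a c - (\<Psi> c - \<Psi> a) = (X n a b - (\<Psi> b - \<Psi> a)) + (X n b c - (\<Psi> c - \<Psi> b))"
            using X_add[OF trans(3,4)] by simp
          show ?case unfolding eq
            using norm_triangle_ineq[of "X n a b - (\<Psi> b - \<Psi> a)" "X n b c - (\<Psi> c - \<Psi> b)"] elim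
            by (simp add: algebra_simps)
        qed
      qed
    next
      case (local r)
      then have r: "r \<in> {s..t}" by simp
      obtain \<delta> where \<delta>: "\<delta> > 0" "\<And>y. y \<in> {s..t} \<Longrightarrow> dist y r < \<delta> \<Longrightarrow> dist (\<phi> y) (\<phi> r) < \<epsilon>"
        using \<phi> r \<epsilon> unfolding continuous_on_iff by blast
      have "Q a b" if ab: "a \<le> r" "r \<le> b" "b - a < \<delta>" for a b
        unfolding Q_def
      proof (intro impI allI)
        fix \<eta> :: real assume sat: "s \<le> a" "b \<le> t" and \<eta>: "0 < \<eta>"
        have near: "norm (\<phi> y - \<phi> r) \<le> \<epsilon>" if "y \<in> {a..b}" for y
        proof -
          have "dist y r < \<delta>" "y \<in> {s..t}" using that ab sat by (auto simp: dist_real_def)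
          then show ?thesis using \<delta>(2)[of y] by (simp add: dist_norm)
        qed
        define c where "c = \<epsilon> + norm (\<phi> r) + 1"
        have c: "c > 0" using \<epsilon> by (simp add: c_def add_pos_nonneg)
        have "(\<lambda>n. m n a b) \<longlonglongrightarrow> F b - F a" using sat ab by (intro m_lim) auto
        then have "\<forall>\<^sub>F n in sequentially. dist (m n a b) (F b - F a) < \<eta> / c"
          using \<eta> c by (intro tendstoD) auto
        then show "\<forall>\<^sub>F n in sequentially. norm (X n a b - (\<Psi> b - \<Psi> a)) \<le> \<epsilon> * (F b - F a) + \<epsilon> * B * (b - a) + \<eta>"
        proof eventually_elim
          case (elim n)
          have 1: "norm (X n a b - m n a b *\<^sub>R \<phi> r) \<le> \<epsilon> * m n a b"
          proof -
            have "X n a b - m n a b *\<^sub>R \<phi> r = (\<Sum>e\<in>E n a b. W n e *\<^sub>R (\<phi> (x e) - \<phi> r))"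
              by (simp add: X_def m_def scaleR_sum_left sum_subtractf scaleR_diff_right)
            also have "norm \<dots> \<le> (\<Sum>e\<in>E n a b. W n e * \<epsilon>)"
              by (rule sum_norm_le) (use W near in \<open>auto simp: E_def intro!: mult_left_mono\<close>)
            finally show ?thesis by (simp add: m_def sum_distrib_left mult.commute)
          qed
          have 2: "norm ((\<Psi> b - \<Psi> a) - (F b - F a) *\<^sub>R \<phi> r) \<le> \<epsilon> * B * (b - a)"
          proof -
            have "norm ((\<Psi> b - F b *\<^sub>R \<phi> r) - (\<Psi> a - F a *\<^sub>R \<phi> r)) \<le> (\<epsilon> * B) * (b - a)"
            proof (rule norm_increment_le_const[where I = "{s..t}" and f' = "\<lambda>y. d y *\<^sub>R (\<phi> y - \<phi> r)"])
              fix y assume y: "y \<in> {a..b}"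
              then have y': "y \<in> {s..t}" using sat by auto
              have "((\<lambda>y. F y *\<^sub>R \<phi> r) has_vector_derivative (d y *\<^sub>R \<phi> r)) (at y within {s..t})"
                using has_vector_derivative_scaleR[OF F'[OF y'], of "\<lambda>_. \<phi> r" 0] by simp
              then show "((\<lambda>y. \<Psi> y - F y *\<^sub>R \<phi> r) has_vector_derivative d y *\<^sub>R (\<phi> y - \<phi> r)) (at y within {s..t})"
                unfolding scaleR_diff_right by (intro has_vector_derivative_diff \<Psi> y')
              have "\<bar>d y\<bar> * norm (\<phi> y - \<phi> r) \<le> B * \<epsilon>"
                using B(2)[OF y'] near[OF y] B(1) by (intro mult_mono) auto
              then show "norm (d y *\<^sub>R (\<phi> y - \<phi> r)) \<le> \<epsilon> * B" by (simp add: mult.commute)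
            qed (use ab sat in auto)
            then show ?thesis by (simp add: algebra_simps)
          qed
          define \<theta> where "\<theta> = m n a b - (F b - F a)"
          have th: "\<bar>\<theta>\<bar> < \<eta> / c" using elim by (simp add: \<theta>_def dist_real_def)
          have 3: "norm (\<theta> *\<^sub>R \<phi> r) + \<epsilon> * \<bar>\<theta>\<bar> \<le> \<eta>"
          proof -
            have "norm (\<theta> *\<^sub>R \<phi> r) + \<epsilon> * \<bar>\<theta>\<bar> \<le> c * \<bar>\<theta>\<bar>" by (simp add: c_def algebra_simps)
            also have "\<dots> \<le> c * (\<eta> / c)" using th c by (intro mult_left_mono) auto
            finally show ?thesis using c by simp
          qed
          have "\<epsilon> * m n a b \<le> \<epsilon> * (F b - F a) + \<epsilon> * \<bar>\<theta>\<bar>"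
            using \<epsilon> mult_left_mono[of \<theta> "\<bar>\<theta>\<bar>" \<epsilon>] by (simp add: \<theta>_def algebra_simps)
          moreover have eq: "X n a b - (\<Psi> b - \<Psi> a) =
              (X n a b - m n a b *\<^sub>R \<phi> r) + \<theta> *\<^sub>R \<phi> r - ((\<Psi> b - \<Psi> a) - (F b - F a) *\<^sub>R \<phi> r)"
            by (simp add: \<theta>_def algebra_simps)
          ultimately show ?case
            using norm_triangle3[of "X n a b - m n a b *\<^sub>R \<phi> r" "\<theta> *\<^sub>R \<phi> r"
                "(\<Psi> b - \<Psi> a) - (F b - F a) *\<^sub>R \<phi> r", folded eq] 1 2 3 by linarith
        qed
      qed
      then show ?case using \<delta>(1) by blast
    qed
    then show ?thesis by (simp add: Q_def)
  qed
  have "(\<lambda>n. X n s t) \<longlonglongrightarrow> \<Psi> t - \<Psi> s"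
  proof (rule tendstoI)
    fix e :: real assume e: "e > 0"
    define c where "c = \<bar>F t - F s\<bar> + B * (t - s) + 1"
    have c: "c > 0" using B(1) st by (simp add: c_def add_nonneg_pos)
    define \<epsilon> where "\<epsilon> = e / (2 * c)"
    have \<epsilon>: "\<epsilon> > 0" using e c by (simp add: \<epsilon>_def)
    have "\<forall>\<^sub>F n in sequentially. norm (X n s t - (\<Psi> t - \<Psi> s)) \<le> \<epsilon> * (F t - F s) + \<epsilon> * B * (t - s) + e / 4"
      using key[OF \<epsilon>] e by simp
    then show "\<forall>\<^sub>F n in sequentially. dist (X n s t) (\<Psi> t - \<Psi> s) < e"
    proof eventually_elim
      case (elim n)
      have "\<epsilon> * (F t - F s) + \<epsilon> * B * (t - s) \<le> \<epsilon> * c"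
        using \<epsilon> mult_left_mono[OF abs_ge_self[of "F t - F s"] less_imp_le[OF \<epsilon>]]
        by (simp add: c_def algebra_simps)
      also have "\<epsilon> * c = e / 2" using c by (simp add: \<epsilon>_def)
      finally show ?case using elim e by (simp add: dist_norm)
    qed
  qed
  then show ?thesis by (simp add: X_def E_def)
qed

text \<open>
  The remainder after subtracting the term of order \<open>p\<close> as well is controlled by the oscillation of
  the \<open>p\<close>-th derivative; the induction integrates the bound for the derivative by the mean value
  inequality.
\<close>

lemma Taylor_bound:
  fixes D :: "nat \<Rightarrow> real \<Rightarrow> 'a::real_normed_vector"
  assumes "\<And>k z. k < p \<Longrightarrow> z \<in> closed_segment x y \<Longrightarrow> (D k has_vector_derivative D (Suc k) z) (at z)"
    and "\<And>z. z \<in> closed_segment x y \<Longrightarrow> norm (D p z - D p x) \<le> \<epsilon>"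
  shows "norm (D 0 y - (\<Sum>k\<le>p. ((y - x) ^ k / fact k) *\<^sub>R D k x)) \<le> \<epsilon> * \<bar>y - x\<bar> ^ p"
  using assms
proof (induction p arbitrary: D y)
  case 0
  then show ?case by simp
next
  case (Suc p)
  define h where "h z = D 0 z - (\<Sum>k\<le>Suc p. ((z - x) ^ k / fact k) *\<^sub>R D k x)" for z
  define h' where "h' z = D 1 z - (\<Sum>k\<le>p. ((z - x) ^ k / fact k) *\<^sub>R D (Suc k) x)" for z
  have eps: "\<epsilon> \<ge> 0" using Suc.prems(2)[of x] by (auto intro: order_trans[OF norm_ge_zero])
  have der: "(h has_vector_derivative h' z) (at z)" if z: "z \<in> closed_segment x y" for z
  proof -
    have mono: "((\<lambda>z. (z - x) ^ Suc k / fact (Suc k)) has_real_derivative (z - x) ^ k / fact k) (at z)" for k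
    proof -
      have "((\<lambda>z. (z - x) ^ Suc k / fact (Suc k)) has_real_derivative
          ((1 + real k) * (1 * (z - x) ^ k)) / fact (Suc k)) (at z)"
        by (intro DERIV_cdivide DERIV_power_Suc) (auto intro!: derivative_eq_intros)
      moreover have "((1 + real k) * (1 * (z - x) ^ k)) / fact (Suc k) = (z - x) ^ k / fact k"
        by (simp add: add_nonneg_eq_0_iff)
      ultimately show ?thesis by simp
    qed
    have "((\<lambda>z. D 0 z - (D 0 x + (\<Sum>k\<le>p. ((z - x) ^ Suc k / fact (Suc k)) *\<^sub>R D (Suc k) x)))
        has_vector_derivative (D 1 z - (0 + (\<Sum>k\<le>p. ((z - x) ^ k / fact k) *\<^sub>R D (Suc k) x)))) (at z)"
    proof (intro has_vector_derivative_diff has_vector_derivative_add has_vector_derivative_const has_vector_derivative_sum)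
      show "(D 0 has_vector_derivative D 1 z) (at z)" using Suc.prems(1)[of 0 z] z by simp
      show "((\<lambda>z. ((z - x) ^ Suc k / fact (Suc k)) *\<^sub>R D (Suc k) x) has_vector_derivative
          ((z - x) ^ k / fact k) *\<^sub>R D (Suc k) x) (at z)" for k
        using has_vector_derivative_scaleR[OF mono, of "\<lambda>_. D (Suc k) x" 0] by simp
    qed
    then show ?thesis
      unfolding h_def[abs_def] h'_def by (simp only: sum.atMost_Suc_shift) simp
  qed
  have bd: "norm (h' z - h' x) \<le> \<epsilon> * \<bar>y - x\<bar> ^ p" if z: "z \<in> closed_segment x y" for z
  proof -
    have sub: "closed_segment x z \<subseteq> closed_segment x y"
      using z by (simp add: subset_closed_segment)
    have "norm (D (Suc 0) z - (\<Sum>k\<le>p. ((z - x) ^ k / fact k) *\<^sub>R D (Suc k) x)) \<le> \<epsilon> * \<bar>z - x\<bar> ^ p"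
      by (rule Suc.IH[of z "\<lambda>k. D (Suc k)"]) (use Suc.prems sub in auto)
    also have "\<dots> \<le> \<epsilon> * \<bar>y - x\<bar> ^ p"
      using segment_bound(1)[OF z] eps by (intro mult_left_mono power_mono) auto
    finally have "norm (h' z) \<le> \<epsilon> * \<bar>y - x\<bar> ^ p" by (simp add: h'_def)
    moreover have "h' x = 0"
    proof -
      have "(\<Sum>k\<le>p. ((x - x) ^ k / fact k) *\<^sub>R D (Suc k) x) = (\<Sum>k\<le>p. if k = 0 then D 1 x else 0)"
        by (intro sum.cong) (auto simp: power_0_left)
      then show ?thesis by (simp add: h'_def)
    qed
    ultimately show ?thesis by simp
  qed
  have "norm (h y - h x - (y - x) *\<^sub>R h' x) \<le> norm (y - x) * (\<epsilon> * \<bar>y - x\<bar> ^ p)"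
  proof (rule vector_differentiable_bound_linearization[where S = "closed_segment x y"])
    show "(h has_vector_derivative h' z) (at z within closed_segment x y)" if "z \<in> closed_segment x y" for z
      using der[OF that] by (rule has_vector_derivative_at_within)
  qed (use bd in auto)
  moreover have "h x = 0"
  proof -
    have "(\<Sum>k\<le>Suc p. ((x - x) ^ k / fact k) *\<^sub>R D k x) = (\<Sum>k\<le>Suc p. if k = 0 then D 0 x else 0)"
      by (intro sum.cong) (auto simp: power_0_left)
    then show ?thesis by (simp add: h_def)
  qed
  moreover have "h' x = 0"
  proof -
    have "(\<Sum>k\<le>p. ((x - x) ^ k / fact k) *\<^sub>R D (Suc k) x) = (\<Sum>k\<le>p. if k = 0 then D 1 x else 0)"
      by (intro sum.cong) (auto simp: power_0_left)
    then show ?thesis by (simp add: h'_def)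
  qed
  ultimately show ?case by (simp add: h_def mult_ac)
qed

section \<open>Change of variables along a path with finite variation\<close>

locale variation_path =
  fixes p :: nat and T :: real and \<pi> :: "nat \<Rightarrow> real set" and \<omega> d :: "real \<Rightarrow> real"
  assumes T: "T > 0" and p: "even p" "p > 0"
    and partitions: "\<And>n. partition_of 0 T (\<pi> n)"
    and path_cont: "continuous_on {0..T} \<omega>"
    and path_variation: "finite_pth_variation p 0 T \<pi> \<omega>"
    and variation_deriv: "\<And>t. t \<in> {0..T} \<Longrightarrow>
      (pth_variation p 0 T \<pi> \<omega> has_real_derivative d t) (at t within {0..T})"
    and d_cont: "continuous_on {0..T} d"
begin

lemma finite_partition: "finite (\<pi> n)" "\<pi> n \<subseteq> {0..T}" "finite (consec (\<pi> n))"
  using partitions[of n] finite_consec by (auto simp: partition_of_def)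

lemma osc_tendsto: "(\<lambda>n. osc \<omega> (\<pi> n)) \<longlonglongrightarrow> 0"
  using path_variation by (simp add: finite_pth_variation_def)

text \<open>
  The intervals of the \<open>n\<close>-th partition that meet the interior of \<open>{s..t}\<close>. The part of such an interval
  inside \<open>{s..t}\<close> runs from \<open>max u s\<close> to \<open>min v t\<close>.
\<close>

definition crossing :: "real \<Rightarrow> real \<Rightarrow> nat \<Rightarrow> (real \<times> real) set" where
  "crossing s t n = {(u, v) \<in> consec (\<pi> n). s < v \<and> u < t}"

lemma finite_crossing: "finite (crossing s t n)"
  by (rule finite_subset[OF _ finite_partition(3)[of n]]) (auto simp: crossing_def)

lemma crossing_bounds:
  assumes "(u, v) \<in> crossing s t n" "s < t" "t \<le> T"
  shows "max u s \<in> {s..t}" "min v t \<in> {s..t}" "max u s < min v t"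
    "u \<le> max u s" "min v t \<le> v" "u \<in> {0..T}" "v \<in> {0..T}"
  using assms finite_partition(2)[of n] by (auto simp: crossing_def consec_def)

lemma crossing_osc:
  assumes e: "(u, v) \<in> crossing s t n" "s < t" "t \<le> T" and xy: "x \<in> {max u s..min v t}" "y \<in> {max u s..min v t}"
  shows "\<bar>\<omega> x - \<omega> y\<bar> \<le> osc \<omega> (\<pi> n)"
proof (rule osc_bound[OF path_cont finite_partition(1,2)])
  show "(u, v) \<in> consec (\<pi> n)" using e by (simp add: crossing_def)
  show "x \<in> {u..v}" "y \<in> {u..v}" using xy by auto
qed

lemma sum_crossing_telescope:
  fixes Z :: "real \<Rightarrow> 'a::real_normed_vector"
  assumes s: "s \<in> {0..<T}" and t: "t \<in> {s<..T}"
  shows "(\<Sum>(u, v)\<in>crossing s t n. Z (min v t) - Z (max u s)) = Z t - Z s"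
proof -
  define clamp where "clamp x = max s (min x t)" for x
  have P: "\<pi> n \<noteq> {}" "0 \<in> \<pi> n" "T \<in> \<pi> n" using partitions[of n] by (auto simp: partition_of_def)
  have "Max (\<pi> n) = T"
    using finite_partition(1,2)[of n] P by (intro Max_eqI) auto
  moreover have "Min (\<pi> n) = 0"
    using finite_partition(1,2)[of n] P by (intro Min_eqI) auto
  ultimately have "Z t - Z s = (\<Sum>(u, v)\<in>consec (\<pi> n). Z (clamp v) - Z (clamp u))"
    using sum_consec_telescope[OF finite_partition(1) P(1), of "\<lambda>x. Z (clamp x)"] s t
    by (simp add: clamp_def)
  also have "\<dots> = (\<Sum>(u, v)\<in>crossing s t n. Z (min v t) - Z (max u s))"
  proof (rule sum.mono_neutral_cong_right[OF finite_partition(3)])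
    show "crossing s t n \<subseteq> consec (\<pi> n)" by (auto simp: crossing_def)
    show "\<forall>e\<in>consec (\<pi> n) - crossing s t n. (case e of (u, v) \<Rightarrow> Z (clamp v) - Z (clamp u)) = 0"
    proof (clarify)
      fix u v assume e: "(u, v) \<in> consec (\<pi> n)" "(u, v) \<notin> crossing s t n"
      then have "u < v" "v \<le> s \<or> t \<le> u" by (auto simp: consec_def crossing_def)
      then have "clamp v = clamp u" using t by (auto simp: clamp_def)
      then show "Z (clamp v) - Z (clamp u) = 0" by simp
    qed
    show "(case e of (u, v) \<Rightarrow> Z (clamp v) - Z (clamp u)) = (case e of (u, v) \<Rightarrow> Z (min v t) - Z (max u s))"
      if "e \<in> crossing s t n" for e
      using that t by (auto simp: crossing_def clamp_def max_def min_def)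
  qed
  finally show ?thesis ..
qed

lemma pathwise_sum_crossing:
  assumes s: "s \<in> {0..<T}" and t: "t \<in> {s<..T}"
  shows "pathwise_sum p f \<omega> (partitions_from s T \<pi> n) t =
    (\<Sum>(u, v)\<in>crossing s t n. \<Sum>k = 1..p - 1.
        (1 / fact k) *\<^sub>R ((\<omega> (min v t) - \<omega> (max u s)) ^ k *\<^sub>R (partial2 ^^ k) f (max u s) (\<omega> (max u s))))"
proof -
  define H where "H = (\<lambda>(u, v). \<Sum>k = 1..p - 1.
        (1 / fact k) *\<^sub>R ((\<omega> (min v t) - \<omega> (min u t)) ^ k *\<^sub>R (partial2 ^^ k) f u (\<omega> u)))"
  have "pathwise_sum p f \<omega> (partitions_from s T \<pi> n) t = sum H (consec ({s} \<union> (\<pi> n \<inter> {s..T})))"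
    by (simp add: pathwise_sum_def partitions_from_def H_def)
  also have "\<dots> = (\<Sum>e\<in>{(u, v) \<in> consec (\<pi> n). s < v}. H ((\<lambda>(u, v). (max u s, v)) e))"
    by (rule sum.reindex_bij_betw[OF bij_betw_consec_partitions_from[OF partitions s], symmetric])
  also have "\<dots> = (\<Sum>(u, v)\<in>crossing s t n. \<Sum>k = 1..p - 1.
        (1 / fact k) *\<^sub>R ((\<omega> (min v t) - \<omega> (max u s)) ^ k *\<^sub>R (partial2 ^^ k) f (max u s) (\<omega> (max u s))))"
  proof (rule sum.mono_neutral_cong_right)
    show "finite {(u, v) \<in> consec (\<pi> n). s < v}"
      by (rule finite_subset[OF _ finite_partition(3)[of n]]) auto
    show "crossing s t n \<subseteq> {(u, v) \<in> consec (\<pi> n). s < v}" by (auto simp: crossing_def)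
    show "\<forall>e\<in>{(u, v) \<in> consec (\<pi> n). s < v} - crossing s t n. H ((\<lambda>(u, v). (max u s, v)) e) = 0"
    proof (rule ballI)
      fix e assume "e \<in> {(u, v) \<in> consec (\<pi> n). s < v} - crossing s t n"
      then obtain u v where e: "e = (u, v)" "u < v" "t \<le> u" by (auto simp: crossing_def consec_def)
      then have "min v t = t" "min (max u s) t = t" using t by auto
      then show "H ((\<lambda>(u, v). (max u s, v)) e) = 0" using e by (auto simp: H_def power_0_left intro!: sum.neutral)
    qed
    show "H ((\<lambda>(u, v). (max u s, v)) e) = (case e of (u, v) \<Rightarrow> \<Sum>k = 1..p - 1.
        (1 / fact k) *\<^sub>R ((\<omega> (min v t) - \<omega> (max u s)) ^ k *\<^sub>R (partial2 ^^ k) f (max u s) (\<omega> (max u s))))"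
      if cr: "e \<in> crossing s t n" for e
    proof -
      obtain u v where e: "e = (u, v)" "u < t" using cr by (auto simp: crossing_def)
      then have "min (max u s) t = max u s" using t by auto
      then show ?thesis by (simp add: e H_def)
    qed
  qed
  finally show ?thesis .
qed

text \<open>
  Compared with the uncut sums, only the interval across \<open>s\<close> and the one across \<open>t\<close>
  contribute differently, and each such term is at most a constant times the \<open>p\<close>-th power of the
  oscillation of \<open>\<omega>\<close>.
\<close>

lemma variation_sums_tendsto:
  fixes \<phi> :: "real \<Rightarrow> 'a::real_normed_vector"
  assumes s: "s \<in> {0..<T}" and t: "t \<in> {s<..T}" and \<phi>: "continuous_on {s..T} \<phi>"
    and \<Psi>: "\<And>r. r \<in> {s..T} \<Longrightarrow> (\<Psi> has_vector_derivative d r *\<^sub>R \<phi> r) (at r within {s..T})"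
  shows "(\<lambda>n. \<Sum>(u, v)\<in>crossing s t n. \<bar>\<omega> (min v t) - \<omega> (max u s)\<bar> ^ p *\<^sub>R \<phi> (max u s))
    \<longlonglongrightarrow> \<Psi> t - \<Psi> s"
proof -
  have st: "s < t" "t \<le> T" using t by auto
  have sub: "{s..t} \<subseteq> {0..T}" "{s..t} \<subseteq> {s..T}" using s t by auto
  define F where "F = pth_variation p 0 T \<pi> \<omega>"
  define w where "w = (\<lambda>(u, v). \<bar>\<omega> v - \<omega> u\<bar> ^ p)"
  define b where "b e = (if s \<le> fst e then w e *\<^sub>R \<phi> (fst e) else 0)" for e
  define a where "a = (\<lambda>(u, v). \<bar>\<omega> (min v t) - \<omega> (max u s)\<bar> ^ p *\<^sub>R \<phi> (max u s))"
  have "(\<lambda>n. \<Sum>e\<in>{e \<in> consec (\<pi> n). s \<le> fst e \<and> fst e < t}. w e *\<^sub>R \<phi> (fst e)) \<longlonglongrightarrow> \<Psi> t - \<Psi> s"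
  proof (rule Stieltjes_sums_tendsto[where d = d and F = F])
    show "finite (consec (\<pi> n))" for n by (rule finite_partition(3))
    show "0 \<le> w e" for e by (auto simp: w_def split: prod.split)
    have Fc: "continuous_on {0..T} F"
      unfolding F_def by (rule DERIV_continuous_on[OF variation_deriv])
    fix r assume r: "r \<in> {s..t}"
    then have r': "r \<in> {0..T}" "r \<in> {s..T}" using sub by auto
    have "(\<Sum>e\<in>{e \<in> consec (\<pi> n). fst e < r}. w e) =
        (\<Sum>(u, v)\<in>{(u, v) \<in> consec (\<pi> n). u < r}. \<bar>\<omega> v - \<omega> u\<bar> ^ p)" for n
      unfolding w_def by (rule sum.cong) auto
    then show "(\<lambda>n. \<Sum>e\<in>{e \<in> consec (\<pi> n). fst e < r}. w e) \<longlonglongrightarrow> F r"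
      using cumulative_variation_tendsto[OF T partitions path_variation Fc[unfolded F_def] r'(1)]
      by (simp add: F_def)
    show "(F has_real_derivative d r) (at r within {s..t})"
      unfolding F_def using variation_deriv[OF r'(1)] sub(1) by (rule DERIV_subset)
    show "(\<Psi> has_vector_derivative d r *\<^sub>R \<phi> r) (at r within {s..t})"
      using \<Psi>[OF r'(2)] sub(2) by (rule has_vector_derivative_within_subset)
  qed (use st sub d_cont \<phi> in \<open>auto intro: continuous_on_subset\<close>)
  moreover have "(\<Sum>e\<in>{e \<in> consec (\<pi> n). s \<le> fst e \<and> fst e < t}. w e *\<^sub>R \<phi> (fst e)) = sum b (crossing s t n)" for n
  proof (rule sum.mono_neutral_cong_left[OF finite_crossing])
    show "{e \<in> consec (\<pi> n). s \<le> fst e \<and> fst e < t} \<subseteq> crossing s t n"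
      by (auto simp: crossing_def consec_def)
  qed (auto simp: b_def crossing_def)
  ultimately have b_lim: "(\<lambda>n. sum b (crossing s t n)) \<longlonglongrightarrow> \<Psi> t - \<Psi> s" by simp
  have "bounded (\<phi> ` {s..T})" by (intro compact_imp_bounded compact_continuous_image \<phi> compact_Icc)
  then obtain B where B: "B > 0" "\<And>r. r \<in> {s..T} \<Longrightarrow> norm (\<phi> r) \<le> B"
    unfolding bounded_pos by auto
  have diff: "norm (sum a (crossing s t n) - sum b (crossing s t n)) \<le> 4 * B * (osc \<omega> (\<pi> n)) ^ p" for n
  proof -
    define o' where "o' = (osc \<omega> (\<pi> n)) ^ p"
    define E1 where "E1 = {(u, v) \<in> consec (\<pi> n). u < s \<and> s < v}"
    define E2 where "E2 = {(u, v) \<in> consec (\<pi> n). u < t \<and> t < v}"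
    have finE: "finite E1" "finite E2"
      unfolding E1_def E2_def by (rule finite_subset[OF _ finite_partition(3)[of n]], auto)+
    have card: "card (E1 \<union> E2) \<le> 2"
      using card_Un_le[of E1 E2] card_consec_across[OF finite_partition(1), of n s]
        card_consec_across[OF finite_partition(1), of n t] by (simp add: E1_def E2_def)
    have o0: "o' \<ge> 0" using p by (simp add: o'_def zero_le_even_power)
    have each: "norm (a e - b e) \<le> 2 * (o' * B)" if e: "e \<in> crossing s t n" for e
    proof -
      obtain u v where uv: "e = (u, v)" by (cases e)
      note cb = crossing_bounds[OF e[unfolded uv] st]
      have "\<bar>\<omega> (min v t) - \<omega> (max u s)\<bar> \<le> osc \<omega> (\<pi> n)"
        using cb(3) by (intro crossing_osc[OF e[unfolded uv] st]) auto
      then have "\<bar>\<omega> (min v t) - \<omega> (max u s)\<bar> ^ p \<le> o'" unfolding o'_def by (intro power_mono) auto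
      moreover have "norm (\<phi> (max u s)) \<le> B" using cb(1) st by (intro B(2)) auto
      ultimately have na: "norm (a e) \<le> o' * B" unfolding a_def uv using o0 by (auto intro!: mult_mono)
      have nb: "norm (b e) \<le> o' * B"
      proof (cases "s \<le> u")
        case True
        have "(u, v) \<in> consec (\<pi> n)" using e by (simp add: uv crossing_def)
        then have "\<bar>\<omega> v - \<omega> u\<bar> \<le> osc \<omega> (\<pi> n)"
          by (intro osc_bound[OF path_cont finite_partition(1,2)]) (auto simp: consec_def)
        then have "\<bar>\<omega> v - \<omega> u\<bar> ^ p \<le> o'" unfolding o'_def by (intro power_mono) auto
        moreover have "norm (\<phi> u) \<le> B" using True cb by (intro B(2)) auto
        ultimately show ?thesis using True o0 by (auto simp: b_def uv w_def intro!: mult_mono)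
      qed (use o0 B in \<open>simp add: b_def uv\<close>)
      show ?thesis using norm_triangle_ineq4[of "a e" "b e"] na nb by simp
    qed
    have zero: "a e - b e = 0" if cr: "e \<in> crossing s t n - (E1 \<union> E2)" for e
    proof -
      obtain u v where e: "e = (u, v)" by (cases e)
      then have "(u, v) \<in> consec (\<pi> n)" "s < v" "u < t" "\<not> u < s" "\<not> t < v"
        using cr by (auto simp: crossing_def E1_def E2_def)
      then have "max u s = u" "min v t = v" "s \<le> u" by auto
      then show ?thesis by (simp add: e a_def b_def w_def)
    qed
    have "sum a (crossing s t n) - sum b (crossing s t n) = (\<Sum>e\<in>crossing s t n. a e - b e)"
      by (simp add: sum_subtractf)
    also have "\<dots> = (\<Sum>e\<in>crossing s t n \<inter> (E1 \<union> E2). a e - b e)"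
      by (rule sum.mono_neutral_right[OF finite_crossing]) (use zero in auto)
    also have "norm \<dots> \<le> (\<Sum>e\<in>crossing s t n \<inter> (E1 \<union> E2). 2 * (o' * B))"
      by (rule sum_norm_le) (use each in auto)
    also have "\<dots> = card (crossing s t n \<inter> (E1 \<union> E2)) * (2 * (o' * B))" by simp
    also have "\<dots> \<le> 2 * (2 * (o' * B))"
    proof (rule mult_right_mono)
      have "card (crossing s t n \<inter> (E1 \<union> E2)) \<le> card (E1 \<union> E2)" using finE by (intro card_mono) auto
      then show "real (card (crossing s t n \<inter> (E1 \<union> E2))) \<le> 2" using card by linarith
    qed (use B o0 in auto)
    finally show ?thesis by (simp add: o'_def mult_ac)
  qed
  have "(\<lambda>n. sum a (crossing s t n) - sum b (crossing s t n)) \<longlonglongrightarrow> 0"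
  proof (rule Lim_null_comparison)
    show "\<forall>\<^sub>F n in sequentially. norm (sum a (crossing s t n) - sum b (crossing s t n)) \<le> 4 * B * (osc \<omega> (\<pi> n)) ^ p"
      using diff by simp
    have "(\<lambda>n. 4 * B * (osc \<omega> (\<pi> n)) ^ p) \<longlonglongrightarrow> 4 * B * 0 ^ p" by (intro tendsto_intros osc_tendsto)
    moreover have "4 * B * 0 ^ p = 0" using p by (simp add: zero_power)
    ultimately show "(\<lambda>n. 4 * B * (osc \<omega> (\<pi> n)) ^ p) \<longlonglongrightarrow> 0" by metis
  qed
  from tendsto_add[OF this b_lim] show ?thesis by (simp add: a_def)
qed

lemma modulus_in_space:
  fixes h :: "real \<Rightarrow> real \<Rightarrow> 'a::real_normed_vector"
  assumes "continuous_on ({s..T} \<times> UNIV) (\<lambda>(t, x). h t x)" "\<epsilon> > 0"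
  shows "\<exists>\<delta>>0. \<forall>t\<in>{s..T}. \<forall>x\<in>{-b..b}. \<forall>y\<in>{-b..b}. \<bar>x - y\<bar> < \<delta> \<longrightarrow> norm (h t x - h t y) \<le> \<epsilon>"
proof -
  have "compact ({s..T} \<times> {-b..b})" by (intro compact_Times compact_Icc)
  moreover have "continuous_on ({s..T} \<times> {-b..b}) (\<lambda>(t, x). h t x)"
    using assms(1) by (rule continuous_on_subset) auto
  ultimately have "uniformly_continuous_on ({s..T} \<times> {-b..b}) (\<lambda>(t, x). h t x)"
    by (rule compact_uniformly_continuous[rotated])
  then obtain \<delta> where \<delta>: "\<delta> > 0" "\<And>a c. a \<in> {s..T} \<times> {-b..b} \<Longrightarrow> c \<in> {s..T} \<times> {-b..b} \<Longrightarrow> dist c a < \<delta> \<Longrightarrow>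
      dist ((\<lambda>(t, x). h t x) c) ((\<lambda>(t, x). h t x) a) < \<epsilon>"
    using assms(2) unfolding uniformly_continuous_on_def by metis
  have "norm (h t x - h t y) \<le> \<epsilon>" if "t \<in> {s..T}" "x \<in> {-b..b}" "y \<in> {-b..b}" "\<bar>x - y\<bar> < \<delta>" for t x y
    using \<delta>(2)[of "(t, y)" "(t, x)"] that by (simp add: dist_Pair_Pair dist_norm)
  then show ?thesis using \<delta>(1) by blast
qed

text \<open>
  On each interval the increment of \<open>D 0 r (\<omega> r)\<close> splits into a time increment at the frozen value
  \<open>\<omega> v\<close>, which matches the increment of \<open>Z\<close>, and a space increment at the time \<open>u\<close>, which is
  expanded to order \<open>p\<close>. The terms of order less than \<open>p\<close> are the summands of the pathwise integral, and those of order
  \<open>p\<close> form a Stieltjes sum against the \<open>p\<close>-th variation because \<open>p\<close> is even. The errors are at most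
  \<open>\<epsilon>\<close> times the length plus \<open>\<epsilon>\<close> times the \<open>p\<close>-th power of the increment of \<open>\<omega>\<close>, hence summable.
\<close>

theorem pathwise_Ito_formula:
  fixes D :: "nat \<Rightarrow> real \<Rightarrow> real \<Rightarrow> 'v::real_normed_vector"
  assumes s: "s \<in> {0..<T}" and t: "t \<in> {s<..T}"
    and f: "\<And>k r. r \<in> {s..T} \<Longrightarrow> k < p \<Longrightarrow> (partial2 ^^ k) f r = D k r"
    and D: "\<And>k r x. r \<in> {s..T} \<Longrightarrow> k < p \<Longrightarrow> (D k r has_vector_derivative D (Suc k) r x) (at x)"
    and Dp: "continuous_on ({s..T} \<times> UNIV) (\<lambda>(r, x). D p r x)"
    and g: "continuous_on ({s..T} \<times> UNIV) (\<lambda>(r, x). g r x)"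
      "\<And>r x. r \<in> {s..T} \<Longrightarrow> ((\<lambda>r. D 0 r x) has_vector_derivative g r x) (at r within {s..T})"
    and Z: "\<And>r. r \<in> {s..T} \<Longrightarrow> (Z has_vector_derivative g r (\<omega> r)) (at r within {s..T})"
    and \<Psi>: "\<And>r. r \<in> {s..T} \<Longrightarrow> (\<Psi> has_vector_derivative d r *\<^sub>R D p r (\<omega> r)) (at r within {s..T})"
  shows "has_pathwise_integral p (partitions_from s T \<pi>) f \<omega> t
    (D 0 t (\<omega> t) - D 0 s (\<omega> s) - (Z t - Z s) - (1 / fact p) *\<^sub>R (\<Psi> t - \<Psi> s))"
proof -
  have st: "s < t" "t \<le> T" using t by auto
  have \<omega>c: "continuous_on {s..T} \<omega>" using path_cont s by (auto intro: continuous_on_subset)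
  have "bounded (\<omega> ` {s..T})" by (intro compact_imp_bounded compact_continuous_image \<omega>c compact_Icc)
  then obtain b where "\<forall>x\<in>\<omega> ` {s..T}. norm x \<le> b" unfolding bounded_iff ..
  then have b: "\<omega> r \<in> {-b..b}" if "r \<in> {s..T}" for r
  proof -
    have "norm (\<omega> r) \<le> b" using \<open>\<forall>x\<in>\<omega> ` {s..T}. norm x \<le> b\<close> that by blast
    then show ?thesis unfolding atLeastAtMost_iff real_norm_def by linarith
  qed
  define \<phi> where "\<phi> r = D p r (\<omega> r)" for r
  have \<phi>: "continuous_on {s..T} \<phi>"
  proof -
    have "continuous_on {s..T} (\<lambda>r. (r, \<omega> r))" by (intro continuous_intros \<omega>c)
    from continuous_on_compose2[OF Dp this] show ?thesis by (auto simp: \<phi>_def[abs_def])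
  qed
  define X where "X n = (\<Sum>(u, v)\<in>crossing s t n. \<bar>\<omega> (min v t) - \<omega> (max u s)\<bar> ^ p *\<^sub>R \<phi> (max u s))" for n
  define m where "m n = (\<Sum>(u, v)\<in>crossing s t n. \<bar>\<omega> (min v t) - \<omega> (max u s)\<bar> ^ p)" for n
  define I where "I n = pathwise_sum p f \<omega> (partitions_from s T \<pi> n) t" for n
  have X_lim: "X \<longlonglongrightarrow> \<Psi> t - \<Psi> s"
    unfolding X_def by (rule variation_sums_tendsto[OF s t \<phi>]) (use \<Psi> in \<open>simp add: \<phi>_def\<close>)
  have m_lim: "m \<longlonglongrightarrow> pth_variation p 0 T \<pi> \<omega> t - pth_variation p 0 T \<pi> \<omega> s"
  proof -
    have "(pth_variation p 0 T \<pi> \<omega> has_vector_derivative d r *\<^sub>R 1) (at r within {s..T})" if "r \<in> {s..T}" for r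
      using DERIV_subset[OF variation_deriv, of r "{s..T}"] that s
      by (auto simp: has_real_derivative_iff_has_vector_derivative)
    from variation_sums_tendsto[OF s t continuous_on_const this] show ?thesis
      by (simp add: m_def[abs_def])
  qed
  then have "Bseq m" by (blast intro: convergent_imp_Bseq convergentI)
  then obtain c where c: "c > 0" "\<forall>n. norm (m n) \<le> c" unfolding Bseq_def by blast
  define L where "L = D 0 t (\<omega> t) - D 0 s (\<omega> s) - (Z t - Z s)"
  have key: "\<forall>\<^sub>F n in sequentially. norm (I n - (L - (1 / fact p) *\<^sub>R X n)) \<le> \<epsilon> * ((t - s) + c)"
    if \<epsilon>: "\<epsilon> > 0" for \<epsilon>
  proof -
    obtain \<delta>1 where \<delta>1: "\<delta>1 > 0" "\<forall>r\<in>{s..T}. \<forall>x\<in>{-b..b}. \<forall>y\<in>{-b..b}. \<bar>x - y\<bar> < \<delta>1 \<longrightarrow> norm (g r x - g r y) \<le> \<epsilon>"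
      using modulus_in_space[OF g(1) \<epsilon>] by blast
    obtain \<delta>2 where \<delta>2: "\<delta>2 > 0" "\<forall>r\<in>{s..T}. \<forall>x\<in>{-b..b}. \<forall>y\<in>{-b..b}. \<bar>x - y\<bar> < \<delta>2 \<longrightarrow> norm (D p r x - D p r y) \<le> \<epsilon>"
      using modulus_in_space[OF Dp \<epsilon>] by blast
    have "\<forall>\<^sub>F n in sequentially. osc \<omega> (\<pi> n) < min \<delta>1 \<delta>2"
      by (rule order_tendstoD(2)[OF osc_tendsto]) (use \<delta>1(1) \<delta>2(1) in simp)
    then show ?thesis
    proof eventually_elim
      case (elim n)
      define J where "J = (\<lambda>(u, v). \<Sum>k = 1..p - 1.
        (1 / fact k) *\<^sub>R ((\<omega> (min v t) - \<omega> (max u s)) ^ k *\<^sub>R (partial2 ^^ k) f (max u s) (\<omega> (max u s))))"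
      define inc where "inc = (\<lambda>(u, v). (D 0 (min v t) (\<omega> (min v t)) - D 0 (max u s) (\<omega> (max u s))) -
        (Z (min v t) - Z (max u s)))"
      define Y where "Y = (\<lambda>(u, v). \<bar>\<omega> (min v t) - \<omega> (max u s)\<bar> ^ p *\<^sub>R \<phi> (max u s))"
      define bd where "bd = (\<lambda>(u, v). \<epsilon> * (min v t - max u s) + \<epsilon> * \<bar>\<omega> (min v t) - \<omega> (max u s)\<bar> ^ p)"
      have loc: "norm (J e + (1 / fact p) *\<^sub>R Y e - inc e) \<le> bd e" if e: "e \<in> crossing s t n" for e
      proof -
        obtain u0 v0 where uv0: "e = (u0, v0)" by (cases e)
        define u where "u = max u0 s"
        define v where "v = min v0 t"
        note e' = e[unfolded uv0]
        have uv: "u \<in> {s..t}" "v \<in> {s..t}" "u < v"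
          using crossing_bounds[OF e' st] by (auto simp: u_def v_def)
        have in_sT: "r \<in> {s..T}" if "r \<in> {u..v}" for r using that uv st by auto
        have osc: "\<bar>\<omega> x - \<omega> y\<bar> < min \<delta>1 \<delta>2" if "x \<in> {u..v}" "y \<in> {u..v}" for x y
          using crossing_osc[OF e' st, of x y] that elim by (simp add: u_def v_def)
        define h where "h = \<omega> v - \<omega> u"
        have time: "norm ((D 0 v (\<omega> v) - Z v) - (D 0 u (\<omega> v) - Z u)) \<le> \<epsilon> * (v - u)"
        proof (rule norm_increment_le_const[where I = "{s..T}" and f' = "\<lambda>r. g r (\<omega> v) - g r (\<omega> r)"])
          fix r assume r: "r \<in> {u..v}"
          show "((\<lambda>r. D 0 r (\<omega> v) - Z r) has_vector_derivative g r (\<omega> v) - g r (\<omega> r)) (at r within {s..T})"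
            using in_sT[OF r] by (intro has_vector_derivative_diff g(2) Z)
          have "\<bar>\<omega> v - \<omega> r\<bar> < \<delta>1" using osc[of v r] r uv by auto
          then show "norm (g r (\<omega> v) - g r (\<omega> r)) \<le> \<epsilon>"
            using \<delta>1(2) in_sT[OF r] b[of v] b[OF in_sT[OF r]] in_sT[of v] uv by auto
        qed (use uv in_sT in auto)
        have u_in: "u \<in> {s..T}" and v_in: "v \<in> {s..T}" using uv st by auto
        have space: "norm (D 0 u (\<omega> v) - (\<Sum>k\<le>p. (h ^ k / fact k) *\<^sub>R D k u (\<omega> u))) \<le> \<epsilon> * \<bar>h\<bar> ^ p"
          unfolding h_def
        proof (rule Taylor_bound[of p "\<omega> u" "\<omega> v" "\<lambda>k. D k u"])
          fix z assume z: "z \<in> closed_segment (\<omega> u) (\<omega> v)"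
          have "z \<in> {-b..b}" using z b[OF u_in] b[OF v_in] by (auto simp: closed_segment_eq_real_ivl split: if_splits)
          moreover have "\<bar>z - \<omega> u\<bar> < \<delta>2"
            using segment_bound(1)[OF z] osc[of v u] uv by auto
          ultimately show "norm (D p u z - D p u (\<omega> u)) \<le> \<epsilon>" using \<delta>2(2) u_in b[OF u_in] by auto
        qed (use D u_in in auto)
        have "(\<Sum>k\<le>p. (h ^ k / fact k) *\<^sub>R D k u (\<omega> u)) =
            D 0 u (\<omega> u) + (J e + (1 / fact p) *\<^sub>R Y e)"
        proof -
          have "J e = (\<Sum>k = 1..p - 1. (h ^ k / fact k) *\<^sub>R D k u (\<omega> u))"
            unfolding J_def uv0 prod.case u_def[symmetric] v_def[symmetric] h_def[symmetric]
            using p by (intro sum.cong) (auto simp: f[OF u_in])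
          moreover have "(1 / fact p) *\<^sub>R Y e = (h ^ p / fact p) *\<^sub>R D p u (\<omega> u)"
            unfolding Y_def uv0 prod.case u_def[symmetric] v_def[symmetric] h_def[symmetric] \<phi>_def
            using p(1) by (simp add: power_even_abs)
          moreover have "{..p} = insert 0 (insert p {1..p - 1})" using p(2) by auto
          ultimately show ?thesis using p(2) by simp
        qed
        then have eq: "J e + (1 / fact p) *\<^sub>R Y e - inc e =
            - (D 0 u (\<omega> v) - (\<Sum>k\<le>p. (h ^ k / fact k) *\<^sub>R D k u (\<omega> u)))
            - ((D 0 v (\<omega> v) - Z v) - (D 0 u (\<omega> v) - Z u))"
          by (simp add: inc_def uv0 u_def v_def)
        have "norm (J e + (1 / fact p) *\<^sub>R Y e - inc e) \<le> \<epsilon> * \<bar>h\<bar> ^ p + \<epsilon> * (v - u)"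
          unfolding eq using time space
            norm_triangle_ineq4[of "- (D 0 u (\<omega> v) - (\<Sum>k\<le>p. (h ^ k / fact k) *\<^sub>R D k u (\<omega> u)))"
              "(D 0 v (\<omega> v) - Z v) - (D 0 u (\<omega> v) - Z u)"]
          by (simp only: norm_minus_cancel)
        then show ?thesis by (simp add: bd_def uv0 u_def v_def h_def)
      qed
      have "sum inc (crossing s t n) = L"
        using sum_crossing_telescope[OF s t, of "\<lambda>r. D 0 r (\<omega> r) - Z r" n]
        unfolding L_def inc_def by (simp add: algebra_simps case_prod_unfold)
      moreover have "I n = sum J (crossing s t n)"
        unfolding I_def J_def by (rule pathwise_sum_crossing[OF s t])
      moreover have "X n = sum Y (crossing s t n)" by (simp add: X_def Y_def)
      ultimately have "I n - (L - (1 / fact p) *\<^sub>R X n) =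
          (\<Sum>e\<in>crossing s t n. J e + (1 / fact p) *\<^sub>R Y e - inc e)"
        by (simp add: sum_subtractf sum.distrib scaleR_sum_right)
      then have "norm (I n - (L - (1 / fact p) *\<^sub>R X n)) \<le> sum bd (crossing s t n)"
        using loc by (simp add: sum_norm_le)
      also have "sum bd (crossing s t n) = \<epsilon> * (t - s) + \<epsilon> * m n"
        using sum_crossing_telescope[OF s t, of "\<lambda>r. r" n]
        unfolding bd_def m_def by (simp add: case_prod_unfold sum.distrib sum_distrib_left[symmetric])
      also have "\<dots> \<le> \<epsilon> * ((t - s) + c)"
      proof -
        have "m n \<le> c" using c(2)[rule_format, of n] by simp
        then show ?thesis using \<epsilon> by (simp add: distrib_left)
      qed
      finally show ?case .
    qed
  qed
  have "(\<lambda>n. I n - (L - (1 / fact p) *\<^sub>R X n)) \<longlonglongrightarrow> 0"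
  proof (rule tendstoI)
    fix e :: real assume e: "e > 0"
    define C where "C = (t - s) + c"
    have C: "C > 0" using c(1) st by (simp add: C_def)
    have "\<forall>\<^sub>F n in sequentially. norm (I n - (L - (1 / fact p) *\<^sub>R X n)) \<le> (e / (2 * C)) * C"
      unfolding C_def by (rule key) (use e C in \<open>simp add: C_def\<close>)
    then show "\<forall>\<^sub>F n in sequentially. dist (I n - (L - (1 / fact p) *\<^sub>R X n)) 0 < e"
      by eventually_elim (use e C in \<open>simp add: field_simps\<close>)
  qed
  moreover have "(\<lambda>n. L - (1 / fact p) *\<^sub>R X n) \<longlonglongrightarrow> L - (1 / fact p) *\<^sub>R (\<Psi> t - \<Psi> s)"
    by (intro tendsto_intros X_lim)
  ultimately have "I \<longlonglongrightarrow> L - (1 / fact p) *\<^sub>R (\<Psi> t - \<Psi> s)"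
    using tendsto_add by fastforce
  then show ?thesis by (simp add: has_pathwise_integral_def I_def[abs_def] L_def)
qed

end

section \<open>Bochner integrals of continuous functions\<close>

text \<open>
  The left endpoint rule on a uniform grid. The function \<open>k\<close> numbers the grid cells; the last
  number \<open>N\<close> is attained only at \<open>b\<close> and has measure zero.
\<close>

lemma step_function_approximation:
  fixes f :: "real \<Rightarrow> 'v::real_normed_vector"
  assumes ab: "a < b" and f: "continuous_on {a..b} f"
    and F: "\<And>t. t \<in> {a..b} \<Longrightarrow> (F has_vector_derivative f t) (at t within {a..b})" and \<epsilon>: "\<epsilon> > 0"
  shows "\<exists>\<phi>. Bochner_Integration.simple_bochner_integrable (lebesgue_on {a..b}) \<phi> \<and>
     (\<forall>x\<in>{a..b}. norm (f x - \<phi> x) \<le> \<epsilon>) \<and>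
     norm (Bochner_Integration.simple_bochner_integral (lebesgue_on {a..b}) \<phi> - (F b - F a)) \<le> \<epsilon> * (b - a)"
proof -
  have "uniformly_continuous_on {a..b} f" using f by (intro compact_uniformly_continuous) auto
  then obtain \<delta> where \<delta>: "\<delta> > 0" "\<And>x y. x \<in> {a..b} \<Longrightarrow> y \<in> {a..b} \<Longrightarrow> dist y x < \<delta> \<Longrightarrow> dist (f y) (f x) < \<epsilon>"
    using \<epsilon> unfolding uniformly_continuous_on_def by metis
  obtain N :: nat where N: "(b - a) / \<delta> < real N" using reals_Archimedean2 by blast
  have N0: "N > 0" using N ab \<delta>(1) by (cases N) (auto simp: divide_less_0_iff)
  define h where "h = (b - a) / N"
  have h: "h > 0" "h < \<delta>" "real N * h = b - a"
    using N N0 ab \<delta>(1) by (auto simp: h_def field_simps)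
  define k where "k x = nat \<lfloor>(x - a) / h\<rfloor>" for x
  define v where "v n = f (a + h * real n)" for n
  define M where "M = lebesgue_on {a..b}"
  have space: "space M = {a..b}" by (simp add: M_def)
  have k: "k x = n \<longleftrightarrow> a + h * real n \<le> x \<and> x < a + h * (real n + 1)" if "x \<in> {a..b}" for x n
  proof -
    have "0 \<le> (x - a) / h" using that h by simp
    then have "k x = n \<longleftrightarrow> \<lfloor>(x - a) / h\<rfloor> = int n" by (auto simp: k_def nat_eq_iff)
    also have "\<dots> \<longleftrightarrow> real n \<le> (x - a) / h \<and> (x - a) / h < real n + 1" by (simp add: floor_eq_iff)
    also have "\<dots> \<longleftrightarrow> a + h * real n \<le> x \<and> x < a + h * (real n + 1)"
      using h by (auto simp: field_simps)
    finally show ?thesis .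
  qed
  have kN: "k x \<le> N" if "x \<in> {a..b}" for x
  proof -
    have "h * real (k x) \<le> h * N" using k[OF that, of "k x"] that h(3) by (auto simp: mult.commute)
    then show ?thesis using h(1) by simp
  qed
  have grid: "a + h * real n \<in> {a..b}" if "n \<le> N" for n
  proof -
    have "h * real n \<le> h * N" using that h by (intro mult_left_mono) auto
    also have "\<dots> = b - a" using h(3) by (simp add: mult.commute)
    finally show ?thesis using h(1) by simp
  qed
  have level: "{x \<in> space M. k x = n} = {a..b} \<inter> {a + h * real n..<a + h * (real n + 1)}" for n
  proof (rule set_eqI)
    fix x
    show "x \<in> {x \<in> space M. k x = n} \<longleftrightarrow> x \<in> {a..b} \<inter> {a + h * real n..<a + h * (real n + 1)}"
      using k[of x n] unfolding space by (cases "x \<in> {a..b}") auto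
  qed
  have level_sets: "{x \<in> space M. k x = n} \<in> sets M" for n
    unfolding level unfolding M_def by (subst sets_restrict_space_iff) auto
  have simple: "simple_function M k"
    unfolding simple_function_def
  proof (intro conjI ballI)
    show "finite (k ` space M)" by (rule finite_subset[of _ "{..N}"]) (use kN space in auto)
    show "k -` {n} \<inter> space M \<in> sets M" for n
      using level_sets[of n] by (simp add: vimage_def Int_def conj_commute)
  qed
  have meas: "measure M {x \<in> space M. k x = n} = (if n = N then 0 else h)" if "n \<le> N" for n
  proof -
    have "measure M {x \<in> space M. k x = n} = measure lebesgue ({a..b} \<inter> {a + h * real n..<a + h * (real n + 1)})"
      unfolding level unfolding M_def by (rule measure_restrict_space) auto
    also have "{a..b} \<inter> {a + h * real n..<a + h * (real n + 1)} =
        (if n = N then {b} else {a + h * real n..<a + h * (real n + 1)})"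
    proof (cases "n = N")
      case True
      then show ?thesis using h by (auto simp: algebra_simps)
    next
      case False
      then have "Suc n \<le> N" using that by simp
      then have "a \<le> a + h * real n" "a + h * (real n + 1) \<le> b"
        using grid[of "Suc n"] grid[OF that] by (auto simp: algebra_simps)
      then show ?thesis using False by auto
    qed
    finally show ?thesis using h(1) by (simp add: algebra_simps)
  qed
  define \<phi> where "\<phi> x = v (k x)" for x
  have near: "norm (f x - \<phi> x) \<le> \<epsilon>" if x: "x \<in> {a..b}" for x
  proof -
    have "dist x (a + h * real (k x)) < \<delta>" using k[OF x, of "k x"] h(2) by (auto simp: dist_real_def algebra_simps)
    then show ?thesis using \<delta>(2)[OF grid[OF kN[OF x]] x] by (simp add: \<phi>_def v_def dist_norm)
  qed
  have sbi: "Bochner_Integration.simple_bochner_integrable M \<phi>"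
  proof
    show "simple_function M \<phi>" unfolding \<phi>_def using simple by (rule simple_function_compose1)
    have "emeasure M {y \<in> space M. \<phi> y \<noteq> 0} \<le> emeasure M (space M)" by (rule emeasure_space)
    also have "\<dots> < \<infinity>" unfolding space using ab by (simp add: M_def emeasure_restrict_space)
    finally show "emeasure M {y \<in> space M. \<phi> y \<noteq> 0} \<noteq> \<infinity>" by simp
  qed
  have "Bochner_Integration.simple_bochner_integral M \<phi> = (\<Sum>n\<in>k ` space M. measure M {x \<in> space M. k x = n} *\<^sub>R v n)"
    by (rule simple_bochner_integral_partition[OF sbi simple]) (auto simp: \<phi>_def)
  also have "\<dots> = (\<Sum>n\<le>N. measure M {x \<in> space M. k x = n} *\<^sub>R v n)"
  proof (rule sum.mono_neutral_left)
    show "k ` space M \<subseteq> {..N}" using kN space by auto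
    show "\<forall>n\<in>{..N} - k ` space M. measure M {x \<in> space M. k x = n} *\<^sub>R v n = 0"
    proof
      fix n assume "n \<in> {..N} - k ` space M"
      then have "{x \<in> space M. k x = n} = {}" by auto
      then show "measure M {x \<in> space M. k x = n} *\<^sub>R v n = 0" by (simp only: measure_empty scaleR_zero_left)
    qed
  qed simp
  also have "\<dots> = (\<Sum>n<N. h *\<^sub>R v n)"
    unfolding lessThan_Suc_atMost[symmetric] sum.lessThan_Suc using meas by simp
  finally have int: "Bochner_Integration.simple_bochner_integral M \<phi> = (\<Sum>n<N. h *\<^sub>R v n)" .
  have "norm (h *\<^sub>R v n - (F (a + h * real (Suc n)) - F (a + h * real n))) \<le> \<epsilon> * h" if n: "n < N" for n
  proof -
    define l u where "l = a + h * real n" and "u = a + h * real (Suc n)"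
    have lu: "l \<in> {a..b}" "u \<in> {a..b}" "u = l + h"
      using grid[of n] grid[of "Suc n"] n by (auto simp: l_def u_def algebra_simps)
    have "norm ((F u - u *\<^sub>R v n) - (F l - l *\<^sub>R v n)) \<le> \<epsilon> * (u - l)"
    proof (rule norm_increment_le_const[where I = "{a..b}" and f' = "\<lambda>r. f r - v n"])
      fix r assume r: "r \<in> {l..u}"
      then have r': "r \<in> {a..b}" using lu by auto
      show "((\<lambda>r. F r - r *\<^sub>R v n) has_vector_derivative f r - v n) (at r within {a..b})"
        by (auto intro!: derivative_eq_intros F[OF r'])
      have "dist r l < \<delta>" using r lu(3) h by (auto simp: dist_real_def)
      then show "norm (f r - v n) \<le> \<epsilon>" using \<delta>(2)[OF lu(1) r'] by (simp add: v_def l_def dist_norm)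
    qed (use lu h in auto)
    moreover have "(F u - u *\<^sub>R v n) - (F l - l *\<^sub>R v n) = - (h *\<^sub>R v n - (F u - F l))"
      using lu(3) by (simp add: algebra_simps)
    ultimately show ?thesis using lu(3) unfolding l_def[symmetric] u_def[symmetric]
      by (simp only: norm_minus_cancel) simp
  qed
  then have "norm (\<Sum>n<N. h *\<^sub>R v n - (F (a + h * real (Suc n)) - F (a + h * real n))) \<le> (\<Sum>n<N. \<epsilon> * h)"
    by (intro sum_norm_le) auto
  also have "\<dots> = \<epsilon> * (b - a)" by (simp add: h(3)[symmetric])
  also have "(\<Sum>n<N. h *\<^sub>R v n - (F (a + h * real (Suc n)) - F (a + h * real n))) =
      Bochner_Integration.simple_bochner_integral M \<phi> - (F b - F a)"
  proof -
    have "(\<Sum>n<N. F (a + h * real (Suc n)) - F (a + h * real n)) = F (a + h * real N) - F (a + h * real 0)"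
      by (rule sum_lessThan_telescope)
    also have "a + h * real N = b" using h(3) by (simp add: mult.commute)
    finally show ?thesis by (simp add: sum_subtractf int)
  qed
  finally show ?thesis using sbi near unfolding M_def by blast
qed

lemma bochner_integral_is_antiderivative:
  fixes f :: "real \<Rightarrow> 'v::real_normed_vector"
  assumes ab: "a < b" and f: "continuous_on {a..b} f"
    and F: "\<And>t. t \<in> {a..b} \<Longrightarrow> (F has_vector_derivative f t) (at t within {a..b})"
  shows "bochner_integral_is (lebesgue_on {a..b}) f (F b - F a)"
proof -
  have "\<exists>\<phi>. \<forall>i. Bochner_Integration.simple_bochner_integrable (lebesgue_on {a..b}) (\<phi> i) \<and>
     (\<forall>x\<in>{a..b}. norm (f x - \<phi> i x) \<le> 1 / Suc i) \<and>
     norm (Bochner_Integration.simple_bochner_integral (lebesgue_on {a..b}) (\<phi> i) - (F b - F a)) \<le> 1 / Suc i * (b - a)"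
    by (intro choice allI step_function_approximation[OF ab f F]) auto
  then obtain \<phi> where \<phi>: "\<forall>i. Bochner_Integration.simple_bochner_integrable (lebesgue_on {a..b}) (\<phi> i) \<and>
     (\<forall>x\<in>{a..b}. norm (f x - \<phi> i x) \<le> 1 / Suc i) \<and>
     norm (Bochner_Integration.simple_bochner_integral (lebesgue_on {a..b}) (\<phi> i) - (F b - F a)) \<le> 1 / Suc i * (b - a)" ..
  have lim: "(\<lambda>i. 1 / Suc i * (b - a)) \<longlonglongrightarrow> 0"
    using tendsto_mult_left_zero[OF LIMSEQ_inverse_real_of_nat, of "b - a"] by (simp add: divide_inverse)
  show ?thesis
    unfolding bochner_integral_is_def
  proof (intro conjI exI[of _ \<phi>] allI)
    have "f \<in> borel_measurable (restrict_space borel {a..b})"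
      using f by (rule borel_measurable_continuous_on_restrict)
    moreover have "borel_measurable (restrict_space borel {a..b}) \<subseteq> (borel_measurable (lebesgue_on {a..b}) :: (real \<Rightarrow> 'v) set)"
    proof (rule measurable_mono)
      have "A \<in> sets lebesgue" if "A \<in> sets borel" for A :: "real set"
        using that by (intro sets_completionI_sets) simp
      then show "sets (restrict_space borel {a..b}) \<subseteq> sets (lebesgue_on {a..b})"
        unfolding sets_restrict_space by (intro image_mono subsetI)
    qed (simp_all add: space_restrict_space)
    ultimately show "f \<in> borel_measurable (lebesgue_on {a..b})" by blast
    show "Bochner_Integration.simple_bochner_integrable (lebesgue_on {a..b}) (\<phi> i)" for i using \<phi> by blast
    show "(\<lambda>i. \<integral>\<^sup>+x. ennreal (norm (f x - \<phi> i x)) \<partial>lebesgue_on {a..b}) \<longlonglongrightarrow> 0"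
    proof (rule tendsto_sandwich[OF _ _ tendsto_const])
      show "\<forall>\<^sub>F i in sequentially. (\<integral>\<^sup>+x. ennreal (norm (f x - \<phi> i x)) \<partial>lebesgue_on {a..b}) \<le> ennreal (1 / Suc i * (b - a))"
      proof (intro always_eventually allI)
        fix i
        have "(\<integral>\<^sup>+x. ennreal (norm (f x - \<phi> i x)) \<partial>lebesgue_on {a..b}) \<le> (\<integral>\<^sup>+x. ennreal (1 / Suc i) \<partial>lebesgue_on {a..b})"
          using \<phi> by (intro nn_integral_mono) (simp add: ennreal_leI)
        also have "\<dots> = ennreal (1 / Suc i) * ennreal (b - a)"
          using ab by (simp add: emeasure_restrict_space)
        also have "\<dots> = ennreal (1 / Suc i * (b - a))" using ab by (intro ennreal_mult[symmetric]) auto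
        finally show "(\<integral>\<^sup>+x. ennreal (norm (f x - \<phi> i x)) \<partial>lebesgue_on {a..b}) \<le> ennreal (1 / Suc i * (b - a))" .
      qed
      show "(\<lambda>i. ennreal (1 / Suc i * (b - a))) \<longlonglongrightarrow> 0"
        using tendsto_ennrealI[OF lim] by simp
    qed auto
    show "(\<lambda>i. Bochner_Integration.simple_bochner_integral (lebesgue_on {a..b}) (\<phi> i)) \<longlonglongrightarrow> F b - F a"
    proof (rule LIM_zero_cancel)
      show "(\<lambda>i. Bochner_Integration.simple_bochner_integral (lebesgue_on {a..b}) (\<phi> i) - (F b - F a)) \<longlonglongrightarrow> 0"
        by (rule Lim_null_comparison[OF _ lim]) (use \<phi> in auto)
    qed
  qed
qed

section \<open>Contraction groups and powers of the generator\<close>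

context
  fixes DB :: "'v::{real_inner, complete_space} set" and B :: "'v \<Rightarrow> 'v" and G :: "real \<Rightarrow> 'v \<Rightarrow>\<^sub>L 'v"
  assumes group: "strongly_continuous_group G" and gen: "infinitesimal_generator DB B G"
    and contr: "\<And>x. norm (G x) \<le> 1"
begin

lemma group_apply_add: "G (x + y) v = G x (G y v)" and group_apply_0: "G 0 v = v"
  and group_cont: "continuous_on UNIV (\<lambda>x. G x v)"
  using group by (auto simp: strongly_continuous_group_def)

lemma group_inverse: "G (- x) (G x v) = v" "G x (G (- x) v) = v"
  using group_apply_add[of "-x" x v] group_apply_add[of x "-x" v] by (simp_all add: group_apply_0)

lemma group_norm_le: "norm (G x v) \<le> norm v"
  using norm_blinfun[of "G x" v] contr[of x] mult_right_mono[of "norm (G x)" 1 "norm v"] by simp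

lemma group_isometry: "norm (G x v) = norm v"
  using group_norm_le[of x v] group_norm_le[of "-x" "G x v"] by (simp add: group_inverse)

lemma group_Lipschitz: "norm (G x v - G x w) \<le> 1 * norm (v - w)"
  by (simp add: blinfun.diff_right[symmetric] group_isometry)

lemma group_continuous_comp:
  assumes "continuous_on A \<omega>" "continuous_on A g"
  shows "continuous_on A (\<lambda>t. G (\<omega> t) (g t))"
  by (rule continuous_on_Lipschitz_family[where F = "\<lambda>t. G (\<omega> t)", OF _ group_Lipschitz assms(2)])
     (rule continuous_on_compose2[OF group_cont assms(1)], simp)

lemma generator_limit: "v \<in> DB \<Longrightarrow> ((\<lambda>h. (1 / h) *\<^sub>R (G h v - v)) \<longlongrightarrow> B v) (at 0)"
  using gen by (simp add: infinitesimal_generator_def)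

lemma generator_group:
  assumes v: "v \<in> DB"
  shows "G x v \<in> DB" "B (G x v) = G x (B v)"
proof -
  have "((\<lambda>h. G x ((1 / h) *\<^sub>R (G h v - v))) \<longlongrightarrow> G x (B v)) (at 0)"
    by (intro blinfun.tendsto tendsto_const generator_limit v)
  moreover have "G x ((1 / h) *\<^sub>R (G h v - v)) = (1 / h) *\<^sub>R (G h (G x v) - G x v)" for h
    by (simp add: blinfun.scaleR_right blinfun.diff_right group_apply_add[symmetric] add.commute)
  ultimately have lim: "((\<lambda>h. (1 / h) *\<^sub>R (G h (G x v) - G x v)) \<longlongrightarrow> G x (B v)) (at 0)" by simp
  then show D: "G x v \<in> DB" using gen unfolding infinitesimal_generator_def by blast
  show "B (G x v) = G x (B v)"
    using tendsto_unique[OF _ generator_limit[OF D] lim] by simp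
qed

lemma group_derivative:
  assumes v: "v \<in> DB"
  shows "((\<lambda>x. G x v) has_vector_derivative G x (B v)) (at x)"
proof -
  have "((\<lambda>h. G x ((1 / h) *\<^sub>R (G h v - v))) \<longlongrightarrow> G x (B v)) (at 0)"
    by (intro blinfun.tendsto tendsto_const generator_limit v)
  moreover have "G x ((1 / h) *\<^sub>R (G h v - v)) = (G (x + h) v - G x v) /\<^sub>R h" for h
    by (simp add: blinfun.scaleR_right blinfun.diff_right group_apply_add[symmetric] divide_inverse)
  ultimately have "((\<lambda>h. (G (x + h) v - G x v) /\<^sub>R h) \<longlongrightarrow> G x (B v)) (at 0)" by simp
  then have lim: "((\<lambda>h. norm ((G (x + h) v - G x v) /\<^sub>R h - G x (B v))) \<longlongrightarrow> 0) (at 0)"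
    by (intro tendsto_norm_zero LIM_zero)
  have "norm (G (x + h) v - G x v - h *\<^sub>R G x (B v)) / norm h = norm ((G (x + h) v - G x v) /\<^sub>R h - G x (B v))"
    if "h \<noteq> 0" for h
  proof -
    have "G (x + h) v - G x v - h *\<^sub>R G x (B v) = h *\<^sub>R ((G (x + h) v - G x v) /\<^sub>R h - G x (B v))"
      using that by (simp add: scaleR_diff_right)
    then show ?thesis using that by simp
  qed
  then have "((\<lambda>h. norm (G (x + h) v - G x v - h *\<^sub>R G x (B v)) / norm h) \<longlongrightarrow> 0) (at 0)"
    by (intro Lim_transform_eventually[OF lim]) (simp add: eventually_at_filter)
  then show ?thesis
    unfolding has_vector_derivative_def has_derivative_at by (simp add: bounded_linear_scaleR_left)
qed

text \<open>
  Induction on \<open>k\<close>: \<open>B \<circ> B\<^sup>k \<circ> S\<close> is the pointwise limit of the bounded difference quotients of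
  the group applied to \<open>B\<^sup>k \<circ> S\<close>.
\<close>

lemma generator_powers:
  assumes S: "bounded_linear S" and dom: "\<And>v k. k < p \<Longrightarrow> (B ^^ k) (S v) \<in> DB"
    and comm: "\<And>x v. G x (S v) = S (G x v)"
    and k: "k \<le> p"
  shows "bounded_linear (\<lambda>v. (B ^^ k) (S v))" "(B ^^ k) (S (G x v)) = G x ((B ^^ k) (S v))"
proof -
  have "bounded_linear (\<lambda>v. (B ^^ k) (S v)) \<and> (\<forall>v. (B ^^ k) (S (G x v)) = G x ((B ^^ k) (S v)))"
    using k
  proof (induction k)
    case 0
    then show ?case using S comm by simp
  next
    case (Suc k)
    define h where "h n = inverse (real (Suc n))" for n
    have IH: "bounded_linear (\<lambda>v. (B ^^ k) (S v))" "\<And>v. (B ^^ k) (S (G x v)) = G x ((B ^^ k) (S v))"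
      using Suc by auto
    have dk: "(B ^^ k) (S v) \<in> DB" for v using dom Suc.prems by simp
    have "filterlim h (at 0) sequentially"
      unfolding filterlim_at using LIMSEQ_inverse_real_of_nat
      by (auto simp: h_def[abs_def] simp del: of_nat_Suc)
    then have lim: "(\<lambda>n. (1 / h n) *\<^sub>R (G (h n) ((B ^^ k) (S v)) - (B ^^ k) (S v))) \<longlonglongrightarrow> B ((B ^^ k) (S v))" for v
      by (rule filterlim_compose[OF generator_limit[OF dk]])
    have "bounded_linear (\<lambda>v. B ((B ^^ k) (S v)))"
      by (rule bounded_linear_pointwise_limit[OF _ lim])
        (intro bounded_linear_scaleR_right[THEN bounded_linear_compose] bounded_linear_sub
          bounded_linear_compose[OF blinfun.bounded_linear_right] IH(1))
    moreover have "B ((B ^^ k) (S (G x v))) = G x (B ((B ^^ k) (S v)))" for v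
      using generator_group(2)[OF dk] IH(2) by simp
    ultimately show ?case by simp
  qed
  then show "bounded_linear (\<lambda>v. (B ^^ k) (S v))" "(B ^^ k) (S (G x v)) = G x ((B ^^ k) (S v))" by auto
qed

end

section \<open>The bilinear problem\<close>

lemma dom_power_linear:
  assumes B: "linear_operator DB B"
  shows "k \<le> m \<Longrightarrow> x \<in> dom_power DB B m \<Longrightarrow> y \<in> dom_power DB B m \<Longrightarrow> (B ^^ k) (x + y) = (B ^^ k) x + (B ^^ k) y"
    and "k \<le> m \<Longrightarrow> x \<in> dom_power DB B m \<Longrightarrow> (B ^^ k) (c *\<^sub>R x) = c *\<^sub>R (B ^^ k) x"
proof (induction k)
  case (Suc k)
  note lin = linear_operatorD[OF B]
  {
    case 1
    then have "(B ^^ k) x \<in> DB" "(B ^^ k) y \<in> DB" by (auto simp: dom_power_def)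
    then show ?case using Suc(1) 1 by (simp add: lin)
  next
    case 2
    then have "(B ^^ k) x \<in> DB" by (auto simp: dom_power_def)
    then show ?case using Suc(2) 2 by (simp add: lin)
  }
qed auto

lemma linear_operator_C:
  assumes A: "linear_operator DA A" and B: "linear_operator DB B"
  shows "linear_operator (C_dom DA DB B p) (C_op A B p d t)"
proof -
  note linA = linear_operatorD[OF A] and linB = linear_operatorD[OF B]
  have B0: "(B ^^ k) 0 = 0" for k by (induction k) (simp_all add: linB)
  have "subspace (C_dom DA DB B p)"
    unfolding C_dom_def
  proof (rule subspace_inter)
    show "subspace DA" using A by (simp add: linear_operator_def)
    show "subspace (dom_power DB B p)"
    proof (rule subspaceI)
      show "0 \<in> dom_power DB B p" by (simp add: dom_power_def B0 linB)
      show "x + y \<in> dom_power DB B p" if "x \<in> dom_power DB B p" "y \<in> dom_power DB B p" for x y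
        using that dom_power_linear(1)[OF B _ that] by (auto simp: dom_power_def linB)
      show "c *\<^sub>R x \<in> dom_power DB B p" if "x \<in> dom_power DB B p" for c x
        using that dom_power_linear(2)[OF B _ that] by (auto simp: dom_power_def linB)
    qed
  qed
  then show ?thesis
    unfolding linear_operator_def
  proof (intro conjI ballI allI)
    fix x y assume xy: "x \<in> C_dom DA DB B p" "y \<in> C_dom DA DB B p"
    then show "C_op A B p d t (x + y) = C_op A B p d t x + C_op A B p d t y"
      using dom_power_linear(1)[OF B order_refl, of x p y] linA(6)[of x y]
      by (simp add: C_op_def C_dom_def algebra_simps)
  next
    fix c x assume x: "x \<in> C_dom DA DB B p"
    then show "C_op A B p d t (c *\<^sub>R x) = c *\<^sub>R C_op A B p d t x"
      using dom_power_linear(2)[OF B order_refl, of x p c] linA(8)[of x c]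
      by (simp add: C_op_def C_dom_def algebra_simps)
  qed
qed

lemma bounded_linear_uniform_bound:
  assumes "bounded_linear f"
  shows "\<exists>M\<ge>0. \<forall>x. norm (f x) \<le> M * norm x"
  using bounded_linear.nonneg_bounded[OF assms] by (auto simp: mult.commute)

theorem proposition3p16:
  fixes A B :: "'v::{real_inner, complete_space} \<Rightarrow> 'v"
    and DA DB :: "'v set"
    and T :: real and p :: nat
    and \<pi> :: "nat \<Rightarrow> real set"
    and \<omega> d :: "real \<Rightarrow> real"
    and G :: "real \<Rightarrow> 'v \<Rightarrow>\<^sub>L 'v"
    and j :: "'y::{real_inner, complete_space} \<Rightarrow> 'v"
    and Q :: "'y \<Rightarrow>\<^sub>L 'v"
    and L :: "real \<Rightarrow> 'v \<Rightarrow>\<^sub>L 'v"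
    and lam1 :: real
  defines "DC \<equiv> C_dom DA DB B p"
    and "C \<equiv> C_op A B p d"
  assumes A: "linear_operator DA A"
    and B: "linear_operator DB B"
    and T: "T > 0"
    and p: "even p" "p > 0"
    and partitions: "\<And>n. partition_of 0 T (\<pi> n)"
    and mesh: "(\<lambda>n. mesh (\<pi> n)) \<longlonglongrightarrow> 0"
    and path_cont: "continuous_on {0..T} \<omega>"
    and path_variation: "finite_pth_variation p 0 T \<pi> \<omega>"
    and h1: "\<And>t. t \<in> {0..T} \<Longrightarrow>
               (pth_variation p 0 T \<pi> \<omega> has_real_derivative d t) (at t within {0..T})"
            "continuous_on {0..T} d"
    and h2: "strongly_continuous_group G" "infinitesimal_generator DB B G"
    and h3: "\<And>x. norm (G x) \<le> 1"
    and Y: "dense_embedding j"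
    and h4: "\<And>x. G x ` range j \<subseteq> range j"
    and h5: "\<And>x. bounded_linear (restrict_to j (G x)) \<and> onorm (restrict_to j (G x)) \<le> 1"
    and h6: "range j \<subseteq> DC" "\<And>t. t \<in> {0..T} \<Longrightarrow> closed_operator DC (C t)"
    and h7: "\<And>t. t \<in> {0..T} \<Longrightarrow> {lam1<..} \<subseteq> real_resolvent_set DC (C t)"
            "\<And>t l. t \<in> {0..T} \<Longrightarrow> l > lam1 \<Longrightarrow> onorm (resolvent DC (C t) l) \<le> 1 / (l - lam1)"
    and Q_iso: "bij Q" "bounded_linear (inv Q)"
    and h8a: "\<And>t v. t \<in> {0..T} \<Longrightarrow> v \<in> DC \<Longrightarrow> C t (j (inv Q v)) \<in> range j"
    and h8b: "\<And>x y. Q (restrict_to j (G x) y) = G x (Q y)"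
    and L: "\<And>v. continuous_on {0..T} (\<lambda>t. L t v)"
    and h8: "\<And>t v. t \<in> {0..T} \<Longrightarrow> v \<in> DC \<Longrightarrow>
               Q (inv j (C t (j (inv Q v)))) = C t v + L t v"
  shows "\<forall>s\<in>{0..<T}. \<forall>x0\<in>range j.
           \<exists>X. strong_solution DA A DB B p \<pi> \<omega> s T x0 X \<and> (\<forall>t\<in>{s..T}. X t \<in> range j)"
proof (intro ballI)
  fix s x0 assume s: "s \<in> {0..<T}" and x0: "x0 \<in> range j"
  have sT: "s < T" using s by simp
  have sub: "{s..T} \<subseteq> {0..T}" using s by auto
  have sub_in: "t \<in> {0..T}" if "t \<in> {s..T}" for t using that sub by blast
  interpret path: variation_path p T \<pi> \<omega> d
    using T p partitions path_cont path_variation h1 by unfold_locales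
  have p2: "2 \<le> p" using p by (auto elim: evenE)

  \<comment> \<open>The range of \<open>S\<close> is the embedded space; working with \<open>S\<close> keeps all estimates in \<open>V\<close>.\<close>
  have j: "bounded_linear j" "inj j" "closure (range j) = UNIV" using Y by (auto simp: dense_embedding_def)
  define S where "S v = j (inv Q v)" for v
  have S_bl: "bounded_linear S" unfolding S_def using j(1) Q_iso(2) by (rule bounded_linear_compose)
  have surjQ: "range (inv Q) = UNIV" using Q_iso(1) by (simp add: bij_is_surj bij_imp_bij_inv)
  have rangeS: "range S = range j"
  proof -
    have "range S = j ` range (inv Q)" unfolding S_def[abs_def] by (simp only: image_image)
    then show ?thesis by (simp only: surjQ)
  qed
  have S_dense: "closure (range S) = UNIV" using j(3) rangeS by simp
  have S_DC: "S v \<in> DC" for v using h6(1) rangeS by blast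
  have invQ: "inv Q (Q y) = y" for y using Q_iso(1) by (simp add: bij_is_inj)
  have invj: "j (inv j v) = v" if "v \<in> range j" for v using that by (rule f_inv_into_f)
  have GS: "G x (S v) = S (G x v)" for x v
  proof -
    have "Q (inv Q v) = v" using Q_iso(1) by (simp add: bij_is_surj surj_f_inv_f)
    then have "Q (inv j (G x (S v))) = G x v"
      using h8b[of x "inv Q v"] by (simp add: restrict_to_def S_def)
    then have "inv j (G x (S v)) = inv Q (G x v)" using invQ by metis
    moreover have "G x (S v) \<in> range j" using h4[of x] rangeS by blast
    ultimately show ?thesis using invj S_def by metis
  qed
  have CS: "C t (S v) = S (C t v + L t v)" if t: "t \<in> {0..T}" and v: "v \<in> DC" for t v
  proof -
    have "inv j (C t (S v)) = inv Q (C t v + L t v)" using h8[OF t v] invQ S_def by metis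
    moreover have "C t (S v) \<in> range j" using h8a[OF t v] by (simp add: S_def)
    ultimately show ?thesis using invj S_def by metis
  qed

  \<comment> \<open>A nonnegative bound \<open>\<kappa>\<close> is needed for the Yosida estimates; enlarging \<open>lam1\<close> weakens (h7).\<close>
  define \<kappa> where "\<kappa> = max 0 lam1"
  have \<kappa>: "\<kappa> \<ge> 0" "\<kappa> \<ge> lam1" by (auto simp: \<kappa>_def)
  have C_lin: "linear_operator DC (C t)" for t
    unfolding DC_def C_def by (rule linear_operator_C[OF A B])
  have C_res: "bij_betw (\<lambda>v. n *\<^sub>R v - C t v) DC UNIV \<and> bounded_linear (resolvent DC (C t) n)"
    if "t \<in> {0..T}" "n > \<kappa>" for t n
    using h7(1)[OF that(1)] that(2) \<kappa> by (force simp: real_resolvent_set_def)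
  have C_low: "(n - \<kappa>) * norm v \<le> norm (n *\<^sub>R v - C t v)"
    if t: "t \<in> {0..T}" and n: "n > \<kappa>" and v: "v \<in> DC" for t n v
  proof -
    have "v = resolvent DC (C t) n (n *\<^sub>R v - C t v)"
      unfolding resolvent_def
      using the_inv_into_f_f[of "\<lambda>v. n *\<^sub>R v - C t v" DC v] C_res[OF t n] v by (simp add: bij_betw_def)
    then have "norm v \<le> onorm (resolvent DC (C t) n) * norm (n *\<^sub>R v - C t v)"
      using onorm[of "resolvent DC (C t) n" "n *\<^sub>R v - C t v"] C_res[OF t n] by simp
    also have "\<dots> \<le> 1 / (n - lam1) * norm (n *\<^sub>R v - C t v)"
      using h7(2)[OF t, of n] n \<kappa> by (intro mult_right_mono) auto
    also have "\<dots> \<le> 1 / (n - \<kappa>) * norm (n *\<^sub>R v - C t v)"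
      using n \<kappa> by (intro mult_right_mono divide_left_mono mult_pos_pos) auto
    finally show ?thesis using n by (simp add: field_simps)
  qed
  have C_surj: "\<exists>v\<in>DC. n *\<^sub>R v - C t v = x" if "t \<in> {0..T}" "n > \<kappa>" for t n x
  proof -
    have "x \<in> (\<lambda>v. n *\<^sub>R v - C t v) ` DC" using C_res[OF that] by (simp add: bij_betw_def)
    then show ?thesis by (elim imageE) (intro bexI, simp_all)
  qed
  have C_md: "m_dissipative \<kappa> DC (C t)" if "t \<in> {0..T}" for t
    using C_lin C_low[OF that] C_surj[OF that] by (rule m_dissipativeI)

  note group = h2 h3
  have Bdom: "(B ^^ k) (S v) \<in> DB" if "k < p" for k v
    using S_DC[of v] that by (auto simp: DC_def C_dom_def dom_power_def)
  note Bpow = generator_powers[OF group S_bl Bdom GS]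
  define b where "b k v = (B ^^ k) (S v)" for k v
  have b_bl: "bounded_linear (b k)" if "k \<le> p" for k
    unfolding b_def by (rule Bpow(1)[OF _ that])
  have bG: "b k (G x v) = G x (b k v)" if "k \<le> p" for k x v
    unfolding b_def by (rule Bpow(2)[OF _ that])
  have b_DB: "b k v \<in> DB" if "k < p" for k v unfolding b_def by (rule Bdom[OF that])
  have bS: "b (Suc k) v = B (b k v)" for k v by (simp add: b_def)
  define a where "a v = A (S v)" for v
  have CSa: "C t (S v) = a v - ((1 / fact p) * d t) *\<^sub>R b p v" for t v
    by (simp add: C_def C_op_def a_def b_def)
  have a_bl: "bounded_linear a"
  proof -
    have "bounded_linear (\<lambda>v. C 0 (S v))"
      using T S_DC by (intro bounded_linear_dissipative_comp[OF C_md \<kappa>(1) S_bl S_dense]) auto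
    then have "bounded_linear (\<lambda>v. C 0 (S v) + ((1 / fact p) * d 0) *\<^sub>R b p v)"
      by (intro bounded_linear_add bounded_linear_compose[OF bounded_linear_scaleR_right] b_bl) auto
    then show ?thesis by (simp add: CSa)
  qed

  \<comment> \<open>Conjugation by the isometries \<open>G (\<omega> t)\<close> preserves dissipativity and the commutator
    identity, but \<open>t \<mapsto> K t (S v)\<close> is continuous only for fixed \<open>v\<close>.\<close>
  define Dt where "Dt t = {v. G (\<omega> t) v \<in> DC}" for t
  define K where "K t v = G (- \<omega> t) (C t (G (\<omega> t) v))" for t v
  define Lh where "Lh t v = G (- \<omega> t) (L t (G (\<omega> t) v))" for t v
  note inverse = group_inverse[OF group] and isometry = group_isometry[OF group]
    and cont_comp = group_continuous_comp[OF group]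
  note C_linD = linear_operatorD[OF C_lin]
  have \<omega>c: "continuous_on {s..T} \<omega>" using path_cont sub by (rule continuous_on_subset)
  have K_md: "m_dissipative \<kappa> (Dt t) (K t)" if t: "t \<in> {s..T}" for t
  proof (rule m_dissipativeI)
    have t': "t \<in> {0..T}" using sub_in[OF t] .
    show "linear_operator (Dt t) (K t)"
      unfolding linear_operator_def Dt_def K_def subspace_def
      by (simp add: C_linD blinfun.add_right blinfun.scaleR_right blinfun.zero_right)
    show "(n - \<kappa>) * norm v \<le> norm (n *\<^sub>R v - K t v)" if n: "n > \<kappa>" and v: "v \<in> Dt t" for n v
    proof -
      have "n *\<^sub>R v - K t v = G (- \<omega> t) (n *\<^sub>R G (\<omega> t) v - C t (G (\<omega> t) v))"
        by (simp add: K_def blinfun.diff_right blinfun.scaleR_right inverse)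
      then show ?thesis using C_low[OF t' n, of "G (\<omega> t) v"] v by (simp add: isometry Dt_def)
    qed
    show "\<exists>v\<in>Dt t. n *\<^sub>R v - K t v = x" if n: "n > \<kappa>" for n x
    proof -
      obtain u where u: "u \<in> DC" "n *\<^sub>R u - C t u = G (\<omega> t) x" using C_surj[OF t' n] by blast
      have "n *\<^sub>R G (- \<omega> t) u - K t (G (- \<omega> t) u) = G (- \<omega> t) (n *\<^sub>R u - C t u)"
        by (simp add: K_def blinfun.diff_right blinfun.scaleR_right inverse)
      then have "n *\<^sub>R G (- \<omega> t) u - K t (G (- \<omega> t) u) = x" using u(2) by (simp add: inverse)
      moreover have "G (- \<omega> t) u \<in> Dt t" using u(1) by (simp add: Dt_def inverse)
      ultimately show ?thesis by blast
    qed
  qed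
  have KS: "K t (S v) = G (- \<omega> t) (a (G (\<omega> t) v) - ((1 / fact p) * d t) *\<^sub>R b p (G (\<omega> t) v))" for t v
    unfolding K_def GS CSa ..
  have dc: "continuous_on {s..T} d" using h1(2) sub by (rule continuous_on_subset)
  have KS_cont: "continuous_on {s..T} (\<lambda>t. K t (S (v t)))" if v: "continuous_on {s..T} v" for v
  proof -
    have Gv: "continuous_on {s..T} (\<lambda>t. G (\<omega> t) (v t))" by (intro cont_comp \<omega>c v)
    show ?thesis
      unfolding KS
      by (intro cont_comp continuous_intros \<omega>c dc bounded_linear.continuous_on[OF a_bl Gv]
          bounded_linear.continuous_on[OF b_bl[OF order_refl] Gv])
  qed
  obtain Ma where Ma: "Ma \<ge> 0" "\<forall>v. norm (a v) \<le> Ma * norm v"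
    using bounded_linear_uniform_bound[OF a_bl] by blast
  obtain Mb where Mb: "Mb \<ge> 0" "\<forall>v. norm (b p v) \<le> Mb * norm v"
    using bounded_linear_uniform_bound[OF b_bl[OF order_refl]] by blast
  have "bounded (d ` {s..T})" by (intro compact_imp_bounded compact_continuous_image dc compact_Icc)
  then obtain d0 where d0: "\<forall>x\<in>d ` {s..T}. norm x \<le> d0" unfolding bounded_iff by blast
  have d0': "\<bar>(1 / fact p) * d t\<bar> \<le> d0" if "t \<in> {s..T}" for t
  proof -
    have "\<bar>d t\<bar> \<le> d0" using d0 that by simp
    moreover have "\<bar>(1 / fact p) * d t\<bar> \<le> 1 * \<bar>d t\<bar>"
      unfolding abs_mult by (intro mult_right_mono) (auto simp: fact_ge_1)
    ultimately show ?thesis by simp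
  qed
  have d0_nonneg: "d0 \<ge> 0" by (rule order_trans[OF abs_ge_zero d0'[of s]]) (use sT in auto)
  have "\<exists>l\<ge>0. \<forall>t\<in>{0..T}. \<forall>v. norm (L t v) \<le> l * norm v"
  proof (rule uniform_boundedness)
    show "bounded_linear (L t)" for t by (rule blinfun.bounded_linear_right)
    fix v
    have "bounded ((\<lambda>t. L t v) ` {0..T})" by (intro compact_imp_bounded compact_continuous_image L compact_Icc)
    then show "\<exists>c. \<forall>t\<in>{0..T}. norm (L t v) \<le> c" unfolding bounded_iff by blast
  qed
  then obtain l where l: "l \<ge> 0" "\<forall>t\<in>{0..T}. \<forall>v. norm (L t v) \<le> l * norm v" by blast

  interpret kato: kato_family s T \<kappa> l "Ma + d0 * Mb" Dt K S Lh
  proof unfold_locales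
    show "s < T" by (rule sT)
    show "\<kappa> \<ge> 0" by (rule \<kappa>)
    show "l \<ge> 0" by (rule l)
    show "Ma + d0 * Mb \<ge> 0" using Ma Mb d0_nonneg by auto
    show "\<And>x y. S (x + y) = S x + S y" "\<And>c x. S (c *\<^sub>R x) = c *\<^sub>R S x"
      using S_bl by (auto simp: linear_add linear_cmul bounded_linear.linear)
    show "\<exists>K. \<forall>x. norm (S x) \<le> norm x * K" using S_bl by (rule bounded_linear.bounded)
    show "closure (range S) = UNIV" by (rule S_dense)
    show "continuous_on {s..T} (\<lambda>t. K t (S x))" for x
      by (rule KS_cont) (rule continuous_on_const)
    show "continuous_on {s..T} (\<lambda>t. Lh t x)" for x
    proof -
      have "continuous_on {s..T} (\<lambda>t. L t (G (\<omega> t) x))"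
      proof (rule continuous_on_Lipschitz_family[where F = "\<lambda>t. L t" and c = l])
        show "continuous_on {s..T} (\<lambda>t. L t v)" for v using L sub by (rule continuous_on_subset)
        show "norm (L t v - L t w) \<le> l * norm (v - w)" if "t \<in> {s..T}" for t v w
          using l(2) sub_in[OF that] by (simp add: blinfun.diff_right[symmetric])
        show "continuous_on {s..T} (\<lambda>t. G (\<omega> t) x)" by (intro cont_comp \<omega>c continuous_on_const)
      qed
      then show ?thesis unfolding Lh_def by (intro cont_comp continuous_on_minus \<omega>c)
    qed
    fix t assume t: "t \<in> {s..T}"
    show "m_dissipative \<kappa> (Dt t) (K t)" by (rule K_md[OF t])
    show "S x \<in> Dt t" for x using S_DC by (simp add: Dt_def GS)
    show "norm (K t (S x)) \<le> (Ma + d0 * Mb) * norm x" for x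
    proof -
      let ?g = "G (\<omega> t) x"
      have "norm (K t (S x)) \<le> norm (a ?g) + norm (((1 / fact p) * d t) *\<^sub>R b p ?g)"
        unfolding KS isometry by (rule norm_triangle_ineq4)
      also have "norm (a ?g) \<le> Ma * norm x" using Ma(2)[rule_format, of ?g] by (simp add: isometry)
      also have "norm (((1 / fact p) * d t) *\<^sub>R b p ?g) \<le> d0 * (Mb * norm x)"
        unfolding norm_scaleR using d0'[OF t] Mb(2)[rule_format, of ?g] d0_nonneg
        by (intro mult_mono) (auto simp: isometry)
      finally show ?thesis by (simp add: algebra_simps)
    qed
    show "Lh t (x + y) = Lh t x + Lh t y" "Lh t (c *\<^sub>R x) = c *\<^sub>R Lh t x" for x y c
      by (simp_all add: Lh_def blinfun.add_right blinfun.scaleR_right)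
    show "norm (Lh t x) \<le> l * norm x" for x
      using l(2) sub_in[OF t] isometry by (metis Lh_def)
    show "K t (S v) = S (K t v + Lh t v)" if v: "v \<in> Dt t" for v
    proof -
      have "K t (S v) = G (- \<omega> t) (S (C t (G (\<omega> t) v) + L t (G (\<omega> t) v)))"
        using v CS[OF sub_in[OF t], of "G (\<omega> t) v"] by (simp add: K_def GS Dt_def)
      then show ?thesis by (simp add: GS K_def Lh_def blinfun.add_right)
    qed
  qed

  obtain y0 where y0: "x0 = j y0" using x0 by blast
  obtain w where wc: "continuous_on {s..T} w" and ws: "w s = G (- \<omega> s) (Q y0)"
    and w': "\<forall>t\<in>{s..T}. ((\<lambda>t. S (w t)) has_vector_derivative K t (S (w t))) (at t within {s..T})"
    using kato.evolution_exists by blast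
  define X where "X t = G (\<omega> t) (S (w t))" for t
  define f where "f t x = G x (S (w t))" for t x
  define E where "E k t x = G x (b k (w t))" for k t x
  define g where "g t x = G x (K t (S (w t)))" for t x
  have X_S: "X t = S (G (\<omega> t) (w t))" for t by (simp add: X_def GS)
  have X_range: "X t \<in> range j" for t using X_S rangeS by auto
  have Xs: "X s = x0" by (simp add: X_S ws inverse y0 S_def invQ)

  have E_deriv: "(E k t has_vector_derivative E (Suc k) t x) (at x)" if "k < p" for k t x
    using group_derivative[OF group b_DB[OF that]] unfolding E_def[abs_def] bS .
  have E0: "E 0 = f" by (simp add: E_def f_def b_def fun_eq_iff)
  have partial: "(partial2 ^^ k) f = E k" if "k \<le> p" for k
    using that
  proof (induction k)
    case (Suc k)
    then have "(partial2 ^^ Suc k) f = partial2 (E k)" by simp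
    also have "\<dots> = E (Suc k)"
      using vector_derivative_at[OF E_deriv[of k]] Suc.prems by (simp add: partial2_def fun_eq_iff)
    finally show ?case .
  qed (simp add: E0)
  have joint: "continuous_on ({s..T} \<times> UNIV) (\<lambda>(t, x). G x (h t))" if "continuous_on {s..T} h" for h
    unfolding case_prod_unfold
    by (intro cont_comp continuous_intros continuous_on_compose2[OF that]) auto
  have bc: "continuous_on {s..T} (\<lambda>t. b k (w t))" if "k \<le> p" for k
    using bounded_linear.continuous_on[OF b_bl[OF that] wc] .
  have KSc: "continuous_on {s..T} (\<lambda>t. K t (S (w t)))"
    by (rule KS_cont[OF wc])
  have E_cont: "continuous_on ({s..T} \<times> UNIV) (\<lambda>(t, x). E k t x)" if "k \<le> p" for k
    using joint[OF bc[OF that]] by (simp add: E_def)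
  have g_cont: "continuous_on ({s..T} \<times> UNIV) (\<lambda>(t, x). g t x)"
    using joint[OF KSc] by (simp add: g_def)
  have g: "((\<lambda>r. f r x) has_vector_derivative g t x) (at t within {s..T})" if "t \<in> {s..T}" for t x
    unfolding f_def g_def
    by (rule bounded_linear.has_vector_derivative[OF blinfun.bounded_linear_right w'[rule_format, OF that]])
  have f_C1p: "f \<in> C1p p s T"
    unfolding C1p_def
  proof (intro CollectI conjI exI[of _ g] ballI allI impI)
    show "continuous_on ({s..T} \<times> UNIV) (\<lambda>(t, x). f t x)" using E_cont[of 0] by (simp add: E0)
    show "continuous_on ({s..T} \<times> UNIV) (\<lambda>(t, x). g t x)" by (fact g_cont)
    show "((\<lambda>r. f r x) has_vector_derivative g t x) (at t)" if "t \<in> {s<..<T}" for t x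
      using g[of t x] that by (simp add: at_within_Icc_at)
    show "((partial2 ^^ k) f t) differentiable (at x)" if "k < p" for k t x
      using E_deriv[OF that] partial[of k] that by (metis differentiableI_vector less_imp_le)
    show "continuous_on ({s..T} \<times> UNIV) (\<lambda>(t, x). (partial2 ^^ p) f t x)"
      using E_cont[of p] by (simp add: partial)
  qed

  \<comment> \<open>\<open>ZA\<close> carries the drift term; subtracting the variation term gives the
    antiderivative of \<open>\<partial>\<^sub>1f t (\<omega> t)\<close> that the change of variables formula asks for.\<close>
  have AX: "A (X t) = a (G (\<omega> t) (w t))" for t by (simp add: X_S a_def)
  have AXc: "continuous_on {s..T} (\<lambda>t. A (X t))"
    unfolding AX by (intro bounded_linear.continuous_on[OF a_bl] cont_comp \<omega>c wc)
  have BXc: "continuous_on {s..T} (\<lambda>t. d t *\<^sub>R E p t (\<omega> t))"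
    unfolding E_def by (intro continuous_intros cont_comp dc \<omega>c bc order_refl)
  obtain ZA where ZA: "\<forall>t\<in>{s..T}. (ZA has_vector_derivative A (X t)) (at t within {s..T})"
    using antiderivative_exists[OF AXc, of 0] by blast
  obtain \<Psi> where \<Psi>: "\<forall>t\<in>{s..T}. (\<Psi> has_vector_derivative d t *\<^sub>R E p t (\<omega> t)) (at t within {s..T})"
    using antiderivative_exists[OF BXc, of 0] by blast
  define Z where "Z t = ZA t - (1 / fact p) *\<^sub>R \<Psi> t" for t
  have Z: "(Z has_vector_derivative g t (\<omega> t)) (at t within {s..T})" if t: "t \<in> {s..T}" for t
  proof -
    have "g t (\<omega> t) = A (X t) - (1 / fact p) *\<^sub>R (d t *\<^sub>R E p t (\<omega> t))"
      by (simp add: g_def KS inverse AX E_def bG)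
    then show ?thesis unfolding Z_def[abs_def]
      using ZA \<Psi> t by (auto intro!: derivative_eq_intros bounded_linear.has_vector_derivative[OF bounded_linear_scaleR_right])
  qed
  have int_A: "bochner_integral_is (lebesgue_on {s..t}) (\<lambda>r. A (X r)) (ZA t - ZA s)" if t: "t \<in> {s<..T}" for t
  proof (rule bochner_integral_is_antiderivative)
    have st: "{s..t} \<subseteq> {s..T}" using t by auto
    show "s < t" using t by simp
    show "continuous_on {s..t} (\<lambda>r. A (X r))" using AXc st by (rule continuous_on_subset)
    show "(ZA has_vector_derivative A (X r)) (at r within {s..t})" if "r \<in> {s..t}" for r
      using ZA[rule_format, of r] that st by (intro has_vector_derivative_within_subset[OF _ st]) auto
  qed
  have int_B: "has_pathwise_integral p (partitions_from s T \<pi>) f \<omega> t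
      (f t (\<omega> t) - f s (\<omega> s) - (Z t - Z s) - (1 / fact p) *\<^sub>R (\<Psi> t - \<Psi> s))" if t: "t \<in> {s<..T}" for t
    unfolding E0[symmetric]
  proof (rule path.pathwise_Ito_formula[OF s t, where g = g and D = E])
    show "(partial2 ^^ k) (E 0) r = E k r" if "k < p" for k r
      using partial[of k] that by (simp add: E0)
    show "((\<lambda>r. E 0 r x) has_vector_derivative g r x) (at r within {s..T})" if "r \<in> {s..T}" for r x
      using g[OF that] by (simp add: E0)
  qed (use E_deriv E_cont g_cont Z \<Psi> in auto)

  have "strong_solution DA A DB B p \<pi> \<omega> s T x0 X"
    unfolding strong_solution_def
  proof (intro conjI ballI bexI[of _ f])
    show "X s = x0" by (rule Xs)
    show "X r \<in> DA \<inter> DB" for r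
      using S_DC b_DB[of 0] p by (simp add: X_S b_def DC_def C_dom_def)
    show "\<exists>I. bochner_integral_is (lebesgue_on {s..T}) (\<lambda>r. A (X r)) I"
      using int_A[of T] sT by auto
    show "f \<in> C1p p s T" by (rule f_C1p)
    show "B (X r) = partial2 f r (\<omega> r)" for r
    proof -
      have "partial2 f r (\<omega> r) = E 1 r (\<omega> r)" using partial[of 1] p2 by simp
      also have "\<dots> = b 1 (G (\<omega> r) (w r))" using p2 by (simp add: E_def bG)
      finally show ?thesis by (simp add: b_def X_S)
    qed
    fix t assume t: "t \<in> {s<..T}"
    have "X t = x0 + (ZA t - ZA s) + (f t (\<omega> t) - f s (\<omega> s) - (Z t - Z s) - (1 / fact p) *\<^sub>R (\<Psi> t - \<Psi> s))"
      using Xs by (simp add: Z_def f_def X_def algebra_simps)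
    then show "\<exists>I J. bochner_integral_is (lebesgue_on {s..t}) (\<lambda>r. A (X r)) I \<and>
        has_pathwise_integral p (partitions_from s T \<pi>) f \<omega> t J \<and> X t = x0 + I + J"
      using int_A[OF t] int_B[OF t] by blast
  qed
  then show "\<exists>X. strong_solution DA A DB B p \<pi> \<omega> s T x0 X \<and> (\<forall>t\<in>{s..T}. X t \<in> range j)"
    using X_range by blast
qed

end
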